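(* Let $G\times M\to M$ be a proper (smooth) action of a Lie group $G$ on a manifold $M$. Then the space of points $X_{C^\infty(M)^G}$ of the $C^\infty$-ring $C^\infty(M)^G$ of $G$-invariant smooth functions is homeomorphic to the orbit space $M/G$.
   Context: Manifolds are smooth, Hausdorff and second countable; $M/G$ carries the quotient topology. $C^\infty(M)$ is a $C^\infty$-ring, i.e. a set with an operation for each $f\in C^\infty(\mathbb{R}^n)$, $n\ge 0$, here given by $f_{C^\infty(M)}(a_1,\ldots,a_n)=f\circ(a_1,\ldots,a_n)$; $C^\infty(M)^G$ is a $C^\infty$-subring (a subset closed under all operations). A map of $C^\infty$-rings is a function preserving all these operations. For a $C^\infty$-ring $\mathscr{A}$, the space of points $X_{\mathscr{A}}=\mathrm{Hom}(\mathscr{A},\mathbb{R})$ is the set of all $C^\infty$-ring maps $\mathscr{A}\to\mathbb{R}$, with the topology having as a basis the sets $\{x\in X_{\mathscr{A}}\mid x(a)\neq 0\}$, $a\in\mathscr{A}$. *)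

theory Defs
  imports "HOL-Analysis.Analysis" "HOL-Algebra.Group_Action"
begin

text \<open>
  Points of \<open>\<real>\<^sup>n\<close> are the elements of the topological space \<^const>\<open>Euclidean_space\<close>,
  i.e. sequences of reals vanishing from index \<open>n\<close> on; this keeps \<open>n\<close> a term and includes
  \<open>n = 0\<close>.
\<close>

section \<open>Smooth functions on open subsets of Euclidean space\<close>

abbreviation Rn :: "nat \<Rightarrow> (nat \<Rightarrow> real) set" where
  "Rn n \<equiv> topspace (Euclidean_space n)"

definition partial_deriv :: "nat \<Rightarrow> ((nat \<Rightarrow> real) \<Rightarrow> real) \<Rightarrow> (nat \<Rightarrow> real) \<Rightarrow> real" where
  "partial_deriv i f x = deriv (\<lambda>t. f (x(i := t))) (x i)"

text \<open>Intended for sets \<open>U\<close> that are open in \<open>\<real>\<^sup>n\<close>.\<close>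

primrec Ck_on :: "nat \<Rightarrow> nat \<Rightarrow> (nat \<Rightarrow> real) set \<Rightarrow> ((nat \<Rightarrow> real) \<Rightarrow> real) \<Rightarrow> bool" where
  "Ck_on n 0 U f \<longleftrightarrow>
     continuous_map (subtopology (Euclidean_space n) U) euclideanreal f"
| "Ck_on n (Suc k) U f \<longleftrightarrow>
     continuous_map (subtopology (Euclidean_space n) U) euclideanreal f \<and>
     (\<forall>i<n. (\<forall>x\<in>U. (\<lambda>t. f (x(i := t))) field_differentiable at (x i)) \<and>
            Ck_on n k U (partial_deriv i f))"

definition smooth_on :: "nat \<Rightarrow> (nat \<Rightarrow> real) set \<Rightarrow> ((nat \<Rightarrow> real) \<Rightarrow> real) \<Rightarrow> bool" where
  "smooth_on n U f \<longleftrightarrow> (\<forall>k. Ck_on n k U f)"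

definition Cinf_Rn :: "nat \<Rightarrow> ((nat \<Rightarrow> real) \<Rightarrow> real) set" where
  "Cinf_Rn n = {f \<in> extensional (Rn n). smooth_on n (Rn n) f}"


section \<open>Manifolds\<close>

text \<open>A chart is a pair of its domain and a map into \<open>\<real>\<^sup>n\<close>; the atlas need not be maximal.\<close>

record 'a manifold =
  mtop :: "'a topology"
  mdim :: nat
  atlas :: "('a set \<times> ('a \<Rightarrow> nat \<Rightarrow> real)) set"

abbreviation points :: "('a, 'z) manifold_scheme \<Rightarrow> 'a set" where
  "points M \<equiv> topspace (mtop M)"

definition smooth_manifold :: "('a, 'z) manifold_scheme \<Rightarrow> bool" where
  "smooth_manifold M \<longleftrightarrow>
     Hausdorff_space (mtop M) \<and> second_countable (mtop M) \<and>
     (\<Union>(U, \<phi>)\<in>atlas M. U) = points M \<and>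
     (\<forall>(U, \<phi>)\<in>atlas M.
        openin (mtop M) U \<and> openin (Euclidean_space (mdim M)) (\<phi> ` U) \<and>
        homeomorphic_map (subtopology (mtop M) U)
          (subtopology (Euclidean_space (mdim M)) (\<phi> ` U)) \<phi>) \<and>
     (\<forall>(U, \<phi>)\<in>atlas M. \<forall>(V, \<psi>)\<in>atlas M. \<forall>j<mdim M.
        smooth_on (mdim M) (\<phi> ` (U \<inter> V)) (\<lambda>y. \<psi> (inv_into U \<phi> y) j))"

definition smooth_map ::
  "('a, 'y) manifold_scheme \<Rightarrow> ('b, 'z) manifold_scheme \<Rightarrow> ('a \<Rightarrow> 'b) \<Rightarrow> bool" where
  "smooth_map M N F \<longleftrightarrow>
     continuous_map (mtop M) (mtop N) F \<and>
     (\<forall>(U, \<phi>)\<in>atlas M. \<forall>(V, \<psi>)\<in>atlas N. \<forall>j<mdim N.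
        smooth_on (mdim M) (\<phi> ` {x \<in> U. F x \<in> V}) (\<lambda>y. \<psi> (F (inv_into U \<phi> y)) j))"

text \<open>Product charts use the identification \<open>\<real>\<^sup>m \<times> \<real>\<^sup>n = \<real>\<^sup>m\<^sup>+\<^sup>n\<close> by concatenation.\<close>

definition prod_manifold :: "'a manifold \<Rightarrow> 'b manifold \<Rightarrow> ('a \<times> 'b) manifold" where
  "prod_manifold M N =
     \<lparr>mtop = prod_topology (mtop M) (mtop N),
      mdim = mdim M + mdim N,
      atlas = {(U \<times> V, \<lambda>(x, y) i. if i < mdim M then \<phi> x i else \<psi> y (i - mdim M)) | U \<phi> V \<psi>.
                 (U, \<phi>) \<in> atlas M \<and> (V, \<psi>) \<in> atlas N}\<rparr>"

text \<open>
  Functions on \<open>M\<close> are normalised to be \<open>undefined\<close> off \<open>M\<close>, so that equality of elements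
  is equality of functions on \<open>M\<close>.
\<close>

definition Cinf :: "'a manifold \<Rightarrow> ('a \<Rightarrow> real) set" where
  "Cinf M = {f \<in> extensional (points M).
     \<forall>(U, \<phi>)\<in>atlas M. smooth_on (mdim M) (\<phi> ` U) (\<lambda>y. f (inv_into U \<phi> y))}"


section \<open>Lie groups and proper actions\<close>

locale lie_group = group G for G (structure) +
  fixes L :: "'a manifold"
  assumes manifold: "smooth_manifold L"
    and carrier_eq: "points L = carrier G"
    and smooth_mult: "smooth_map (prod_manifold L L) L (\<lambda>(g, h). g \<otimes> h)"
    and smooth_inv: "smooth_map L L (\<lambda>g. inv g)"

definition smooth_action ::
  "('g, 'z) monoid_scheme \<Rightarrow> 'g manifold \<Rightarrow> 'm manifold \<Rightarrow> ('g \<Rightarrow> 'm \<Rightarrow> 'm) \<Rightarrow> bool" where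
  "smooth_action G L M \<alpha> \<longleftrightarrow>
     group_action G (points M) \<alpha> \<and>
     smooth_map (prod_manifold L M) M (\<lambda>(g, x). \<alpha> g x)"

definition proper_action ::
  "('g, 'z) monoid_scheme \<Rightarrow> 'g manifold \<Rightarrow> 'm manifold \<Rightarrow> ('g \<Rightarrow> 'm \<Rightarrow> 'm) \<Rightarrow> bool" where
  "proper_action G L M \<alpha> \<longleftrightarrow>
     smooth_action G L M \<alpha> \<and>
     proper_map (prod_topology (mtop L) (mtop M)) (prod_topology (mtop M) (mtop M))
       (\<lambda>(g, x). (\<alpha> g x, x))"

definition quotient_topology :: "'a topology \<Rightarrow> ('a \<Rightarrow> 'b) \<Rightarrow> 'b topology" where
  "quotient_topology X q =
     topology (\<lambda>U. U \<subseteq> q ` topspace X \<and> openin X {x \<in> topspace X. q x \<in> U})"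

lemma openin_quotient_topology:
  "openin (quotient_topology X q) U \<longleftrightarrow>
     U \<subseteq> q ` topspace X \<and> openin X {x \<in> topspace X. q x \<in> U}"
proof -
  have "istopology (\<lambda>U. U \<subseteq> q ` topspace X \<and> openin X {x \<in> topspace X. q x \<in> U})"
    unfolding istopology_def
  proof (intro conjI allI impI)
    fix S T
    assume "S \<subseteq> q ` topspace X \<and> openin X {x \<in> topspace X. q x \<in> S}"
      and "T \<subseteq> q ` topspace X \<and> openin X {x \<in> topspace X. q x \<in> T}"
    then have "openin X ({x \<in> topspace X. q x \<in> S} \<inter> {x \<in> topspace X. q x \<in> T})"
      by blast
    also have "{x \<in> topspace X. q x \<in> S} \<inter> {x \<in> topspace X. q x \<in> T} =
               {x \<in> topspace X. q x \<in> S \<inter> T}" by blast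
    finally show "openin X {x \<in> topspace X. q x \<in> S \<inter> T}" .
  next
    fix \<K>
    assume K: "\<forall>S\<in>\<K>. S \<subseteq> q ` topspace X \<and> openin X {x \<in> topspace X. q x \<in> S}"
    have "openin X (\<Union>S\<in>\<K>. {x \<in> topspace X. q x \<in> S})"
      using K by blast
    also have "(\<Union>S\<in>\<K>. {x \<in> topspace X. q x \<in> S}) = {x \<in> topspace X. q x \<in> \<Union>\<K>}" by blast
    finally show "openin X {x \<in> topspace X. q x \<in> \<Union>\<K>}" .
  qed blast+
  then show ?thesis
    by (simp add: quotient_topology_def topology_inverse')
qed

lemma topspace_quotient_topology [simp]:
  "topspace (quotient_topology X q) = q ` topspace X"
proof -
  have "{x \<in> topspace X. q x \<in> q ` topspace X} = topspace X" by blast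
  then have "openin (quotient_topology X q) (q ` topspace X)"
    by (simp add: openin_quotient_topology)
  then show ?thesis
    by (meson openin_quotient_topology openin_subset openin_topspace subset_antisym)
qed

lemma quotient_map_quotient_topology: "quotient_map X (quotient_topology X q) q"
  by (auto simp: quotient_map_def openin_quotient_topology)

definition orbit_space ::
  "('g, 'z) monoid_scheme \<Rightarrow> 'm manifold \<Rightarrow> ('g \<Rightarrow> 'm \<Rightarrow> 'm) \<Rightarrow> 'm set topology" where
  "orbit_space G M \<alpha> = quotient_topology (mtop M) (orbit G \<alpha>)"

lemma topspace_orbit_space: "topspace (orbit_space G M \<alpha>) = orbits G (points M) \<alpha>"
  by (auto simp: orbit_space_def orbits_def)


section \<open>\<open>C\<^sup>\<infinity>\<close>-rings and their spaces of points\<close>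

text \<open>
  The arguments of an operation form a list \<open>as\<close>, whose length is the arity; so
  \<open>cop A f as\<close> is the operation of \<open>f\<close> in \<open>C\<^sup>\<infinity>(\<real>\<^sup>n)\<close> with \<open>n = length as\<close>.
\<close>

record 'a cinf_ring =
  ccarrier :: "'a set"
  cop :: "((nat \<Rightarrow> real) \<Rightarrow> real) \<Rightarrow> 'a list \<Rightarrow> 'a"

definition vec_of_list :: "real list \<Rightarrow> nat \<Rightarrow> real" where
  "vec_of_list xs = (\<lambda>i. if i < length xs then xs ! i else 0)"

definition is_cinf_ring :: "'a cinf_ring \<Rightarrow> bool" where
  "is_cinf_ring A \<longleftrightarrow>
     (\<forall>as\<in>lists (ccarrier A). \<forall>f\<in>Cinf_Rn (length as). cop A f as \<in> ccarrier A) \<and>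
     (\<forall>as\<in>lists (ccarrier A). \<forall>i<length as.
        cop A (\<lambda>x\<in>Rn (length as). x i) as = as ! i) \<and>
     (\<forall>as\<in>lists (ccarrier A). \<forall>fs\<in>lists (Cinf_Rn (length as)). \<forall>h\<in>Cinf_Rn (length fs).
        cop A h (map (\<lambda>f. cop A f as) fs) =
        cop A (\<lambda>x\<in>Rn (length as). h (vec_of_list (map (\<lambda>f. f x) fs))) as)"

definition real_cinf_ring :: "real cinf_ring" where
  "real_cinf_ring = \<lparr>ccarrier = UNIV, cop = (\<lambda>f as. f (vec_of_list as))\<rparr>"

definition Cinf_ring :: "'m manifold \<Rightarrow> ('m \<Rightarrow> real) cinf_ring" where
  "Cinf_ring M = \<lparr>ccarrier = Cinf M,
     cop = (\<lambda>f as. \<lambda>x\<in>points M. f (vec_of_list (map (\<lambda>a. a x) as)))\<rparr>"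

definition invariant_cinf_ring ::
  "('g, 'z) monoid_scheme \<Rightarrow> 'm manifold \<Rightarrow> ('g \<Rightarrow> 'm \<Rightarrow> 'm) \<Rightarrow> ('m \<Rightarrow> real) cinf_ring" where
  "invariant_cinf_ring G M \<alpha> = (Cinf_ring M)
     \<lparr>ccarrier := {f \<in> Cinf M. \<forall>g\<in>carrier G. \<forall>x\<in>points M. f (\<alpha> g x) = f x}\<rparr>"

definition cinf_hom :: "'a cinf_ring \<Rightarrow> 'b cinf_ring \<Rightarrow> ('a \<Rightarrow> 'b) set" where
  "cinf_hom A B = {h \<in> ccarrier A \<rightarrow>\<^sub>E ccarrier B.
     \<forall>as\<in>lists (ccarrier A). \<forall>f\<in>Cinf_Rn (length as). h (cop A f as) = cop B f (map h as)}"

definition space_of_points :: "'a cinf_ring \<Rightarrow> ('a \<Rightarrow> real) topology" where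
  "space_of_points A =
     topology (arbitrary union_of
       (\<lambda>U. \<exists>a\<in>ccarrier A. U = {x \<in> cinf_hom A real_cinf_ring. x a \<noteq> 0}))"


section \<open>Well-definedness\<close>

text \<open>
  Smoothness is closed under composition, so the invariant functions form a \<open>C\<^sup>\<infinity>\<close>-ring,
  and for every \<open>C\<^sup>\<infinity>\<close>-ring the basis in \<open>space_of_points\<close> does generate a
  topology, whose underlying set is the set of all \<open>C\<^sup>\<infinity>\<close>-ring maps to \<open>\<real>\<close>.
\<close>

lemma Ck_continuous: "Ck_on n k U f \<Longrightarrow> continuous_map (subtopology (Euclidean_space n) U) euclideanreal f"
  by (cases k) auto

lemma Euclidean_space_euclidean: "Euclidean_space n = top_of_set (Rn n)"
  by (simp add: Euclidean_space_def euclidean_product_topology)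

lemma sub_Euclidean: "openin (Euclidean_space n) U \<Longrightarrow> subtopology (Euclidean_space n) U = top_of_set U"
  by (metis Euclidean_space_euclidean inf.absorb_iff2 openin_subset subtopology_subtopology)

lemma Ck_continuous_on: "openin (Euclidean_space n) U \<Longrightarrow> Ck_on n k U f \<Longrightarrow> continuous_on U f"
  using Ck_continuous sub_Euclidean by fastforce

lemma eventually_upd:
  assumes "openin (Euclidean_space n) U" "x \<in> U" "i < n"
  shows "\<forall>\<^sub>F t in nhds (x i). x(i := t) \<in> U"
proof -
  obtain T where T: "open T" "U = Rn n \<inter> T"
    using assms(1) Euclidean_space_euclidean openin_open by metis
  have "continuous_on UNIV (\<lambda>t. x(i := t))"
    proof (rule continuous_on_coordinatewise_then_product)
    show "continuous_on UNIV (\<lambda>t. (x(i := t)) j)" for j by (cases "j = i") auto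
  qed
  then have "open ((\<lambda>t. x(i := t)) -` T)"
    using T(1) open_vimage by blast
  moreover have "x i \<in> (\<lambda>t. x(i := t)) -` T" using assms T by auto
  ultimately have "\<forall>\<^sub>F t in nhds (x i). x(i := t) \<in> T"
    unfolding eventually_nhds by (intro exI[of _ "(\<lambda>t. x(i := t)) -` T"]) auto
  moreover have "x(i := t) \<in> Rn n" for t
    using assms T by (auto simp: topspace_Euclidean_space)
  ultimately show ?thesis using T by (auto elim: eventually_mono)
qed

lemma upd_cong:
  assumes "openin (Euclidean_space n) U" "x \<in> U" "i < n" "\<And>y. y \<in> U \<Longrightarrow> f y = g y"
  shows "\<forall>\<^sub>F t in nhds (x i). f (x(i := t)) = g (x(i := t))"
  using eventually_upd[OF assms(1-3)] assms(4) by (auto elim: eventually_mono)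

lemma partial_cong:
  assumes "openin (Euclidean_space n) U" "x \<in> U" "i < n" "\<And>y. y \<in> U \<Longrightarrow> f y = g y"
  shows "partial_deriv i f x = partial_deriv i g x"
  unfolding partial_deriv_def using upd_cong[OF assms] by (intro deriv_cong_ev) auto

lemma Ck_cong:
  assumes "openin (Euclidean_space n) U" "\<And>y. y \<in> U \<Longrightarrow> f y = g y"
  shows "Ck_on n k U f \<Longrightarrow> Ck_on n k U g"
  using assms(2)
proof (induction k arbitrary: f g)
  case 0
  then show ?case using sub_Euclidean[OF assms(1)]
    by (auto cong: continuous_on_cong)
next
  case (Suc k)
  have "continuous_on U g"
    using Suc.prems Ck_continuous_on[OF assms(1)] continuous_on_cong by metis
  moreover have "(\<lambda>t. g (x(i := t))) field_differentiable at (x i)" if "i < n" "x \<in> U" for i x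
  proof -
    have "(\<lambda>t. f (x(i := t))) field_differentiable at (x i)" using Suc.prems that by simp
    then obtain d where "((\<lambda>t. f (x(i := t))) has_field_derivative d) (at (x i))"
      by (auto simp: field_differentiable_def)
    then have "((\<lambda>t. g (x(i := t))) has_field_derivative d) (at (x i))"
      using upd_cong[OF assms(1) that(2,1) Suc.prems(2)]
      by (subst (asm) DERIV_cong_ev) auto
    then show ?thesis by (auto simp: field_differentiable_def)
  qed
  moreover have "Ck_on n k U (partial_deriv i g)" if "i < n" for i
    using Suc.IH[of "partial_deriv i f" "partial_deriv i g"] Suc.prems that
      partial_cong[OF assms(1) _ that Suc.prems(2)] by auto
  ultimately show ?case using sub_Euclidean[OF assms(1)] by auto
qed

lemma Ck_mono: "Ck_on n (Suc k) U f \<Longrightarrow> Ck_on n k U f"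
  by (induction k arbitrary: f) auto

lemma partial_DERIV:
  assumes "Ck_on n (Suc k) U f" "i < n" "x \<in> U"
  shows "((\<lambda>t. f (x(i := t))) has_field_derivative partial_deriv i f x) (at (x i))"
  using assms unfolding partial_deriv_def by (simp add: field_differentiable_derivI)

lemma Ck_SucI:
  assumes U: "openin (Euclidean_space n) U" and c: "continuous_on U f"
    and D: "\<And>i x. \<lbrakk>i < n; x \<in> U\<rbrakk> \<Longrightarrow> ((\<lambda>t. f (x(i := t))) has_field_derivative f' i x) (at (x i))"
    and k: "\<And>i. i < n \<Longrightarrow> Ck_on n k U (f' i)"
  shows "Ck_on n (Suc k) U f"
proof -
  have "partial_deriv i f x = f' i x" if "i < n" "x \<in> U" for i x
    unfolding partial_deriv_def using D[OF that] by (rule DERIV_imp_deriv)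
  then have "Ck_on n k U (partial_deriv i f)" if "i < n" for i
    using Ck_cong[OF U _ k[OF that], of "partial_deriv i f"] that by auto
  then show ?thesis using c D sub_Euclidean[OF U] by (auto simp: field_differentiable_def)
qed

lemma Ck_const:
  assumes U: "openin (Euclidean_space n) U" shows "Ck_on n k U (\<lambda>x. c)"
proof (induction k arbitrary: c)
  case (Suc k)
  then show ?case by (intro Ck_SucI[OF U, where f' = "\<lambda>_ _. 0"]) auto
qed auto

lemma Ck_coord:
  assumes U: "openin (Euclidean_space n) U" shows "Ck_on n k U (\<lambda>x. x j)"
proof (cases k)
  case 0
  then show ?thesis using continuous_on_product_then_coordinatewise[OF continuous_on_id, of U j]
    by (simp add: sub_Euclidean[OF U])
next
  case (Suc k)
  show ?thesis unfolding Suc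
  proof (rule Ck_SucI[OF U, where f' = "\<lambda>i _. if i = j then 1 else 0"])
    show "continuous_on U (\<lambda>x. x j)"
      using continuous_on_product_then_coordinatewise[OF continuous_on_id, of U j] by simp
    show "((\<lambda>t. (x(i := t)) j) has_field_derivative (if i = j then 1 else 0)) (at (x i))" for i x
      by (cases "i = j") (auto intro: DERIV_ident)
  qed (rule Ck_const[OF U])
qed

lemma Ck_add:
  assumes U: "openin (Euclidean_space n) U"
  shows "Ck_on n k U f \<Longrightarrow> Ck_on n k U g \<Longrightarrow> Ck_on n k U (\<lambda>x. f x + g x)"
proof (induction k arbitrary: f g)
  case (Suc k)
  have D: "((\<lambda>t. f (x(i := t)) + g (x(i := t))) has_field_derivative
          partial_deriv i f x + partial_deriv i g x) (at (x i))" if "i < n" "x \<in> U" for i x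
    by (rule DERIV_add[OF partial_DERIV[OF Suc.prems(1) that] partial_DERIV[OF Suc.prems(2) that]])
  have "Ck_on n k U (\<lambda>x. partial_deriv i f x + partial_deriv i g x)" if "i < n" for i
    using Suc.prems that by (intro Suc.IH) auto
  moreover have "continuous_on U (\<lambda>x. f x + g x)"
    using Suc.prems Ck_continuous_on[OF U] by (intro continuous_intros) blast+
  ultimately show ?case using D by (intro Ck_SucI[OF U]) assumption+
qed (auto simp: sub_Euclidean[OF U] intro!: continuous_intros)

lemma Ck_sum:
  assumes U: "openin (Euclidean_space n) U" and "finite J" "\<And>j. j \<in> J \<Longrightarrow> Ck_on n k U (f j)"
  shows "Ck_on n k U (\<lambda>x. \<Sum>j\<in>J. f j x)"
  using assms(2,3) by (induction J) (auto intro: Ck_const[OF U] Ck_add[OF U])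

lemma Ck_mult:
  assumes U: "openin (Euclidean_space n) U"
  shows "Ck_on n k U f \<Longrightarrow> Ck_on n k U g \<Longrightarrow> Ck_on n k U (\<lambda>x. f x * g x)"
proof (induction k arbitrary: f g)
  case (Suc k)
  have D: "((\<lambda>t. f (x(i := t)) * g (x(i := t))) has_field_derivative
          partial_deriv i f x * g x + partial_deriv i g x * f x) (at (x i))" if "i < n" "x \<in> U" for i x
    using DERIV_mult[OF partial_DERIV[OF Suc.prems(1) that] partial_DERIV[OF Suc.prems(2) that]]
    by (simp only: fun_upd_triv)
  have "Ck_on n k U (\<lambda>x. partial_deriv i f x * g x + partial_deriv i g x * f x)" if "i < n" for i
    using Suc.prems that Ck_mono by (intro Ck_add[OF U] Suc.IH) auto
  moreover have "continuous_on U (\<lambda>x. f x * g x)"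
    using Suc.prems Ck_continuous_on[OF U] by (intro continuous_intros) blast+
  ultimately show ?case using D by (intro Ck_SucI[OF U]) assumption+
qed (auto simp: sub_Euclidean[OF U] intro!: continuous_intros)

lemma Rn_upd: "x \<in> Rn n \<Longrightarrow> i < n \<Longrightarrow> x(i := t) \<in> Rn n"
  by (auto simp: topspace_Euclidean_space)

lemma curve_DERIV:
  fixes \<gamma> :: "nat \<Rightarrow> real \<Rightarrow> real"
  assumes h: "Ck_on m (Suc 0) (Rn m) h"
    and \<gamma>: "\<And>j. j < m \<Longrightarrow> (\<gamma> j has_field_derivative d j) (at t0)"
  defines "v \<equiv> (\<lambda>t j. if j < m then \<gamma> j t else 0)"
  shows "((\<lambda>t. h (v t)) has_field_derivative (\<Sum>j<m. partial_deriv j h (v t0) * d j)) (at t0)"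
proof -
  define p where "p = (\<lambda>j t i. if i < j then v t i else v t0 i)"
  have pR: "p j t \<in> Rn m" for j t by (auto simp: p_def v_def topspace_Euclidean_space)
  have tele: "h (v t) - h (v t0) = (\<Sum>j<m. h (p (Suc j) t) - h (p j t))" for t
  proof -
    have "p m t = v t" "p 0 t = v t0" by (auto simp: p_def v_def)
    then show ?thesis using sum_lessThan_telescope[of "\<lambda>j. h (p j t)" m] by simp
  qed
  have pS: "p (Suc j) t = (p j t)(j := \<gamma> j t)" "p j t = (p j t)(j := \<gamma> j t0)" if "j < m" for j t
    using that by (auto simp: p_def v_def fun_eq_iff less_Suc_eq)
  have "\<exists>\<xi>. \<bar>\<xi> - \<gamma> j t0\<bar> \<le> \<bar>\<gamma> j t - \<gamma> j t0\<bar> \<and>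
       h (p (Suc j) t) - h (p j t) = partial_deriv j h ((p j t)(j := \<xi>)) * (\<gamma> j t - \<gamma> j t0)"
    if "j < m" for j t
  proof -
    define u where "u = (\<lambda>s. h ((p j t)(j := s)))"
    have D: "(u has_field_derivative partial_deriv j h ((p j t)(j := s))) (at s)" for s
      using partial_DERIV[OF h that Rn_upd[OF pR that], of j t s] by (simp add: u_def)
    have "\<exists>\<xi>. \<bar>\<xi> - a\<bar> \<le> \<bar>b - a\<bar> \<and> u b - u a = partial_deriv j h ((p j t)(j := \<xi>)) * (b - a)" for a b
    proof (cases a b rule: linorder_cases)
      case less
      then obtain z where "z > a" "z < b" "u b - u a = (b - a) * partial_deriv j h ((p j t)(j := z))"
        using MVT2[OF less D] by blast
      then show ?thesis by (intro exI[of _ z]) auto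
    next
      case greater
      then obtain z where "z > b" "z < a" "u a - u b = (a - b) * partial_deriv j h ((p j t)(j := z))"
        using MVT2[OF greater D] by blast
      then show ?thesis by (intro exI[of _ z]) (auto simp: algebra_simps)
    qed auto
    from this[of "\<gamma> j t0" "\<gamma> j t"] show ?thesis
      unfolding u_def using pS[OF that, of t] by metis
  qed
  then obtain \<xi> where \<xi>: "\<And>j t. j < m \<Longrightarrow> \<bar>\<xi> j t - \<gamma> j t0\<bar> \<le> \<bar>\<gamma> j t - \<gamma> j t0\<bar>"
    "\<And>j t. j < m \<Longrightarrow> h (p (Suc j) t) - h (p j t) =
       partial_deriv j h ((p j t)(j := \<xi> j t)) * (\<gamma> j t - \<gamma> j t0)"
    by metis
  have \<gamma>c: "(\<gamma> j \<longlongrightarrow> \<gamma> j t0) (at t0)" if "j < m" for j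
    using DERIV_isCont[OF \<gamma>[OF that]] by (simp add: isCont_def)
  have lim: "((\<lambda>t. partial_deriv j h ((p j t)(j := \<xi> j t))) \<longlongrightarrow> partial_deriv j h (v t0)) (at t0)"
    if j: "j < m" for j
  proof -
    have "Ck_on m 0 (Rn m) (partial_deriv j h)" using h j by simp
    then have c: "continuous_on (Rn m) (partial_deriv j h)"
      by (rule Ck_continuous_on[rotated]) auto
    have "((\<lambda>t. (p j t)(j := \<xi> j t)) \<longlongrightarrow> v t0) (at t0)"
    proof -
      have comp: "((\<lambda>t. ((p j t)(j := \<xi> j t)) i) \<longlongrightarrow> v t0 i) (at t0)" for i
      proof (cases "i = j")
        case True
        have "((\<lambda>t. \<bar>\<gamma> j t - \<gamma> j t0\<bar>) \<longlongrightarrow> 0) (at t0)"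
          using \<gamma>c[OF j] tendsto_rabs_zero LIM_zero by blast
        then have "((\<lambda>t. \<xi> j t - \<gamma> j t0) \<longlongrightarrow> 0) (at t0)"
          by (rule Lim_null_comparison[rotated]) (simp add: \<xi>(1)[OF j])
        then show ?thesis using True j LIM_zero_cancel by (auto simp: v_def)
      next
        case False
        then show ?thesis using \<gamma>c[of i] by (cases "i < j"; cases "i < m") (auto simp: p_def v_def)
      qed
      have "limitin euclidean (\<lambda>t. (p j t)(j := \<xi> j t)) (v t0) (at t0)"
        unfolding euclidean_product_topology[symmetric]
        using comp by (simp add: limitin_componentwise)
      then show ?thesis by simp
    qed
    moreover have "v t0 \<in> Rn m" by (auto simp: v_def topspace_Euclidean_space)
    ultimately show ?thesis
      by (rule continuous_on_tendsto_compose[OF c]) (simp only: Rn_upd[OF pR j] eventually_True)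
  qed
  have "((\<lambda>t. (\<Sum>j<m. partial_deriv j h ((p j t)(j := \<xi> j t)) * ((\<gamma> j t - \<gamma> j t0) / (t - t0))))
     \<longlongrightarrow> (\<Sum>j<m. partial_deriv j h (v t0) * d j)) (at t0)"
    using \<gamma> by (intro tendsto_sum tendsto_mult lim) (auto simp: has_field_derivative_iff)
  also have "(\<lambda>t. (\<Sum>j<m. partial_deriv j h ((p j t)(j := \<xi> j t)) * ((\<gamma> j t - \<gamma> j t0) / (t - t0))))
    = (\<lambda>t. (h (v t) - h (v t0)) / (t - t0))"
    unfolding tele by (auto simp: \<xi>(2) sum_divide_distrib intro!: sum.cong ext)
  finally show ?thesis by (simp add: has_field_derivative_iff)
qed

lemma continuous_on_compose_Rn:
  assumes U: "openin (Euclidean_space n) U"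
    and h: "Ck_on m k (Rn m) h" and g: "\<And>j. j < m \<Longrightarrow> Ck_on n k U (g j)"
  shows "continuous_on U (\<lambda>x. h (\<lambda>j. if j < m then g j x else 0))"
proof -
  have "continuous_on U (\<lambda>x j. if j < m then g j x else 0)"
  proof (rule continuous_on_coordinatewise_then_product)
    show "continuous_on U (\<lambda>x. if j < m then g j x else 0)" for j
      using Ck_continuous_on[OF U g] by (cases "j < m") auto
  qed
  moreover have "continuous_on (Rn m) h" using Ck_continuous_on[OF _ h] by auto
  moreover have "(\<lambda>x j. if j < m then g j x else 0) ` U \<subseteq> Rn m"
    by (auto simp: topspace_Euclidean_space)
  ultimately show ?thesis
    using continuous_on_compose2[of "Rn m" h U "\<lambda>x j. if j < m then g j x else 0"] by blast
qed

lemma Ck_compose: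
  assumes U: "openin (Euclidean_space n) U"
  shows "Ck_on m k (Rn m) h \<Longrightarrow> (\<And>j. j < m \<Longrightarrow> Ck_on n k U (g j)) \<Longrightarrow>
     Ck_on n k U (\<lambda>x. h (\<lambda>j. if j < m then g j x else 0))"
proof (induction k arbitrary: h)
  case 0
  show ?case using continuous_on_compose_Rn[OF U 0] by (simp add: sub_Euclidean[OF U])
next
  case (Suc k)
  have h1: "Ck_on m (Suc 0) (Rn m) h"
    using Suc.prems(1) Ck_continuous[of m k "Rn m"] by (simp del: subtopology_topspace)
  let ?v = "\<lambda>x j. if j < m then g j x else 0"
  show ?case
  proof (rule Ck_SucI[OF U, where f' = "\<lambda>i x. \<Sum>j<m. partial_deriv j h (?v x) * partial_deriv i (g j) x"])
    show "continuous_on U (\<lambda>x. h (?v x))" using continuous_on_compose_Rn[OF U Suc.prems] by simp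
    show "((\<lambda>t. h (?v (x(i := t)))) has_field_derivative
        (\<Sum>j<m. partial_deriv j h (?v x) * partial_deriv i (g j) x)) (at (x i))" if "i < n" "x \<in> U" for i x
      using curve_DERIV[of m h "\<lambda>j t. g j (x(i := t))", OF h1 partial_DERIV[OF Suc.prems(2) that]]
      by (simp only: fun_upd_triv)
    show "Ck_on n k U (\<lambda>x. \<Sum>j<m. partial_deriv j h (?v x) * partial_deriv i (g j) x)" if "i < n" for i
      using Suc.prems that Ck_mono by (intro Ck_sum[OF U] Ck_mult[OF U] Suc.IH) auto
  qed
qed

lemma smooth_compose:
  assumes U: "openin (Euclidean_space n) U"
    and "smooth_on m (Rn m) h" "\<And>j. j < m \<Longrightarrow> smooth_on n U (g j)"
  shows "smooth_on n U (\<lambda>x. h (\<lambda>j. if j < m then g j x else 0))"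
  unfolding smooth_on_def using assms(2,3) by (intro allI Ck_compose[OF U]) (simp_all add: smooth_on_def)

lemma Cinf_op:
  assumes M: "smooth_manifold M" and as: "as \<in> lists (Cinf M)" and f: "f \<in> Cinf_Rn (length as)"
  shows "cop (Cinf_ring M) f as \<in> Cinf M"
proof -
  have "smooth_on (mdim M) (\<phi> ` U) (\<lambda>y. cop (Cinf_ring M) f as (inv_into U \<phi> y))"
    if c: "(U, \<phi>) \<in> atlas M" for U \<phi>
  proof -
    have o: "openin (Euclidean_space (mdim M)) (\<phi> ` U)" and "openin (mtop M) U"
      using M c by (auto simp: smooth_manifold_def)
    then have Us: "U \<subseteq> points M" using openin_subset by blast
    have "smooth_on (mdim M) (\<phi> ` U) (\<lambda>y. (as ! j) (inv_into U \<phi> y))" if "j < length as" for j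
      using as c that by (auto simp: Cinf_def in_lists_conv_set)
    then have "smooth_on (mdim M) (\<phi> ` U) (\<lambda>y. f (\<lambda>j. if j < length as then (as ! j) (inv_into U \<phi> y) else 0))"
      using smooth_compose[OF o, of "length as" f "\<lambda>j y. (as ! j) (inv_into U \<phi> y)"] f by (simp add: Cinf_Rn_def)
    moreover have "f (\<lambda>j. if j < length as then (as ! j) (inv_into U \<phi> y) else 0)
       = cop (Cinf_ring M) f as (inv_into U \<phi> y)" if "y \<in> \<phi> ` U" for y
    proof -
      have "inv_into U \<phi> y \<in> points M" using inv_into_into[OF that] Us by blast
      moreover have "(\<lambda>j. if j < length as then (as ! j) (inv_into U \<phi> y) else 0) =
         vec_of_list (map (\<lambda>a. a (inv_into U \<phi> y)) as)" by (auto simp: vec_of_list_def)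
      ultimately show ?thesis by (simp add: Cinf_ring_def)
    qed
    ultimately show ?thesis unfolding smooth_on_def by (intro allI) (rule Ck_cong[OF o], assumption, rule spec)
  qed
  then show ?thesis by (auto simp: Cinf_def Cinf_ring_def)
qed

lemma invariant_op:
  assumes M: "smooth_manifold M" and A: "group_action G (points M) \<alpha>"
    and as: "as \<in> lists (ccarrier (invariant_cinf_ring G M \<alpha>))" and f: "f \<in> Cinf_Rn (length as)"
  shows "cop (invariant_cinf_ring G M \<alpha>) f as \<in> ccarrier (invariant_cinf_ring G M \<alpha>)"
proof -
  interpret group_action G "points M" \<alpha> by fact
  have "as \<in> lists (Cinf M)" using as by (auto simp: invariant_cinf_ring_def)
  from Cinf_op[OF M this f] have "cop (Cinf_ring M) f as \<in> Cinf M" .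
  moreover have "cop (Cinf_ring M) f as (\<alpha> g x) = cop (Cinf_ring M) f as x" if "g \<in> carrier G" "x \<in> points M" for g x
  proof -
    have "map (\<lambda>a. a (\<alpha> g x)) as = map (\<lambda>a. a x) as"
      using as that by (auto simp: invariant_cinf_ring_def)
    moreover have "\<alpha> g x \<in> points M" using that element_image by blast
    ultimately show ?thesis using that by (simp add: Cinf_ring_def del: map_eq_conv)
  qed
  ultimately show ?thesis by (simp add: invariant_cinf_ring_def)
qed

lemma vec_Rn: "vec_of_list xs \<in> Rn (length xs)"
  by (auto simp: vec_of_list_def topspace_Euclidean_space)

theorem is_cinf_ring_invariant:
  fixes M :: "'m manifold"
  assumes M: "smooth_manifold M" and A: "group_action G (points M) \<alpha>"
  shows "is_cinf_ring (invariant_cinf_ring G M \<alpha>)"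
proof -
  let ?A = "invariant_cinf_ring G M \<alpha>"
  have op: "cop ?A f as x = (if x \<in> points M then f (vec_of_list (map (\<lambda>a. a x) as)) else undefined)"
    for f as x by (simp add: invariant_cinf_ring_def Cinf_ring_def)
  have V: "vec_of_list (map (\<lambda>a. a x) as) \<in> Rn (length as)" for as :: "('m \<Rightarrow> real) list" and x
    using vec_Rn[of "map (\<lambda>a. a x) as"] by simp
  have "cop ?A (\<lambda>x\<in>Rn (length as). x i) as = as ! i"
    if "as \<in> lists (ccarrier ?A)" "i < length as" for as i
  proof
    fix x
    show "cop ?A (\<lambda>x\<in>Rn (length as). x i) as x = (as ! i) x"
    proof (cases "x \<in> points M")
      case True
      then show ?thesis using V[of x as] \<open>i < length as\<close> by (simp add: op vec_of_list_def)
    next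
      case False
      have "as ! i \<in> extensional (points M)"
        using that by (auto simp: invariant_cinf_ring_def Cinf_def in_lists_conv_set)
      then have "(as ! i) x = undefined" using False by (rule extensional_arb)
      then show ?thesis using False by (simp add: op)
    qed
  qed
  moreover have "cop ?A h (map (\<lambda>f. cop ?A f as) fs) =
        cop ?A (\<lambda>x\<in>Rn (length as). h (vec_of_list (map (\<lambda>f. f x) fs))) as" for as fs h
  proof
    fix x
    show "cop ?A h (map (\<lambda>f. cop ?A f as) fs) x =
        cop ?A (\<lambda>x\<in>Rn (length as). h (vec_of_list (map (\<lambda>f. f x) fs))) as x"
      unfolding op using V[of x as] by (simp add: op o_def)
  qed
  ultimately show ?thesis
    unfolding is_cinf_ring_def using invariant_op[OF M A] by blast
qed

theorem is_cinf_ring_real: "is_cinf_ring real_cinf_ring"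
proof -
  have "vec_of_list as i = as ! i" if "i < length as" for as i
    using that by (simp add: vec_of_list_def)
  then show ?thesis
    unfolding is_cinf_ring_def by (simp add: real_cinf_ring_def o_def vec_Rn)
qed

lemma Cinf_RnI:
  assumes "\<And>k. Ck_on n k (Rn n) f" shows "restrict f (Rn n) \<in> Cinf_Rn n"
proof -
  have "Ck_on n k (Rn n) (restrict f (Rn n))" for k
    by (rule Ck_cong[OF _ _ assms]) simp_all
  then show ?thesis by (simp add: Cinf_Rn_def smooth_on_def)
qed

theorem space_of_points_basis:
  assumes A: "is_cinf_ring A"
  shows "istopology (arbitrary union_of
       (\<lambda>U. \<exists>a\<in>ccarrier A. U = {x \<in> cinf_hom A real_cinf_ring. x a \<noteq> 0}))" (is ?top)
    and "topspace (space_of_points A) = cinf_hom A real_cinf_ring" (is ?space)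
proof -
  let ?P = "\<lambda>U. \<exists>a\<in>ccarrier A. U = {x \<in> cinf_hom A real_cinf_ring. x a \<noteq> 0}"
  show ?top
  proof (rule istopology_base)
    fix S T assume "?P S" "?P T"
    then obtain a b where ab: "a \<in> ccarrier A" "b \<in> ccarrier A"
      and ST: "S = {x \<in> cinf_hom A real_cinf_ring. x a \<noteq> 0}" "T = {x \<in> cinf_hom A real_cinf_ring. x b \<noteq> 0}"
      by blast
    define f where "f = (\<lambda>x\<in>Rn 2. x 0 * x 1 :: real)"
    have f: "f \<in> Cinf_Rn (length [a, b])" unfolding f_def
      using Cinf_RnI[OF Ck_mult[OF _ Ck_coord Ck_coord], of 2 0 1] by (simp add: numeral_2_eq_2)
    have L: "[a, b] \<in> lists (ccarrier A)" using ab by simp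
    have "cop A f [a, b] \<in> ccarrier A" using A L f unfolding is_cinf_ring_def by blast
    have mult: "x (cop A f [a, b]) = x a * x b" if "x \<in> cinf_hom A real_cinf_ring" for x
    proof -
      have "x (cop A f [a, b]) = cop real_cinf_ring f [x a, x b]"
        using that L f unfolding cinf_hom_def by fastforce
      also have "\<dots> = x a * x b"
        using vec_Rn[of "[x a, x b]"] by (simp add: real_cinf_ring_def f_def numeral_2_eq_2) (simp add: vec_of_list_def)
      finally show ?thesis .
    qed
    have "S \<inter> T = {x \<in> cinf_hom A real_cinf_ring. x (cop A f [a, b]) \<noteq> 0}"
    proof (rule Set.set_eqI)
      fix x
      show "x \<in> S \<inter> T \<longleftrightarrow> x \<in> {x \<in> cinf_hom A real_cinf_ring. x (cop A f [a, b]) \<noteq> 0}"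
      proof (cases "x \<in> cinf_hom A real_cinf_ring")
        case True
        show ?thesis unfolding ST using mult[OF True] True by simp
      qed (simp add: ST)
    qed
    then show "?P (S \<inter> T)" using \<open>cop A f [a, b] \<in> ccarrier A\<close> by (rule bexI)
  qed
  then have o: "openin (space_of_points A) = arbitrary union_of ?P"
    unfolding space_of_points_def by (rule topology_inverse')
  define e where "e = (\<lambda>x\<in>Rn 0. 1 :: real)"
  have e: "e \<in> Cinf_Rn (length [])" "[] \<in> lists (ccarrier A)" unfolding e_def
    using Cinf_RnI[of 0 "\<lambda>x. 1"] by (auto intro!: Ck_const)
  have "cop A e [] \<in> ccarrier A" using A e unfolding is_cinf_ring_def by blast
  have one: "x (cop A e []) = 1" if "x \<in> cinf_hom A real_cinf_ring" for x
  proof -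
    have "x (cop A e []) = cop real_cinf_ring e []" using that e unfolding cinf_hom_def by fastforce
    also have "\<dots> = 1"  using vec_Rn[of "[]"] by (simp add: real_cinf_ring_def e_def)
    finally show ?thesis .
  qed
  have "cinf_hom A real_cinf_ring = {x \<in> cinf_hom A real_cinf_ring. x (cop A e []) \<noteq> 0}"
  proof (rule Set.set_eqI)
    fix x
    show "x \<in> cinf_hom A real_cinf_ring \<longleftrightarrow> x \<in> {x \<in> cinf_hom A real_cinf_ring. x (cop A e []) \<noteq> 0}"
    proof (cases "x \<in> cinf_hom A real_cinf_ring")
      case True
      show ?thesis using one[OF True] True by simp
    qed simp
  qed
  with \<open>cop A e [] \<in> ccarrier A\<close> have "?P (cinf_hom A real_cinf_ring)" by (intro bexI)
  then have "openin (space_of_points A) (cinf_hom A real_cinf_ring)"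
    unfolding o by (rule arbitrary_union_of_inc)
  then have "cinf_hom A real_cinf_ring \<subseteq> topspace (space_of_points A)"
    by (rule openin_subset)
  moreover have "U \<subseteq> cinf_hom A real_cinf_ring" if "openin (space_of_points A) U" for U
  proof -
    have "(arbitrary union_of ?P) U" using that by (simp only: o)
    then obtain \<U> where "\<U> \<subseteq> Collect ?P" "\<Union>\<U> = U"
      unfolding union_of_def by (elim exE conjE)
    then show ?thesis by auto
  qed
  ultimately show ?space by (intro subset_antisym) auto
qed

end

theory Submission
  imports Defs
begin

text \<open>
  The homeomorphism sends the orbit of a point \<open>x\<close> to evaluation at \<open>x\<close>. Everything rests on a
  supply of invariant functions (\<open>invariant_bump\<close>): inside every open neighbourhood \<open>W\<close> of \<open>x\<close> there is
  a compact set \<open>K\<close> such that some invariant smooth \<open>f \<ge> 0\<close> is positive at \<open>x\<close> and vanishes at all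
  points whose orbit misses \<open>K\<close>. Such an \<open>f\<close> is the average \<open>f y = J (\<lambda>g. \<rho> (g \<cdot> y))\<close> of an ordinary
  bump \<open>\<rho>\<close> over the group. Properness of the action makes \<open>g \<mapsto> \<rho> (g \<cdot> y)\<close> compactly supported,
  with a support that can be chosen locally uniformly in \<open>y\<close>, and \<open>J\<close> is a Haar functional:
  linear, positive and invariant under right translations.

  The functional \<open>J\<close> is obtained in Weil's way (\<open>haar_functional_exists\<close>). The least total weight of
  right translates of \<open>\<phi>\<close> needed to dominate \<open>f\<close> is a right-invariant sublinear function of \<open>f\<close>;
  after normalisation it becomes additive in the limit as the support of \<open>\<phi>\<close> shrinks to the unit,
  and Tychonoff's theorem supplies a limit. That averages are smooth is differentiation under \<open>J\<close>,
  which is valid for every positive functional because such a functional is continuous for uniform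
  convergence on a fixed compact support (\<open>Ck_positive_functional\<close>).

  Three consequences of \<open>invariant_bump\<close> finish the proof. Orbits are closed, so an invariant bump
  at \<open>x\<close> with \<open>W\<close> the complement of another orbit separates the two: the fibres of the evaluation
  map are exactly the orbits (\<open>same_orbit_iff\<close>). The image of an open set \<open>W\<close> under evaluation is a
  union of basic open sets given by bumps inside \<open>W\<close>, so evaluation is an open map. Finally every
  \<open>C\<^sup>\<infinity>\<close>-ring map \<open>h\<close> to \<open>\<real>\<close> is an evaluation (\<open>hom_is_evaluation\<close>): bumps add up to an invariant
  exhaustion function \<open>p\<close>, whose sublevel sets are compact modulo \<open>G\<close>. If \<open>h\<close> were no evaluation,
  there would be finitely many invariant functions \<open>a\<close> such that at each point where \<open>p \<le> h p\<close> one of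
  them differs from the number \<open>h a\<close>; the sum of the squares of \<open>p - h p\<close> and of these \<open>a - h a\<close> would
  then be invertible although \<open>h\<close> maps it to \<open>0\<close>. So evaluation and the orbit map are two quotient maps on
  \<open>M\<close> with the same fibres, and their targets are homeomorphic.
\<close>

section \<open>Differentiability is local\<close>

lemma mem_Rn: "x \<in> Rn n \<longleftrightarrow> (\<forall>i\<ge>n. x i = 0)"
  by (simp add: topspace_Euclidean_space)

lemma Ck_subset:
  assumes "Ck_on n k U f" "V \<subseteq> U"
  shows "Ck_on n k V f"
  using assms(1)
proof (induction k arbitrary: f)
  case 0
  then show ?case using assms(2) continuous_map_from_subtopology_mono by auto
next
  case (Suc k)
  then show ?case using assms(2) continuous_map_from_subtopology_mono by auto
qed

lemma continuous_on_local_Rn: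
  assumes U: "openin (Euclidean_space n) U"
    and loc: "\<And>x. x \<in> U \<Longrightarrow> \<exists>V. openin (Euclidean_space n) V \<and> x \<in> V \<and> continuous_on V f"
  shows "continuous_on U f"
  unfolding continuous_on_eq_continuous_within
proof
  fix x assume x: "x \<in> U"
  then obtain V where V: "openin (Euclidean_space n) V" "x \<in> V" "continuous_on V f"
    using loc by blast
  then obtain T where T: "open T" "V = Rn n \<inter> T"
    using Euclidean_space_euclidean openin_open by metis
  have "continuous (at x within V) f"
    using V continuous_on_eq_continuous_within by blast
  moreover have "at x within V = at x within Rn n"
    using T V(2) by (intro at_within_nhd[of _ T]) auto
  ultimately have "continuous (at x within Rn n) f" by simp
  then show "continuous (at x within U) f"
    by (rule continuous_within_subset[OF _ openin_subset[OF U]])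
qed

text \<open>
  This permits gluing: bumps and averages are given by different formulas on different open sets.
\<close>

lemma Ck_local:
  assumes U: "openin (Euclidean_space n) U"
    and loc: "\<And>x. x \<in> U \<Longrightarrow> \<exists>V. openin (Euclidean_space n) V \<and> x \<in> V \<and> Ck_on n k V f"
  shows "Ck_on n k U f"
  using loc
proof (induction k arbitrary: f)
  case 0
  have "continuous_on U f"
    by (rule continuous_on_local_Rn[OF U]) (meson 0 Ck_continuous_on)
  then show ?case using sub_Euclidean[OF U] by simp
next
  case (Suc k)
  have "continuous_on U f"
    by (rule continuous_on_local_Rn[OF U]) (meson Suc.prems Ck_continuous_on)
  moreover have "(\<lambda>t. f (x(i := t))) field_differentiable at (x i)" if "i < n" "x \<in> U" for i x
    using Suc.prems[OF that(2)] that by auto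
  moreover have "Ck_on n k U (partial_deriv i f)" if "i < n" for i
    using Suc.prems that by (intro Suc.IH) fastforce
  ultimately show ?case using sub_Euclidean[OF U] by auto
qed

lemma Ck_prod:
  assumes U: "openin (Euclidean_space n) U" and "finite J" "\<And>j. j \<in> J \<Longrightarrow> Ck_on n k U (f j)"
  shows "Ck_on n k U (\<lambda>x. \<Prod>j\<in>J. f j x)"
  using assms(2,3) by (induction J) (auto intro: Ck_const[OF U] Ck_mult[OF U])

lemma Ck_minus:
  assumes U: "openin (Euclidean_space n) U" and "Ck_on n k U f" 
  shows "Ck_on n k U (\<lambda>x. - f x)"
  using Ck_mult[OF U Ck_const[OF U, of k "-1"] assms(2)] by simp

lemma Ck_diff:
  assumes U: "openin (Euclidean_space n) U" and "Ck_on n k U f" "Ck_on n k U g"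
  shows "Ck_on n k U (\<lambda>x. f x - g x)"
  using Ck_add[OF U assms(2) Ck_minus[OF U assms(3)]] by simp

lemma Ck_power:
  assumes U: "openin (Euclidean_space n) U" and "Ck_on n k U f"
  shows "Ck_on n k U (\<lambda>x. f x ^ d)"
  by (induction d) (auto intro: Ck_const[OF U] Ck_mult[OF U] assms(2))

lemma Ck_inverse:
  assumes U: "openin (Euclidean_space n) U"
  shows "Ck_on n k U f \<Longrightarrow> (\<And>x. x \<in> U \<Longrightarrow> f x \<noteq> 0) \<Longrightarrow> Ck_on n k U (\<lambda>x. inverse (f x))"
proof (induction k)
  case 0
  then show ?case by (auto simp: sub_Euclidean[OF U] intro!: continuous_intros)
next
  case (Suc k)
  show ?case
  proof (rule Ck_SucI[OF U])
    show "continuous_on U (\<lambda>x. inverse (f x))"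
      using Suc.prems Ck_continuous_on[OF U] by (intro continuous_on_inverse) blast+
    show "((\<lambda>t. inverse (f (x(i := t)))) has_field_derivative
        - (inverse (f x) * partial_deriv i f x * inverse (f x))) (at (x i))" if "i < n" "x \<in> U" for i x
      using DERIV_inverse'[OF partial_DERIV[OF Suc.prems(1) that]] Suc.prems(2)[OF that(2)]
      by (simp only: fun_upd_triv simp_thms)
    show "Ck_on n k U (\<lambda>x. - (inverse (f x) * partial_deriv i f x * inverse (f x)))" if "i < n" for i
      using Suc that Ck_mono by (intro Ck_minus[OF U] Ck_mult[OF U]) auto
  qed
qed

section \<open>Bump functions on Euclidean space\<close>

text \<open>
  For \<open>q = 1\<close> this is the classical function that is flat at \<open>0\<close>; the polynomial factor makes the
  family closed under differentiation.
\<close>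

definition flat :: "real poly \<Rightarrow> real \<Rightarrow> real" where
  "flat q s = (if s > 0 then poly q (inverse s) * exp (- inverse s) else 0)"

lemma flat_tendsto_0: "(flat q \<longlongrightarrow> 0) (at 0)"
proof (rule filterlim_split_at)
  show "(flat q \<longlongrightarrow> 0) (at_left 0)"
    by (rule tendsto_eventually) (auto simp: flat_def eventually_at_filter)
  have "((\<lambda>u. poly q u * exp (- u)) \<longlongrightarrow> 0) at_top"
  proof -
    have "((\<lambda>u. \<Sum>i\<le>degree q. coeff q i * (u ^ i / exp u)) \<longlongrightarrow> (\<Sum>i\<le>degree q. coeff q i * 0)) at_top"
      by (intro tendsto_sum tendsto_mult tendsto_const tendsto_power_div_exp_0)
    then show ?thesis
      by (simp add: poly_altdef sum_distrib_right exp_minus divide_inverse mult.assoc)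
  qed
  then have "((\<lambda>s. poly q (inverse s) * exp (- inverse s)) \<longlongrightarrow> 0) (at_right 0)"
    by (rule filterlim_compose) (rule filterlim_inverse_at_top_right)
  then show "(flat q \<longlongrightarrow> 0) (at_right 0)"
    by (rule Lim_transform_eventually) (auto simp: flat_def eventually_at_filter)
qed

lemma flat_DERIV:
  "(flat q has_field_derivative flat ([:0, 0, 1:] * (q - pderiv q)) s) (at s)"
proof (cases s "0::real" rule: linorder_cases)
  case less
  have "((\<lambda>_. 0) has_field_derivative 0) (at s)" by simp
  moreover have "\<forall>\<^sub>F x in nhds s. flat q x = 0"
    using less eventually_nhds_in_open[of "{..<0}" s] by (auto simp: flat_def elim: eventually_mono)
  ultimately show ?thesis using less by (subst DERIV_cong_ev) (auto simp: flat_def)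
next
  case equal
  \<comment> \<open>The difference quotient of \<open>flat q\<close> at \<open>0\<close> is again a member of the family.\<close>
  have "(flat (pCons 0 q) \<longlongrightarrow> 0) (at 0)" by (rule flat_tendsto_0)
  then have "((\<lambda>x. (flat q x - flat q 0) / (x - 0)) \<longlongrightarrow> 0) (at 0)"
    by (rule Lim_transform_eventually) (auto simp: flat_def eventually_at_filter divide_inverse)
  then show ?thesis using equal by (simp add: has_field_derivative_iff flat_def)
next
  case greater
  have "((\<lambda>x. poly q (inverse x) * exp (- inverse x)) has_field_derivative
     flat ([:0, 0, 1:] * (q - pderiv q)) s) (at s)"
    using greater
    by (auto simp: flat_def algebra_simps power2_eq_square
        intro!: derivative_eq_intros poly_DERIV[THEN DERIV_chain2])
  moreover have "\<forall>\<^sub>F x in nhds s. flat q x = poly q (inverse x) * exp (- inverse x)"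
    using greater eventually_nhds_in_open[of "{0<..}" s] by (auto simp: flat_def elim: eventually_mono)
  ultimately show ?thesis by (subst DERIV_cong_ev) auto
qed

lemma Ck_flat:
  assumes U: "openin (Euclidean_space n) U"
  shows "Ck_on n k U g \<Longrightarrow> Ck_on n k U (\<lambda>x. flat q (g x))"
proof (induction k arbitrary: q)
  have c: "continuous_on A (flat q)" for A q
    using flat_DERIV DERIV_isCont continuous_at_imp_continuous_on by blast
  case 0
  then show ?case
    by (auto simp: sub_Euclidean[OF U] intro: continuous_on_compose2[OF c[of UNIV]])
next
  have c: "continuous_on A (flat q)" for A q
    using flat_DERIV DERIV_isCont continuous_at_imp_continuous_on by blast
  case (Suc k)
  show ?case
  proof (rule Ck_SucI[OF U])
    show "continuous_on U (\<lambda>x. flat q (g x))"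
      using Ck_continuous_on[OF U Suc.prems] by (auto intro: continuous_on_compose2[OF c[of UNIV]])
    show "((\<lambda>t. flat q (g (x(i := t)))) has_field_derivative
        flat ([:0, 0, 1:] * (q - pderiv q)) (g x) * partial_deriv i g x) (at (x i))"
      if "i < n" "x \<in> U" for i x
      using DERIV_chain2[OF flat_DERIV partial_DERIV[OF Suc.prems that]] by (simp only: fun_upd_triv)
    show "Ck_on n k U (\<lambda>x. flat ([:0, 0, 1:] * (q - pderiv q)) (g x) * partial_deriv i g x)"
      if "i < n" for i
      using Suc that Ck_mono by (intro Ck_mult[OF U]) auto
  qed
qed

definition box_Rn :: "nat \<Rightarrow> (nat \<Rightarrow> real) \<Rightarrow> real \<Rightarrow> (nat \<Rightarrow> real) set" where
  "box_Rn n p r = {t \<in> Rn n. \<forall>i<n. \<bar>t i - p i\<bar> < r}"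

definition cbox_Rn :: "nat \<Rightarrow> (nat \<Rightarrow> real) \<Rightarrow> real \<Rightarrow> (nat \<Rightarrow> real) set" where
  "cbox_Rn n p r = {t \<in> Rn n. \<forall>i<n. \<bar>t i - p i\<bar> \<le> r}"

lemma openin_box_Rn: "openin (Euclidean_space n) (box_Rn n p r)"
proof -
  have "open (\<Inter>i\<in>{..<n}. {t::nat \<Rightarrow> real. \<bar>t i - p i\<bar> < r})"
    by (intro open_INT finite_lessThan ballI open_Collect_less continuous_intros
        continuous_on_product_coordinates)
  moreover have "box_Rn n p r = Rn n \<inter> (\<Inter>i\<in>{..<n}. {t. \<bar>t i - p i\<bar> < r})"
    by (auto simp: box_Rn_def)
  ultimately show ?thesis
    by (subst Euclidean_space_euclidean) (simp only: openin_open_Int)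
qed

lemma compactin_cbox_Rn: "compactin (Euclidean_space n) (cbox_Rn n p r)"
proof -
  let ?S = "\<lambda>i. if i < n then {p i - r..p i + r} else {0}"
  have "t \<in> cbox_Rn n p r \<longleftrightarrow> (\<forall>i. t i \<in> ?S i)" for t
  proof -
    have "(t i \<in> ?S i) \<longleftrightarrow> (n \<le> i \<longrightarrow> t i = 0) \<and> (i < n \<longrightarrow> \<bar>t i - p i\<bar> \<le> r)" for i
      by (cases "i < n") (simp_all add: abs_diff_le_iff)
    then show ?thesis unfolding cbox_Rn_def mem_Rn mem_Collect_eq by blast
  qed
  then have "cbox_Rn n p r = PiE UNIV ?S" unfolding PiE_UNIV_domain by (auto simp only: Pi_iff)
  then have "compactin (powertop_real UNIV) (cbox_Rn n p r)"
    by (simp add: compactin_PiE)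
  moreover have "cbox_Rn n p r \<subseteq> Rn n" by (auto simp: cbox_Rn_def)
  ultimately show ?thesis
    by (simp add: Euclidean_space_def compactin_subtopology)
qed

lemma cbox_Rn_inside:
  assumes W: "openin (Euclidean_space n) W" and p: "p \<in> W"
  obtains r where "r > 0" "cbox_Rn n p r \<subseteq> W"
proof -
  obtain T where T: "openin (powertop_real UNIV) T" "W = Rn n \<inter> T"
    using W[unfolded Euclidean_space_def openin_subtopology] topspace_Euclidean_space[of n] by auto
  with p obtain X where X: "p \<in> PiE UNIV X" "\<And>i. openin euclideanreal (X i)" "PiE UNIV X \<subseteq> T"
    using product_topology_open_contains_basis[OF T(1), of p] by auto
  have "\<exists>e>0. {p i - e..p i + e} \<subseteq> X i" for i
  proof -
    have "open (X i)" "p i \<in> X i" using X by auto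
    then obtain e where "e > 0" "cball (p i) e \<subseteq> X i" using open_contains_cball by blast
    then show ?thesis by (auto simp: cball_eq_atLeastAtMost)
  qed
  then obtain e where e: "\<And>i. e i > 0" "\<And>i. {p i - e i..p i + e i} \<subseteq> X i" by metis
  define r where "r = Min (insert 1 (e ` {..<n}))"
  have r: "r > 0" "\<And>i. i < n \<Longrightarrow> r \<le> e i" using e(1) by (auto simp: r_def)
  have "t i \<in> X i" if t: "t \<in> cbox_Rn n p r" for t i
  proof (cases "i < n")
    case True
    then have "\<bar>t i - p i\<bar> \<le> e i" using t r(2)[OF True] by (force simp: cbox_Rn_def)
    then show ?thesis using e(2)[of i] by (auto simp: abs_le_iff)
  next
    case False
    then have "t i = p i" using t p T(2) by (simp add: cbox_Rn_def mem_Rn)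
    then show ?thesis using X(1) by auto
  qed
  then have "cbox_Rn n p r \<subseteq> W"
    using X(3) T(2) by (auto simp: cbox_Rn_def)
  then show thesis using r(1) that by blast
qed

lemma bump_Rn:
  assumes W: "openin (Euclidean_space n) W" and p: "p \<in> W"
  obtains b C where "smooth_on n (Rn n) b" "\<And>t. b t \<ge> 0" "b p > 0"
    "compactin (Euclidean_space n) C" "C \<subseteq> W" "\<And>t. t \<in> Rn n \<Longrightarrow> b t \<noteq> 0 \<Longrightarrow> t \<in> C"
proof -
  obtain r where r: "r > 0" "cbox_Rn n p r \<subseteq> W" using cbox_Rn_inside[OF W p] .
  define b where "b = (\<lambda>t. \<Prod>i<n. flat 1 (r\<^sup>2 - (t i - p i)\<^sup>2))"
  show thesis
  proof (rule that[of b "cbox_Rn n p r"])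
    show "smooth_on n (Rn n) b" unfolding smooth_on_def b_def
      by (intro allI Ck_prod Ck_flat Ck_diff Ck_power Ck_const Ck_coord) auto
    show "b t \<ge> 0" for t unfolding b_def by (intro prod_nonneg) (auto simp: flat_def)
    show "b p > 0" using r unfolding b_def by (intro prod_pos) (auto simp: flat_def)
    show "t \<in> cbox_Rn n p r" if "t \<in> Rn n" "b t \<noteq> 0" for t
    proof -
      have "\<bar>t i - p i\<bar> \<le> r" if "i < n" for i
      proof -
        have "flat 1 (r\<^sup>2 - (t i - p i)\<^sup>2) \<noteq> 0"
          using \<open>b t \<noteq> 0\<close> that unfolding b_def by auto
        then have "(t i - p i)\<^sup>2 \<le> r\<^sup>2" by (auto simp: flat_def split: if_splits)
        then show ?thesis using r(1) by (metis abs_le_square_iff abs_of_pos)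
      qed
      then show ?thesis using that by (simp add: cbox_Rn_def)
    qed
  qed (fact compactin_cbox_Rn r(2))+
qed

section \<open>Functions with compact support\<close>

definition Cc :: "'a topology \<Rightarrow> ('a \<Rightarrow> real) set" where
  "Cc X = {f. continuous_map X euclideanreal f \<and>
     (\<exists>K. compactin X K \<and> (\<forall>x\<in>topspace X. f x \<noteq> 0 \<longrightarrow> x \<in> K))}"

definition Cc_nonneg :: "'a topology \<Rightarrow> ('a \<Rightarrow> real) set" where
  "Cc_nonneg X = {f \<in> Cc X. \<forall>x\<in>topspace X. 0 \<le> f x}"

lemma compactin_finite_subcover:
  assumes "compactin X K" "\<And>i. i \<in> I \<Longrightarrow> openin X (U i)" "K \<subseteq> (\<Union>i\<in>I. U i)"
  shows "\<exists>F. finite F \<and> F \<subseteq> I \<and> K \<subseteq> (\<Union>i\<in>F. U i)"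
proof -
  have "\<exists>\<F>. finite \<F> \<and> \<F> \<subseteq> U ` I \<and> K \<subseteq> \<Union>\<F>"
    by (rule compactinD[OF assms(1)]) (use assms in auto)
  then show ?thesis by (metis finite_subset_image)
qed

lemma Cc_add: "f \<in> Cc X \<Longrightarrow> g \<in> Cc X \<Longrightarrow> (\<lambda>x. f x + g x) \<in> Cc X"
proof -
  assume "f \<in> Cc X" "g \<in> Cc X"
  then obtain K L where "compactin X K" "compactin X L"
    "\<forall>x\<in>topspace X. f x \<noteq> 0 \<longrightarrow> x \<in> K" "\<forall>x\<in>topspace X. g x \<noteq> 0 \<longrightarrow> x \<in> L"
    "continuous_map X euclideanreal f" "continuous_map X euclideanreal g"
    by (auto simp: Cc_def)
  then show ?thesis unfolding Cc_def
    by (auto intro!: continuous_intros exI[of _ "K \<union> L"] compactin_Un)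
qed

lemma Cc_mult:
  assumes "f \<in> Cc X" "continuous_map X euclideanreal g"
  shows "(\<lambda>x. g x * f x) \<in> Cc X"
  using assms by (auto simp: Cc_def intro!: continuous_intros)

lemma Cc_cmult: "f \<in> Cc X \<Longrightarrow> (\<lambda>x. c * f x) \<in> Cc X"
  by (intro Cc_mult) simp_all

lemma Cc_diff: "f \<in> Cc X \<Longrightarrow> g \<in> Cc X \<Longrightarrow> (\<lambda>x. f x - g x) \<in> Cc X"
  using Cc_add[of f X "\<lambda>x. (-1) * g x"] Cc_cmult[of g X "-1"] by simp

lemma Cc_pos_part: "f \<in> Cc X \<Longrightarrow> (\<lambda>x. max (f x) 0) \<in> Cc_nonneg X"
  by (auto simp: Cc_def Cc_nonneg_def intro!: continuous_intros split: if_splits)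

lemma Cc_neg_part: "f \<in> Cc X \<Longrightarrow> (\<lambda>x. max (- f x) 0) \<in> Cc_nonneg X"
  using Cc_pos_part[of "\<lambda>x. (-1) * f x" X] Cc_cmult[of f X "-1"] by simp

lemma Cc_nonneg_add: "f \<in> Cc_nonneg X \<Longrightarrow> g \<in> Cc_nonneg X \<Longrightarrow> (\<lambda>x. f x + g x) \<in> Cc_nonneg X"
  by (auto simp: Cc_nonneg_def Cc_add)

lemma Cc_nonneg_cmult: "f \<in> Cc_nonneg X \<Longrightarrow> 0 \<le> c \<Longrightarrow> (\<lambda>x. c * f x) \<in> Cc_nonneg X"
  by (auto simp: Cc_nonneg_def Cc_cmult)

lemma Cc_bounded:
  assumes "f \<in> Cc X"
  obtains B where "B > 0" "\<And>x. x \<in> topspace X \<Longrightarrow> \<bar>f x\<bar> \<le> B"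
proof -
  obtain K where K: "compactin X K" "\<forall>x\<in>topspace X. f x \<noteq> 0 \<longrightarrow> x \<in> K"
    and c: "continuous_map X euclideanreal f"
    using assms by (auto simp: Cc_def)
  have "compact (f ` K)" using image_compactin[OF K(1) c] by simp
  then obtain B where "\<forall>y\<in>f ` K. \<bar>y\<bar> \<le> B" using compact_imp_bounded bounded_real by blast
  then have "\<bar>f x\<bar> \<le> max B 1" if "x \<in> topspace X" for x
    using K(2) that by (cases "f x = 0") (auto simp: le_max_iff_disj)
  then show thesis by (intro that[of "max B 1"]) auto
qed

lemma Cc_nonneg_bump:
  assumes X: "locally_compact_space X" "Hausdorff_space X"
    and V: "openin X V" "x \<in> V"
  obtains f where "f \<in> Cc_nonneg X" "f x = 1" "\<And>y. y \<in> topspace X \<Longrightarrow> f y \<noteq> 0 \<Longrightarrow> y \<in> V"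
proof -
  have xX: "x \<in> topspace X" using V openin_subset by blast
  obtain U K where UK: "openin X U" "compactin X K" "x \<in> U" "U \<subseteq> K"
    using X(1) xX unfolding locally_compact_space_def by blast
  have "closedin X (topspace X - U \<inter> V)" using UK V by blast
  moreover have "x \<in> topspace X - (topspace X - U \<inter> V)" using UK V xX by blast
  ultimately obtain f where f: "continuous_map X (top_of_set {0..1::real}) f" "f x = 0"
    "f ` (topspace X - U \<inter> V) \<subseteq> {1}"
    using locally_compact_regular_imp_completely_regular_space[OF X(1)] X(2)
    unfolding completely_regular_space_def by metis
  let ?f = "\<lambda>y. 1 - f y"
  have r: "continuous_map X euclideanreal f" "f y \<le> 1" if "y \<in> topspace X" for y
    using f(1) that by (auto simp: continuous_map_in_subtopology)
  have c: "continuous_map X euclideanreal ?f" using r[OF xX] by (intro continuous_intros)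
  have s: "y \<in> U \<inter> V" if "y \<in> topspace X" "?f y \<noteq> 0" for y
    using f(3) that by force
  have "?f \<in> Cc_nonneg X"
    using c s UK r by (auto simp: Cc_nonneg_def Cc_def intro!: exI[of _ K])
  then show thesis using s f(2) by (intro that[of ?f]) auto
qed

text \<open>
  A weight for uniform estimates: any function bounded by \<open>e\<close> with support in \<open>K\<close> is at most \<open>e \<cdot> w\<close>.
\<close>

lemma Cc_nonneg_ge_1_on_compact:
  assumes X: "locally_compact_space X" "Hausdorff_space X" and K: "compactin X K"
  obtains w where "w \<in> Cc_nonneg X" "\<And>x. x \<in> K \<Longrightarrow> 1 \<le> w x"
proof -
  have KX: "K \<subseteq> topspace X" using K compactin_subset_topspace by blast
  have "\<exists>f. f \<in> Cc_nonneg X \<and> f x = 1" if "x \<in> K" for x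
    using Cc_nonneg_bump[OF X openin_topspace, of x] that KX by blast
  then obtain f where f: "\<And>x. x \<in> K \<Longrightarrow> f x \<in> Cc_nonneg X" "\<And>x. x \<in> K \<Longrightarrow> f x x = 1" by metis
  have o: "openin X {y \<in> topspace X. f x y \<in> {1/2<..}}" if "x \<in> K" for x
    using f(1)[OF that] by (intro openin_continuous_map_preimage) (auto simp: Cc_nonneg_def Cc_def)
  obtain F where F: "finite F" "F \<subseteq> K" "K \<subseteq> (\<Union>x\<in>F. {y \<in> topspace X. f x y \<in> {1/2<..}})"
    using compactin_finite_subcover[OF K, of K "\<lambda>x. {y \<in> topspace X. f x y \<in> {1/2<..}}"] o f(2) KX
    by fastforce
  have s: "(\<lambda>y. \<Sum>x\<in>F. f x y) \<in> Cc_nonneg X"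
    using F(1,2)
  proof (induction F)
    case empty
    show ?case by (auto simp: Cc_nonneg_def Cc_def intro: exI[of _ "{}"])
  next
    case (insert x F)
    then show ?case using Cc_nonneg_add[OF f(1)[of x]] by auto
  qed
  show thesis
  proof (rule that[OF Cc_nonneg_cmult[OF s, of 2]])
    fix y assume y: "y \<in> K"
    then obtain x where x: "x \<in> F" "f x y > 1/2" using F(3) by auto
    have "f x y \<le> (\<Sum>x\<in>F. f x y)"
      using f(1) F y KX x by (intro member_le_sum) (auto simp: Cc_nonneg_def)
    then show "1 \<le> 2 * (\<Sum>x\<in>F. f x y)" using x by linarith
  qed simp
qed

section \<open>Haar covering numbers\<close>

locale locally_compact_group = group G for G (structure) +
  fixes T :: "'a topology"
  assumes topspace_eq: "topspace T = carrier G"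
    and continuous_mult: "continuous_map (prod_topology T T) T (\<lambda>(g, h). g \<otimes> h)"
    and continuous_inv: "continuous_map T T (\<lambda>g. inv g)"
    and Hausdorff: "Hausdorff_space T"
    and locally_compact: "locally_compact_space T"
begin

lemma continuous_right_translation:
  "a \<in> carrier G \<Longrightarrow> continuous_map T T (\<lambda>x. x \<otimes> a)"
  using continuous_map_compose[OF _ continuous_mult, of T "\<lambda>x. (x, a)"]
  by (simp add: continuous_map_pairedI topspace_eq o_def)

lemma Cc_translate:
  assumes f: "f \<in> Cc T" and a: "a \<in> carrier G"
  shows "(\<lambda>x. f (x \<otimes> a)) \<in> Cc T"
proof -
  obtain K where K: "compactin T K" "\<forall>x\<in>topspace T. f x \<noteq> 0 \<longrightarrow> x \<in> K"
    and c: "continuous_map T euclideanreal f"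
    using f by (auto simp: Cc_def)
  have "continuous_map T euclideanreal (\<lambda>x. f (x \<otimes> a))"
    using continuous_map_compose[OF continuous_right_translation[OF a] c] by (simp add: o_def)
  moreover have "compactin T ((\<lambda>x. x \<otimes> inv a) ` K)"
    using image_compactin[OF K(1) continuous_right_translation] a by simp
  moreover have "x \<in> (\<lambda>x. x \<otimes> inv a) ` K" if "x \<in> topspace T" "f (x \<otimes> a) \<noteq> 0" for x
    using K(2) that a by (intro image_eqI[of _ _ "x \<otimes> a"]) (auto simp: topspace_eq m_assoc)
  ultimately show ?thesis by (auto simp: Cc_def)
qed

lemma Cc_nonneg_translate:
  "f \<in> Cc_nonneg T \<Longrightarrow> a \<in> carrier G \<Longrightarrow> (\<lambda>x. f (x \<otimes> a)) \<in> Cc_nonneg T"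
  by (auto simp: Cc_nonneg_def Cc_translate topspace_eq)

text \<open>
  The tube lemma gives the estimate for \<open>y\<close> in the support \<open>K\<close>. If only \<open>v \<otimes> y\<close> lies in \<open>K\<close>, one
  moves back from there by \<open>inv v\<close>; this is why \<open>V\<close> is made symmetric.
\<close>

lemma Cc_uniformly_continuous:
  assumes f: "f \<in> Cc T" and e: "0 < (e::real)"
  obtains V where "openin T V" "\<one> \<in> V"
    "\<And>v y. v \<in> V \<Longrightarrow> y \<in> carrier G \<Longrightarrow> \<bar>f (v \<otimes> y) - f y\<bar> < e"
proof -
  obtain K where K: "compactin T K" "\<forall>x\<in>topspace T. f x \<noteq> 0 \<longrightarrow> x \<in> K"
    and c: "continuous_map T euclideanreal f"
    using f by (auto simp: Cc_def)
  define W where "W = {p \<in> topspace (prod_topology T T). (\<lambda>(v, y). f (v \<otimes> y) - f y) p \<in> {-e<..<e}}"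
  have "continuous_map (prod_topology T T) euclideanreal (\<lambda>(v, y). f (v \<otimes> y) - f y)"
    using continuous_map_compose[OF continuous_mult c] continuous_map_compose[OF continuous_map_snd c]
    by (auto simp: o_def case_prod_unfold intro!: continuous_map_diff)
  then have W: "openin (prod_topology T T) W"
    unfolding W_def by (rule openin_continuous_map_preimage) simp
  have "K \<subseteq> carrier G" using K(1) compactin_subset_topspace topspace_eq by blast
  then have "{\<one>} \<times> K \<subseteq> W" using e by (auto simp: W_def topspace_eq)
  then obtain U V where UV: "openin T U" "\<one> \<in> U" "K \<subseteq> V" "U \<times> V \<subseteq> W"
    using tube_lemma_right[OF W K(1)] topspace_eq by (metis one_closed)
  have UG: "U \<subseteq> carrier G" using UV(1) openin_subset topspace_eq by blast
  have near: "\<bar>f (u \<otimes> y) - f y\<bar> < e" if "u \<in> U" "y \<in> K" for u y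
  proof -
    have "(u, y) \<in> W" using that UV by blast
    then show ?thesis by (auto simp: W_def abs_less_iff)
  qed
  let ?U = "{x \<in> topspace T. inv x \<in> U}"
  show thesis
  proof (rule that[of "U \<inter> ?U"])
    show "openin T (U \<inter> ?U)"
      using UV(1) openin_continuous_map_preimage[OF continuous_inv] by blast
    show "\<one> \<in> U \<inter> ?U" using UV(2) by (simp add: topspace_eq)
    fix v y assume v: "v \<in> U \<inter> ?U" and y: "y \<in> carrier G"
    have vG: "v \<in> carrier G" using v UG by blast
    show "\<bar>f (v \<otimes> y) - f y\<bar> < e"
    proof (cases "y \<in> K")
      case True
      then show ?thesis using near v by blast
    next
      case y0: False
      show ?thesis
      proof (cases "v \<otimes> y \<in> K")
        case True
        then have "\<bar>f (inv v \<otimes> (v \<otimes> y)) - f (v \<otimes> y)\<bar> < e" using near v by blast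
        moreover have "inv v \<otimes> (v \<otimes> y) = y" using vG y by (simp flip: m_assoc)
        ultimately show ?thesis by (simp add: abs_minus_commute)
      next
        case False
        then have "f (v \<otimes> y) = 0" "f y = 0" using y0 K(2) vG y by (auto simp: topspace_eq)
        then show ?thesis using e by simp
      qed
    qed
  qed
qed

definition translate_sum :: "('a \<Rightarrow> real) \<Rightarrow> (real \<times> 'a) list \<Rightarrow> 'a \<Rightarrow> real" where
  "translate_sum \<phi> cs x = (\<Sum>(c, y)\<leftarrow>cs. c * \<phi> (x \<otimes> y))"

definition weight :: "(real \<times> 'a) list \<Rightarrow> real" where
  "weight cs = (\<Sum>(c, y)\<leftarrow>cs. c)"

definition covers :: "('a \<Rightarrow> real) \<Rightarrow> ('a \<Rightarrow> real) \<Rightarrow> (real \<times> 'a) list set" where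
  "covers f \<phi> = {cs. (\<forall>(c, y)\<in>set cs. 0 \<le> c \<and> y \<in> carrier G) \<and>
     (\<forall>x\<in>carrier G. f x \<le> translate_sum \<phi> cs x)}"

text \<open>
  Haar's covering number \<open>(f : \<phi>)\<close>, with right translates of \<open>\<phi>\<close>.
\<close>

definition cov :: "('a \<Rightarrow> real) \<Rightarrow> ('a \<Rightarrow> real) \<Rightarrow> real" where
  "cov f \<phi> = Inf (weight ` covers f \<phi>)"

text \<open>
  Positivity at the unit ensures that finitely many translates cover any given compact set.
\<close>

definition test_functions :: "('a \<Rightarrow> real) set" where
  "test_functions = {\<phi> \<in> Cc_nonneg T. 0 < \<phi> \<one>}"

lemma translate_sum_simps [simp]:
  "translate_sum \<phi> [] x = 0"
  "translate_sum \<phi> ((c, y) # cs) x = c * \<phi> (x \<otimes> y) + translate_sum \<phi> cs x"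
  "translate_sum \<phi> (cs @ ds) x = translate_sum \<phi> cs x + translate_sum \<phi> ds x"
  by (simp_all add: translate_sum_def)

lemma weight_simps [simp]:
  "weight [] = 0" "weight ((c, y) # cs) = c + weight cs" "weight (cs @ ds) = weight cs + weight ds"
  by (simp_all add: weight_def)

lemma test_functionD:
  assumes "\<phi> \<in> test_functions"
  shows "\<phi> \<in> Cc T" "\<phi> \<in> Cc_nonneg T" "x \<in> carrier G \<Longrightarrow> 0 \<le> \<phi> x" "0 < \<phi> \<one>"
  using assms by (auto simp: test_functions_def Cc_nonneg_def topspace_eq)

lemma weight_nonneg:
  assumes "\<forall>(c, y)\<in>set cs. 0 \<le> c \<and> y \<in> carrier G"
  shows "0 \<le> weight cs"
  using assms by (induction cs) auto

lemma bdd_below_weight_covers: "bdd_below (weight ` covers f \<phi>)"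
  by (rule bdd_belowI[of _ 0]) (auto simp: covers_def intro: weight_nonneg)

lemma covers_nonempty:
  assumes f: "f \<in> Cc T" and \<phi>: "\<phi> \<in> test_functions"
  shows "covers f \<phi> \<noteq> {}"
proof -
  obtain K where K: "compactin T K" "\<forall>x\<in>topspace T. f x \<noteq> 0 \<longrightarrow> x \<in> K"
    using f by (auto simp: Cc_def)
  obtain B where B: "B > 0" "\<And>x. x \<in> topspace T \<Longrightarrow> \<bar>f x\<bar> \<le> B" using Cc_bounded[OF f] by blast
  note \<phi>' = test_functionD[OF \<phi>]
  let ?U = "\<lambda>y. {x \<in> topspace T. \<phi> (x \<otimes> y) \<in> {\<phi> \<one> / 2<..}}"
  have "openin T (?U y)" if "y \<in> carrier G" for y
    using Cc_translate[OF \<phi>'(1) that]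
    by (intro openin_continuous_map_preimage) (auto simp: Cc_def)
  moreover have "K \<subseteq> (\<Union>y\<in>carrier G. ?U y)"
  proof
    fix x assume "x \<in> K"
    then have x: "x \<in> carrier G" using K(1) compactin_subset_topspace topspace_eq by blast
    then have "x \<in> ?U (inv x)" using \<phi>'(4) by (simp add: topspace_eq)
    then show "x \<in> (\<Union>y\<in>carrier G. ?U y)" using x by blast
  qed
  ultimately obtain F where F: "finite F" "F \<subseteq> carrier G" "K \<subseteq> (\<Union>y\<in>F. ?U y)"
    using compactin_finite_subcover[OF K(1), of "carrier G" ?U] by blast
  \<comment> \<open>Each point of \<open>K\<close> has a translate with value above \<open>\<phi> \<one> / 2\<close>, so this weight reaches the bound \<open>B\<close>.\<close>
  define c where "c = 2 * B / \<phi> \<one>"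
  have c: "0 \<le> c" using B \<phi>'(4) by (simp add: c_def)
  obtain ys where ys: "set ys = F" using finite_list[OF F(1)] by blast
  define cs where "cs = map (\<lambda>y. (c, y)) ys"
  have s: "0 \<le> translate_sum \<phi> (map (\<lambda>y. (c, y)) ys) x" if "x \<in> carrier G" "set ys \<subseteq> carrier G" for x ys
    using that c \<phi>'(3) by (induction ys) auto
  have "f x \<le> translate_sum \<phi> cs x" if x: "x \<in> carrier G" for x
  proof (cases "x \<in> K")
    case False
    then have "f x = 0" using K(2) x topspace_eq by auto
    then show ?thesis using s[OF x, of ys] ys F(2) by (simp add: cs_def)
  next
    case True
    then obtain y where y: "y \<in> set ys" "\<phi> (x \<otimes> y) > \<phi> \<one> / 2" using F(3) ys by auto
    then obtain as bs where ab: "ys = as @ y # bs" using split_list[OF y(1)] by blast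
    have "f x \<le> B" using B(2)[of x] x topspace_eq by auto
    also have "\<dots> = c * (\<phi> \<one> / 2)" using \<phi>'(4) by (simp add: c_def)
    also have "\<dots> \<le> c * \<phi> (x \<otimes> y)" using y c by (intro mult_left_mono) auto
    also have "\<dots> \<le> translate_sum \<phi> cs x"
      using s[OF x, of as] s[OF x, of bs] ys F(2) by (auto simp: cs_def ab)
    finally show ?thesis .
  qed
  then have "cs \<in> covers f \<phi>" using c ys F(2) by (auto simp: covers_def cs_def)
  then show ?thesis by blast
qed

lemma cov_le_weight: "cs \<in> covers f \<phi> \<Longrightarrow> cov f \<phi> \<le> weight cs"
  unfolding cov_def by (intro cInf_lower bdd_below_weight_covers) auto

lemma cov_greatest:
  assumes "f \<in> Cc T" "\<phi> \<in> test_functions" "\<And>cs. cs \<in> covers f \<phi> \<Longrightarrow> b \<le> weight cs"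
  shows "b \<le> cov f \<phi>"
  unfolding cov_def using assms covers_nonempty[OF assms(1,2)] by (intro cInf_greatest) auto

lemma cov_nonneg: "f \<in> Cc T \<Longrightarrow> \<phi> \<in> test_functions \<Longrightarrow> 0 \<le> cov f \<phi>"
  by (rule cov_greatest) (auto simp: covers_def intro: weight_nonneg)

lemma cov_mono:
  assumes "g \<in> Cc T" "\<phi> \<in> test_functions" "\<And>x. x \<in> carrier G \<Longrightarrow> f x \<le> g x"
  shows "cov f \<phi> \<le> cov g \<phi>"
proof (rule cov_greatest[OF assms(1,2)])
  fix cs assume "cs \<in> covers g \<phi>"
  then have "cs \<in> covers f \<phi>" using assms(3) by (force simp: covers_def)
  then show "cov f \<phi> \<le> weight cs" by (rule cov_le_weight)
qed

lemma cov_add: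
  assumes f: "f \<in> Cc T" and g: "g \<in> Cc T" and \<phi>: "\<phi> \<in> test_functions"
  shows "cov (\<lambda>x. f x + g x) \<phi> \<le> cov f \<phi> + cov g \<phi>"
proof -
  have step: "cov (\<lambda>x. f x + g x) \<phi> - weight cs \<le> weight ds"
    if "cs \<in> covers f \<phi>" "ds \<in> covers g \<phi>" for cs ds
  proof -
    have "cs @ ds \<in> covers (\<lambda>x. f x + g x) \<phi>"
      using that by (auto simp: covers_def intro!: add_mono)
    from cov_le_weight[OF this] show ?thesis by simp
  qed
  have "cov (\<lambda>x. f x + g x) \<phi> - weight cs \<le> cov g \<phi>" if "cs \<in> covers f \<phi>" for cs
    by (rule cov_greatest[OF g \<phi> step[OF that]])
  then have "cov (\<lambda>x. f x + g x) \<phi> - cov g \<phi> \<le> cov f \<phi>"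
    by (intro cov_greatest[OF f \<phi>]) (simp add: algebra_simps)
  then show ?thesis by simp
qed

lemma translate_sum_scale:
  "translate_sum \<phi> (map (\<lambda>(d, y). (c * d, y)) cs) x = c * translate_sum \<phi> cs x"
  by (induction cs) (auto simp: algebra_simps)

lemma weight_scale: "weight (map (\<lambda>(d, y). (c * d, y)) cs) = c * weight cs"
  by (induction cs) (auto simp: algebra_simps)

lemma cov_cmult_le:
  assumes f: "f \<in> Cc T" and \<phi>: "\<phi> \<in> test_functions" and c: "0 < c"
  shows "cov (\<lambda>x. c * f x) \<phi> \<le> c * cov f \<phi>"
proof -
  have "cov (\<lambda>x. c * f x) \<phi> / c \<le> cov f \<phi>"
  proof (rule cov_greatest[OF f \<phi>])
    fix cs assume "cs \<in> covers f \<phi>"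
    then have "map (\<lambda>(d, y). (c * d, y)) cs \<in> covers (\<lambda>x. c * f x) \<phi>"
      using c by (force simp: covers_def translate_sum_scale)
    from cov_le_weight[OF this, unfolded weight_scale] show "cov (\<lambda>x. c * f x) \<phi> / c \<le> weight cs"
      using c by (simp add: field_simps)
  qed
  then show ?thesis using c by (simp add: field_simps)
qed

lemma cov_cmult:
  assumes f: "f \<in> Cc T" and \<phi>: "\<phi> \<in> test_functions" and c: "0 \<le> c"
  shows "cov (\<lambda>x. c * f x) \<phi> = c * cov f \<phi>"
proof (cases "c = 0")
  case True
  have "[] \<in> covers (\<lambda>x. 0) \<phi>" by (auto simp: covers_def)
  then have "cov (\<lambda>x. 0) \<phi> \<le> 0" using cov_le_weight by fastforce
  moreover have "(\<lambda>x. 0) \<in> Cc T" using Cc_cmult[OF f, of 0] by simp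
  ultimately show ?thesis using True cov_nonneg[OF _ \<phi>, of "\<lambda>x. 0"] by simp
next
  case False
  then have c: "0 < c" using c by simp
  have "cov (\<lambda>x. inverse c * (c * f x)) \<phi> \<le> inverse c * cov (\<lambda>x. c * f x) \<phi>"
    using c by (intro cov_cmult_le Cc_cmult f \<phi>) simp
  moreover have "(\<lambda>x. inverse c * (c * f x)) = f" using c by (simp add: fun_eq_iff)
  ultimately have "c * cov f \<phi> \<le> cov (\<lambda>x. c * f x) \<phi>" using c by (simp add: field_simps)
  then show ?thesis using cov_cmult_le[OF f \<phi> c] by simp
qed

text \<open>
  Left multiplication of the nodes of a cover by \<open>a\<close> turns a cover of \<open>f\<close> into one of its translate.
\<close>

lemma cov_translate_le:
  assumes f: "f \<in> Cc T" and \<phi>: "\<phi> \<in> test_functions" and a: "a \<in> carrier G"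
  shows "cov (\<lambda>x. f (x \<otimes> a)) \<phi> \<le> cov f \<phi>"
proof (rule cov_greatest[OF f \<phi>])
  fix cs assume cs: "cs \<in> covers f \<phi>"
  let ?ds = "map (\<lambda>(c, y). (c, a \<otimes> y)) cs"
  have t: "translate_sum \<phi> (map (\<lambda>(c, y). (c, a \<otimes> y)) cs) x = translate_sum \<phi> cs (x \<otimes> a)"
    if "x \<in> carrier G" "\<forall>(c, y)\<in>set cs. 0 \<le> c \<and> y \<in> carrier G" for x cs
    using that(2) by (induction cs) (use that a in \<open>auto simp: m_assoc\<close>)
  have "?ds \<in> covers (\<lambda>x. f (x \<otimes> a)) \<phi>"
    using cs a by (auto simp: covers_def t)
  moreover have "weight ?ds = weight cs" by (induction cs) auto
  ultimately show "cov (\<lambda>x. f (x \<otimes> a)) \<phi> \<le> weight cs"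
    using cov_le_weight by metis
qed

lemma cov_translate:
  assumes f: "f \<in> Cc T" and \<phi>: "\<phi> \<in> test_functions" and a: "a \<in> carrier G"
  shows "cov (\<lambda>x. f (x \<otimes> a)) \<phi> = cov f \<phi>"
proof (rule antisym[OF cov_translate_le[OF assms]])
  have "cov f \<phi> \<le> cov (\<lambda>x. f (x \<otimes> inv a \<otimes> a)) \<phi>"
    using Cc_translate[OF Cc_translate[OF f a], of "inv a"] a
    by (intro cov_mono \<phi>) (simp_all add: m_assoc)
  also have "\<dots> \<le> cov (\<lambda>x. f (x \<otimes> a)) \<phi>"
    using a by (intro cov_translate_le[OF Cc_translate[OF f a] \<phi>]) simp
  finally show "cov f \<phi> \<le> cov (\<lambda>x. f (x \<otimes> a)) \<phi>" .
qed

text \<open>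
  Substituting covers of \<open>\<psi>\<close> by translates of \<open>\<phi>\<close> into a cover of \<open>f\<close> by translates of \<open>\<psi>\<close>. It bounds
  the normalised covering number \<open>cov f \<phi> / cov f0 \<phi>\<close> by \<open>cov f f0\<close>, uniformly in \<open>\<phi>\<close>; these bounds are
  the compact factors to which Tychonoff's theorem applies.
\<close>

lemma cov_submult:
  assumes f: "f \<in> Cc T" and \<psi>: "\<psi> \<in> test_functions" and \<phi>: "\<phi> \<in> test_functions"
  shows "cov f \<phi> \<le> cov f \<psi> * cov \<psi> \<phi>"
proof -
  have \<psi>T: "\<psi> \<in> Cc T" using test_functionD[OF \<psi>] by blast
  have step: "cov f \<phi> \<le> weight cs * cov \<psi> \<phi>" if cs: "cs \<in> covers f \<psi>" for cs
  proof -
    have "cov (translate_sum \<psi> cs) \<phi> \<le> weight cs * cov \<psi> \<phi> \<and> translate_sum \<psi> cs \<in> Cc T"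
      if "\<forall>(c, y)\<in>set cs. 0 \<le> c \<and> y \<in> carrier G" for cs
      using that
    proof (induction cs)
      case Nil
      have "(\<lambda>x. 0) = translate_sum \<psi> []" by auto
      then show ?case using cov_cmult[OF \<psi>T \<phi>, of 0] Cc_cmult[OF \<psi>T, of 0] by simp
    next
      case (Cons p cs)
      obtain c y where p: "p = (c, y)" by fastforce
      with Cons.prems have cy: "0 \<le> c" "y \<in> carrier G" by auto
      have t: "translate_sum \<psi> (p # cs) = (\<lambda>x. c * \<psi> (x \<otimes> y) + translate_sum \<psi> cs x)"
        by (auto simp: p)
      have C: "(\<lambda>x. c * \<psi> (x \<otimes> y)) \<in> Cc T" by (intro Cc_cmult Cc_translate \<psi>T cy)
      have "cov (\<lambda>x. c * \<psi> (x \<otimes> y)) \<phi> = c * cov \<psi> \<phi>"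
        using cov_cmult[OF Cc_translate[OF \<psi>T cy(2)] \<phi> cy(1)] cov_translate[OF \<psi>T \<phi> cy(2)] by simp
      then show ?case unfolding t
        using Cons cov_add[OF C _ \<phi>, of "translate_sum \<psi> cs"] Cc_add[OF C]
        by (auto simp: p algebra_simps)
    qed
    then have *: "cov (translate_sum \<psi> cs) \<phi> \<le> weight cs * cov \<psi> \<phi>" "translate_sum \<psi> cs \<in> Cc T"
      using cs by (auto simp: covers_def)
    have "cov f \<phi> \<le> cov (translate_sum \<psi> cs) \<phi>"
      using cs by (intro cov_mono * \<phi>) (auto simp: covers_def)
    then show ?thesis using * by linarith
  qed
  show ?thesis
  proof (cases "cov \<psi> \<phi> = 0")
    case True
    obtain cs where "cs \<in> covers f \<psi>" using covers_nonempty[OF f \<psi>] by blast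
    then show ?thesis using step[of cs] True by simp
  next
    case False
    then have pos: "0 < cov \<psi> \<phi>" using cov_nonneg[OF \<psi>T \<phi>] by simp
    have "cov f \<phi> / cov \<psi> \<phi> \<le> cov f \<psi>"
      using step pos by (intro cov_greatest[OF f \<psi>]) (simp add: field_simps)
    then show ?thesis using pos by (simp add: field_simps)
  qed
qed

text \<open>
  Evaluation of a cover at the unit shows that its weight is at least \<open>f \<one>\<close> over a bound of \<open>\<phi>\<close>.
\<close>

lemma cov_pos:
  assumes f: "f \<in> test_functions" and \<phi>: "\<phi> \<in> test_functions"
  shows "0 < cov f \<phi>"
proof -
  obtain B where B: "B > 0" "\<And>x. x \<in> topspace T \<Longrightarrow> \<bar>\<phi> x\<bar> \<le> B"
    using Cc_bounded[OF test_functionD(1)[OF \<phi>]] by blast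
  have t: "translate_sum \<phi> cs \<one> \<le> B * weight cs"
    if "\<forall>(c, y)\<in>set cs. 0 \<le> c \<and> y \<in> carrier G" for cs
    using that
  proof (induction cs)
    case (Cons p cs)
    obtain c y where p: "p = (c, y)" by fastforce
    have "\<bar>\<phi> y\<bar> \<le> B" using Cons.prems p B(2)[of y] topspace_eq by auto
    then have "c * \<phi> (\<one> \<otimes> y) \<le> c * B" using Cons.prems p by (intro mult_left_mono) auto
    then show ?case using Cons p by (auto simp: algebra_simps)
  qed simp
  have "f \<one> / B \<le> cov f \<phi>"
  proof (rule cov_greatest[OF test_functionD(1)[OF f] \<phi>])
    fix cs assume "cs \<in> covers f \<phi>"
    then have "f \<one> \<le> B * weight cs" using t[of cs] by (force simp: covers_def)
    then show "f \<one> / B \<le> weight cs" using B(1) by (simp add: field_simps)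
  qed
  moreover have "0 < f \<one> / B" using test_functionD(4)[OF f] B by simp
  ultimately show ?thesis by linarith
qed

text \<open>
  Covering numbers are subadditive, and superadditivity fails only because a translate of \<open>\<phi>\<close> may
  serve both functions. If the support of \<open>\<phi>\<close> is small, a cover of \<open>f1 + f2\<close> can be split: with
  \<open>h\<^sub>i = f\<^sub>i / (f1 + f2)\<close>, the translate with weight \<open>c\<close> and node \<open>y\<close> gets weight \<open>c \<cdot> h\<^sub>i (inv y)\<close> in the
  cover of \<open>f\<^sub>i\<close>, since \<open>h\<^sub>i\<close> is almost constant where that translate lives, and \<open>h1 + h2 \<le> 1\<close>. To divide
  safely, \<open>f1 + f2\<close> is first enlarged by a small multiple of a function \<open>w\<close> that is at least \<open>1\<close> on the
  supports.
\<close>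

lemma cov_almost_additive:
  assumes f1: "f1 \<in> Cc_nonneg T" and f2: "f2 \<in> Cc_nonneg T"
    and f0: "f0 \<in> test_functions" and e: "0 < e"
  obtains V where "openin T V" "\<one> \<in> V"
    "\<And>\<phi>. \<lbrakk>\<phi> \<in> test_functions; \<And>x. x \<in> carrier G \<Longrightarrow> \<phi> x \<noteq> 0 \<Longrightarrow> x \<in> V\<rbrakk> \<Longrightarrow>
       cov f1 \<phi> + cov f2 \<phi> \<le> cov (\<lambda>x. f1 x + f2 x) \<phi> + e * cov f0 \<phi>"
proof -
  have f12: "f1 \<in> Cc T" "f2 \<in> Cc T" "\<And>x. x \<in> carrier G \<Longrightarrow> 0 \<le> f1 x \<and> 0 \<le> f2 x"
    using f1 f2 by (auto simp: Cc_nonneg_def topspace_eq)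
  then obtain K1 K2 where K: "compactin T K1" "compactin T K2"
    "\<forall>x\<in>topspace T. f1 x \<noteq> 0 \<longrightarrow> x \<in> K1" "\<forall>x\<in>topspace T. f2 x \<noteq> 0 \<longrightarrow> x \<in> K2"
    by (auto simp: Cc_def)
  obtain w where w: "w \<in> Cc_nonneg T" "\<And>x. x \<in> K1 \<union> K2 \<Longrightarrow> 1 \<le> w x"
    using Cc_nonneg_ge_1_on_compact[OF locally_compact Hausdorff compactin_Un[OF K(1,2)]] by blast
  have wC: "w \<in> Cc T" "\<And>x. x \<in> carrier G \<Longrightarrow> 0 \<le> w x"
    using w(1) by (auto simp: Cc_nonneg_def topspace_eq)
  have fC: "(\<lambda>x. f1 x + f2 x) \<in> Cc T" by (rule Cc_add[OF f12(1,2)])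
  define A where "A = cov (\<lambda>x. f1 x + f2 x) f0"
  define B where "B = cov w f0"
  have AB: "0 \<le> A" "0 \<le> B" using cov_nonneg fC wC(1) f0 by (auto simp: A_def B_def)
  \<comment> \<open>The final error is \<open>2 d A + (1 + 2 d) d B\<close>, in units of \<open>cov f0 \<phi>\<close>.\<close>
  define d where "d = min 1 (e / (2 * A + 3 * B + 1))"
  have d: "0 < d" "d \<le> 1" using e AB by (auto simp: d_def)
  have "d * (2 * A + 3 * B) \<le> e / (2 * A + 3 * B + 1) * (2 * A + 3 * B)"
    using AB by (intro mult_right_mono) (auto simp: d_def)
  also have "\<dots> \<le> e" using AB e by (simp add: field_simps)
  finally have de: "2 * d * A + 3 * d * B \<le> e" by (simp add: algebra_simps)
  define D where "D = (\<lambda>x. f1 x + f2 x + d * w x)"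
  have DC: "D \<in> Cc T" unfolding D_def by (rule Cc_add[OF fC Cc_cmult[OF wC(1)]])
  \<comment> \<open>On the supports \<open>D \<ge> d\<close>, so the maximum changes no quotient but keeps the denominator positive.\<close>
  have "continuous_map T euclideanreal (\<lambda>x. inverse (max (D x) d))"
    using DC d by (intro continuous_intros) (auto simp: Cc_def)
  then have hC: "(\<lambda>x. inverse (max (D x) d) * f1 x) \<in> Cc T" "(\<lambda>x. inverse (max (D x) d) * f2 x) \<in> Cc T"
    using Cc_mult f12(1,2) by blast+
  define h1 where "h1 = (\<lambda>x. inverse (max (D x) d) * f1 x)"
  define h2 where "h2 = (\<lambda>x. inverse (max (D x) d) * f2 x)"
  have hC: "h1 \<in> Cc T" "h2 \<in> Cc T" using hC by (auto simp: h1_def h2_def)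
  have D_ge: "d \<le> D x" if "x \<in> carrier G" "f1 x \<noteq> 0 \<or> f2 x \<noteq> 0" for x
  proof -
    have "1 \<le> w x" using that K w(2) topspace_eq by auto
    then have "d * 1 \<le> d * w x" using d by (intro mult_left_mono) auto
    then show ?thesis using f12(3)[OF that(1)] by (simp add: D_def)
  qed
  have fh: "f1 x = D x * h1 x" "f2 x = D x * h2 x" if "x \<in> carrier G" for x
  proof -
    have "f1 x = D x * h1 x \<and> f2 x = D x * h2 x"
    proof (cases "f1 x = 0 \<and> f2 x = 0")
      case False
      then have "max (D x) d = D x" "D x \<noteq> 0" using D_ge[OF that] d by auto
      then show ?thesis by (simp add: h1_def h2_def)
    qed (simp add: h1_def h2_def)
    then show "f1 x = D x * h1 x" "f2 x = D x * h2 x" by auto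
  qed
  have h_nonneg: "0 \<le> h1 x" "0 \<le> h2 x" if "x \<in> carrier G" for x
    using f12(3)[OF that] d by (auto simp: h1_def h2_def)
  have h_sum: "h1 x + h2 x \<le> 1" if "x \<in> carrier G" for x
  proof -
    have "0 \<le> d * w x" using d wC(2)[OF that] by simp
    then have "f1 x + f2 x \<le> max (D x) d" by (simp add: D_def)
    moreover have "0 < max (D x) d" using d by simp
    ultimately show ?thesis by (simp add: h1_def h2_def field_simps flip: distrib_left)
  qed
  obtain V1 where V1: "openin T V1" "\<one> \<in> V1"
    "\<And>v y. v \<in> V1 \<Longrightarrow> y \<in> carrier G \<Longrightarrow> \<bar>h1 (v \<otimes> y) - h1 y\<bar> < d"
    using Cc_uniformly_continuous[OF hC(1) d(1)] by blast
  obtain V2 where V2: "openin T V2" "\<one> \<in> V2"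
    "\<And>v y. v \<in> V2 \<Longrightarrow> y \<in> carrier G \<Longrightarrow> \<bar>h2 (v \<otimes> y) - h2 y\<bar> < d"
    using Cc_uniformly_continuous[OF hC(2) d(1)] by blast
  show thesis
  proof (rule that[of "V1 \<inter> V2"])
    fix \<phi> assume \<phi>: "\<phi> \<in> test_functions"
      and supp: "\<And>x. x \<in> carrier G \<Longrightarrow> \<phi> x \<noteq> 0 \<Longrightarrow> x \<in> V1 \<inter> V2"
    have main: "cov f1 \<phi> + cov f2 \<phi> \<le> (1 + 2 * d) * weight cs" if cs: "cs \<in> covers D \<phi>" for cs
    proof -
      have csG: "\<forall>(c, y)\<in>set cs. 0 \<le> c \<and> y \<in> carrier G" using cs by (auto simp: covers_def)
      let ?m = "\<lambda>h cs. map (\<lambda>(c, y). (c * (h (inv y) + d), y)) cs"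
      have tr: "translate_sum \<phi> cs x * h x \<le> translate_sum \<phi> (?m h cs) x"
        if x: "x \<in> carrier G" and near: "\<And>v y. v \<in> V1 \<inter> V2 \<Longrightarrow> y \<in> carrier G \<Longrightarrow> \<bar>h (v \<otimes> y) - h y\<bar> < d"
          and csG: "\<forall>(c, y)\<in>set cs. 0 \<le> c \<and> y \<in> carrier G" for h x cs
        using csG
      proof (induction cs)
        case (Cons p cs)
        obtain c y where p: "p = (c, y)" by fastforce
        with Cons.prems have cy: "0 \<le> c" "y \<in> carrier G" by auto
        have "\<phi> (x \<otimes> y) * h x \<le> \<phi> (x \<otimes> y) * (h (inv y) + d)"
        proof (cases "\<phi> (x \<otimes> y) = 0")
          case False
          then have "x \<otimes> y \<in> V1 \<inter> V2" using supp x cy by simp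
          then have "\<bar>h (x \<otimes> y \<otimes> inv y) - h (inv y)\<bar> < d" using near cy by simp
          then have "h x \<le> h (inv y) + d" using x cy by (simp add: m_assoc)
          then show ?thesis using test_functionD(3)[OF \<phi>] x cy by (intro mult_left_mono) auto
        qed simp
        then have "c * (\<phi> (x \<otimes> y) * h x) \<le> c * (\<phi> (x \<otimes> y) * (h (inv y) + d))"
          by (rule mult_left_mono[OF _ cy(1)])
        then show ?case using Cons by (simp add: p algebra_simps)
      qed simp
      have mem: "?m h cs \<in> covers f \<phi>"
        if near: "\<And>v y. v \<in> V1 \<inter> V2 \<Longrightarrow> y \<in> carrier G \<Longrightarrow> \<bar>h (v \<otimes> y) - h y\<bar> < d"
          and f: "\<And>x. x \<in> carrier G \<Longrightarrow> f x = D x * h x"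
          and h: "\<And>x. x \<in> carrier G \<Longrightarrow> 0 \<le> h x" for f h
      proof -
        have "f x \<le> translate_sum \<phi> (?m h cs) x" if x: "x \<in> carrier G" for x
        proof -
          have "D x * h x \<le> translate_sum \<phi> cs x * h x"
            using cs x h[OF x] by (intro mult_right_mono) (auto simp: covers_def)
          then show ?thesis using f[OF x] tr[OF x near csG] by simp
        qed
        moreover have "0 \<le> c * (h (inv y) + d)" if "(c, y) \<in> set cs" for c y
          using that csG h[of "inv y"] d by auto
        ultimately show ?thesis using csG by (auto simp: covers_def)
      qed
      have "cov f1 \<phi> \<le> weight (?m h1 cs)" "cov f2 \<phi> \<le> weight (?m h2 cs)"
        using V1(3) V2(3) fh h_nonneg by (intro cov_le_weight mem; simp)+
      moreover have "weight (?m h1 cs) + weight (?m h2 cs) \<le> (1 + 2 * d) * weight cs"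
        using csG
      proof (induction cs)
        case (Cons p cs)
        obtain c y where p: "p = (c, y)" by fastforce
        with Cons.prems have cy: "0 \<le> c" "y \<in> carrier G" by auto
        have "c * (h1 (inv y) + h2 (inv y)) \<le> c * 1"
          using h_sum[of "inv y"] cy by (intro mult_left_mono) auto
        then show ?case using Cons by (simp add: p algebra_simps)
      qed simp
      ultimately show ?thesis by linarith
    qed
    have d0: "0 < 1 + 2 * d" using d by simp
    have "(cov f1 \<phi> + cov f2 \<phi>) / (1 + 2 * d) \<le> cov D \<phi>"
      using main d0 by (intro cov_greatest[OF DC \<phi>]) (simp add: field_simps)
    then have 1: "cov f1 \<phi> + cov f2 \<phi> \<le> (1 + 2 * d) * cov D \<phi>"
      using d0 by (simp add: field_simps)
    have "cov D \<phi> \<le> cov (\<lambda>x. f1 x + f2 x) \<phi> + d * cov w \<phi>"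
      unfolding D_def using cov_add[OF fC Cc_cmult[OF wC(1)] \<phi>, of d] cov_cmult[OF wC(1) \<phi>, of d] d by simp
    then have 2: "(1 + 2 * d) * cov D \<phi> \<le> (1 + 2 * d) * (cov (\<lambda>x. f1 x + f2 x) \<phi> + d * cov w \<phi>)"
      using d0 by (intro mult_left_mono) auto
    have b: "cov (\<lambda>x. f1 x + f2 x) \<phi> \<le> A * cov f0 \<phi>" "cov w \<phi> \<le> B * cov f0 \<phi>"
      unfolding A_def B_def by (intro cov_submult fC wC f0 \<phi>)+
    have w0: "0 \<le> cov w \<phi>" by (rule cov_nonneg[OF wC(1) \<phi>])
    have "(1 + 2 * d) * (cov (\<lambda>x. f1 x + f2 x) \<phi> + d * cov w \<phi>)
       = cov (\<lambda>x. f1 x + f2 x) \<phi> + 2 * d * cov (\<lambda>x. f1 x + f2 x) \<phi> + (1 + 2 * d) * (d * cov w \<phi>)"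
      by (simp add: algebra_simps)
    also have "\<dots> \<le> cov (\<lambda>x. f1 x + f2 x) \<phi> + 2 * d * (A * cov f0 \<phi>) + 3 * (d * (B * cov f0 \<phi>))"
      using b d w0 by (intro add_mono mult_mono mult_left_mono order_refl) auto
    also have "\<dots> = cov (\<lambda>x. f1 x + f2 x) \<phi> + (2 * d * A + 3 * d * B) * cov f0 \<phi>"
      by (simp add: algebra_simps)
    also have "\<dots> \<le> cov (\<lambda>x. f1 x + f2 x) \<phi> + e * cov f0 \<phi>"
      using de cov_nonneg[OF test_functionD(1)[OF f0] \<phi>] by (intro add_left_mono mult_right_mono)
    finally show "cov f1 \<phi> + cov f2 \<phi> \<le> cov (\<lambda>x. f1 x + f2 x) \<phi> + e * cov f0 \<phi>"
      using 1 2 by linarith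
  qed (use V1 V2 in auto)
qed

end

section \<open>Positive functionals and the Haar functional\<close>

definition positive_functional :: "'a topology \<Rightarrow> (('a \<Rightarrow> real) \<Rightarrow> real) \<Rightarrow> bool" where
  "positive_functional X J \<longleftrightarrow>
     (\<forall>f\<in>Cc X. \<forall>g\<in>Cc X. J (\<lambda>x. f x + g x) = J f + J g) \<and>
     (\<forall>f\<in>Cc X. \<forall>c. J (\<lambda>x. c * f x) = c * J f) \<and>
     (\<forall>f\<in>Cc_nonneg X. 0 \<le> J f)"

lemma positive_functional_cmult:
  assumes "positive_functional X J" "f \<in> Cc X"
  shows "J (\<lambda>x. c * f x) = c * J f"
  using assms by (simp add: positive_functional_def)

lemma positive_functional_diff:
  assumes J: "positive_functional X J" and "f \<in> Cc X" "g \<in> Cc X"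
  shows "J (\<lambda>x. f x - g x) = J f - J g"
proof -
  have m: "(\<lambda>x. - 1 * g x) \<in> Cc X" by (rule Cc_cmult[OF assms(3)])
  have "(\<lambda>x. f x - g x) = (\<lambda>x. f x + - 1 * g x)" by simp
  then have "J (\<lambda>x. f x - g x) = J f + J (\<lambda>x. - 1 * g x)"
    using J assms(2) m unfolding positive_functional_def by metis
  also have "J (\<lambda>x. - 1 * g x) = - 1 * J g"
    using J assms(3) unfolding positive_functional_def by blast
  finally show ?thesis by simp
qed

lemma positive_functional_mono:
  assumes J: "positive_functional X J" and fg: "f \<in> Cc X" "g \<in> Cc X"
    and le: "\<And>x. x \<in> topspace X \<Longrightarrow> f x \<le> g x"
  shows "J f \<le> J g"
proof -
  have "(\<lambda>x. g x - f x) \<in> Cc_nonneg X" using le Cc_diff[OF fg(2,1)] by (simp add: Cc_nonneg_def)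
  then have "0 \<le> J (\<lambda>x. g x - f x)" using J by (simp add: positive_functional_def)
  then show ?thesis using positive_functional_diff[OF J fg(2,1)] by simp
qed

lemma positive_functional_cong:
  assumes "positive_functional X J" "f \<in> Cc X" "g \<in> Cc X"
    and "\<And>x. x \<in> topspace X \<Longrightarrow> f x = g x"
  shows "J f = J g"
  by (rule antisym[OF positive_functional_mono[OF assms(1,2,3)] positive_functional_mono[OF assms(1,3,2)]])
     (simp_all add: assms(4))

lemma positive_functional_bound:
  assumes J: "positive_functional X J"
    and X: "locally_compact_space X" "Hausdorff_space X" and K: "compactin X K"
  obtains B where "0 \<le> B"
    "\<And>f e. \<lbrakk>f \<in> Cc X; \<And>x. x \<in> topspace X \<Longrightarrow> f x \<noteq> 0 \<Longrightarrow> x \<in> K;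
       \<And>x. x \<in> topspace X \<Longrightarrow> \<bar>f x\<bar> \<le> e; 0 \<le> e\<rbrakk> \<Longrightarrow> \<bar>J f\<bar> \<le> e * B"
proof -
  obtain w where w: "w \<in> Cc_nonneg X" "\<And>x. x \<in> K \<Longrightarrow> 1 \<le> w x"
    using Cc_nonneg_ge_1_on_compact[OF X K] by blast
  have wC: "w \<in> Cc X" "\<And>x. x \<in> topspace X \<Longrightarrow> 0 \<le> w x" using w(1) by (auto simp: Cc_nonneg_def)
  have J_cmult: "J (\<lambda>x. c * f x) = c * J f" if "f \<in> Cc X" for c f
    using J that by (auto simp: positive_functional_def)
  show thesis
  proof (rule that[of "J w"])
    show "0 \<le> J w" using J w(1) by (simp add: positive_functional_def)
    fix f e assume f: "f \<in> Cc X" "\<And>x. x \<in> topspace X \<Longrightarrow> f x \<noteq> 0 \<Longrightarrow> x \<in> K"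
      "\<And>x. x \<in> topspace X \<Longrightarrow> \<bar>f x\<bar> \<le> e" and e: "0 \<le> e"
    have le: "\<bar>f x\<bar> \<le> e * w x" if x: "x \<in> topspace X" for x
    proof (cases "f x = 0")
      case True
      then show ?thesis using e wC(2)[OF x] by simp
    next
      case False
      then have "e * 1 \<le> e * w x" using f(2)[OF x] w(2) e by (intro mult_left_mono) auto
      then show ?thesis using f(3)[OF x] by simp
    qed
    have "J f \<le> J (\<lambda>x. e * w x)"
      using le by (intro positive_functional_mono[OF J f(1) Cc_cmult[OF wC(1)]]) (auto simp: abs_le_iff)
    moreover have "J (\<lambda>x. - e * w x) \<le> J f"
      using le by (intro positive_functional_mono[OF J Cc_cmult[OF wC(1)] f(1)]) (force simp: abs_le_iff)
    ultimately show "\<bar>J f\<bar> \<le> e * J w"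
      using J_cmult[OF wC(1)] by (simp only: abs_le_iff) simp
  qed
qed

context locally_compact_group
begin

lemma test_function_exists:
  assumes "openin T V" "\<one> \<in> V"
  obtains \<phi> where "\<phi> \<in> test_functions" "\<And>x. x \<in> carrier G \<Longrightarrow> \<phi> x \<noteq> 0 \<Longrightarrow> x \<in> V"
proof -
  obtain f where "f \<in> Cc_nonneg T" "f \<one> = 1" "\<And>y. y \<in> topspace T \<Longrightarrow> f y \<noteq> 0 \<Longrightarrow> y \<in> V"
    using Cc_nonneg_bump[OF locally_compact Hausdorff assms] by blast
  then show thesis using that[of f] by (simp add: test_functions_def topspace_eq)
qed

text \<open>
  Each normalised covering number is a point of the compact product of the intervals \<open>[0, cov f f0]\<close>.
  A closed condition that holds for all test functions with sufficiently small support defines a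
  closed set in this product, and finitely many such sets have a common point. The desired
  properties are conditions of this kind, so a point in the intersection of all these closed sets
  has them; additivity is the conjunction of its approximate versions.
\<close>

lemma haar_on_nonneg:
  assumes f0: "f0 \<in> test_functions"
  obtains I where
    "\<And>f g. \<lbrakk>f \<in> Cc_nonneg T; g \<in> Cc_nonneg T; \<And>x. x \<in> carrier G \<Longrightarrow> f x \<le> g x\<rbrakk> \<Longrightarrow> I f \<le> I g"
    "\<And>f g. \<lbrakk>f \<in> Cc_nonneg T; g \<in> Cc_nonneg T\<rbrakk> \<Longrightarrow> I (\<lambda>x. f x + g x) = I f + I g"
    "\<And>f c. \<lbrakk>f \<in> Cc_nonneg T; 0 \<le> c\<rbrakk> \<Longrightarrow> I (\<lambda>x. c * f x) = c * I f"
    "\<And>f a. \<lbrakk>f \<in> Cc_nonneg T; a \<in> carrier G\<rbrakk> \<Longrightarrow> I (\<lambda>x. f (x \<otimes> a)) = I f"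
    "\<And>f. f \<in> Cc_nonneg T \<Longrightarrow> 0 \<le> I f"
    "I f0 = (1::real)"
proof -
  define X where "X = product_topology (\<lambda>f. top_of_set {0..cov f f0}) (Cc_nonneg T)"
  \<comment> \<open>Normalisation by \<open>f0\<close> forces the limit to take the value \<open>1\<close> at \<open>f0\<close>, so it is not zero.\<close>
  define n where "n = (\<lambda>\<phi>. \<lambda>f\<in>Cc_nonneg T. cov f \<phi> / cov f0 \<phi>)"
  have CC: "f \<in> Cc T" if "f \<in> Cc_nonneg T" for f using that by (simp add: Cc_nonneg_def)
  have f0C: "f0 \<in> Cc_nonneg T" using test_functionD[OF f0] by blast
  have X: "compact_space X" unfolding X_def by (simp add: compact_space_product_topology compact_space_subtopology)
  have nX: "n \<phi> \<in> topspace X" if \<phi>: "\<phi> \<in> test_functions" for \<phi>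
    using cov_nonneg[OF CC \<phi>] cov_pos[OF f0 \<phi>] cov_submult[OF CC f0 \<phi>]
    by (auto simp: X_def n_def PiE_iff divide_nonneg_pos field_simps)
  define \<C> where "\<C> = {C. closedin X C \<and> (\<exists>V. openin T V \<and> \<one> \<in> V \<and>
     (\<forall>\<phi>\<in>test_functions. (\<forall>x\<in>carrier G. \<phi> x \<noteq> 0 \<longrightarrow> x \<in> V) \<longrightarrow> n \<phi> \<in> C))}"
  have "\<Inter>\<F> \<noteq> {}" if \<F>: "finite \<F>" "\<F> \<subseteq> \<C>" for \<F>
  proof -
    have "\<forall>C\<in>\<F>. \<exists>V. openin T V \<and> \<one> \<in> V \<and>
       (\<forall>\<phi>\<in>test_functions. (\<forall>x\<in>carrier G. \<phi> x \<noteq> 0 \<longrightarrow> x \<in> V) \<longrightarrow> n \<phi> \<in> C)"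
      using \<F>(2) unfolding \<C>_def by blast
    then obtain V where V: "\<And>C. C \<in> \<F> \<Longrightarrow> openin T (V C) \<and> \<one> \<in> V C \<and>
       (\<forall>\<phi>\<in>test_functions. (\<forall>x\<in>carrier G. \<phi> x \<noteq> 0 \<longrightarrow> x \<in> V C) \<longrightarrow> n \<phi> \<in> C)"
      by metis
    have "openin T (topspace T \<inter> \<Inter>(V ` \<F>))" using V \<F>(1) by (intro openin_Int_Inter) auto
    moreover have "\<one> \<in> topspace T \<inter> \<Inter>(V ` \<F>)" using V topspace_eq by auto
    ultimately obtain \<phi> where "\<phi> \<in> test_functions"
      "\<And>x. x \<in> carrier G \<Longrightarrow> \<phi> x \<noteq> 0 \<Longrightarrow> x \<in> topspace T \<inter> \<Inter>(V ` \<F>)"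
      using test_function_exists by metis
    then have "n \<phi> \<in> C" if "C \<in> \<F>" for C using V[OF that] that by blast
    then show ?thesis by blast
  qed
  then have "\<Inter>\<C> \<noteq> {}"
    using X unfolding compact_space_fip by (simp add: \<C>_def)
  then obtain I where I: "\<And>C. C \<in> \<C> \<Longrightarrow> I \<in> C" by blast
  have IX: "I \<in> topspace X"
    by (rule I) (use nX topspace_eq in \<open>auto simp: \<C>_def intro!: exI[of _ "topspace T"]\<close>)
  have key: "u I \<le> 0" if u: "continuous_map X euclideanreal u" and V: "openin T V" "\<one> \<in> V"
    and *: "\<And>\<phi>. \<lbrakk>\<phi> \<in> test_functions; \<And>x. x \<in> carrier G \<Longrightarrow> \<phi> x \<noteq> 0 \<Longrightarrow> x \<in> V\<rbrakk> \<Longrightarrow> u (n \<phi>) \<le> 0" for u V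
  proof -
    have "closedin X {I \<in> topspace X. u I \<in> {..0}}"
      by (rule closedin_continuous_map_preimage[OF u]) simp
    then have "{I \<in> topspace X. u I \<in> {..0}} \<in> \<C>"
      using V * nX by (auto simp: \<C>_def intro!: exI[of _ V])
    from I[OF this] show ?thesis by simp
  qed
  have key': "u I \<le> 0" if "continuous_map X euclideanreal u"
    and "\<And>\<phi>. \<phi> \<in> test_functions \<Longrightarrow> u (n \<phi>) \<le> 0" for u
    using key[OF that(1) openin_topspace] that(2) topspace_eq by auto
  have pr: "continuous_map X euclideanreal (\<lambda>I. I f)" if "f \<in> Cc_nonneg T" for f
    using continuous_map_product_projection[OF that, of "\<lambda>f. top_of_set {0..cov f f0}"]
    unfolding X_def by (simp add: continuous_map_in_subtopology)
  have pos: "0 < cov f0 \<phi>" if "\<phi> \<in> test_functions" for \<phi> by (rule cov_pos[OF f0 that])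
  show thesis
  proof (rule that[of I])
    fix f g assume fg: "f \<in> Cc_nonneg T" "g \<in> Cc_nonneg T"
    note add = Cc_nonneg_add[OF fg]
    { assume le: "\<And>x. x \<in> carrier G \<Longrightarrow> f x \<le> g x"
      have "I f - I g \<le> 0"
        using fg pos cov_mono[OF CC[OF fg(2)] _ le]
        by (intro key'[of "\<lambda>I. I f - I g"] continuous_map_diff pr) (auto simp: n_def divide_right_mono less_imp_le)
      then show "I f \<le> I g" by simp }
    have "I (\<lambda>x. f x + g x) - (I f + I g) \<le> 0"
      using fg pos add cov_add[OF CC[OF fg(1)] CC[OF fg(2)]]
      by (intro key'[of "\<lambda>I. I (\<lambda>x. f x + g x) - (I f + I g)"] continuous_map_diff continuous_map_add pr)
         (auto simp: n_def divide_right_mono less_imp_le simp flip: add_divide_distrib)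
    moreover have "I f + I g \<le> I (\<lambda>x. f x + g x) + e" if e: "0 < e" for e
    proof -
      obtain V where V: "openin T V" "\<one> \<in> V"
        "\<And>\<phi>. \<lbrakk>\<phi> \<in> test_functions; \<And>x. x \<in> carrier G \<Longrightarrow> \<phi> x \<noteq> 0 \<Longrightarrow> x \<in> V\<rbrakk> \<Longrightarrow>
           cov f \<phi> + cov g \<phi> \<le> cov (\<lambda>x. f x + g x) \<phi> + e * cov f0 \<phi>"
        using cov_almost_additive[OF fg f0 e] by blast
      have "I f + I g - I (\<lambda>x. f x + g x) - e \<le> 0"
      proof (rule key[of "\<lambda>I. I f + I g - I (\<lambda>x. f x + g x) - e", OF _ V(1,2)])
        show "continuous_map X euclideanreal (\<lambda>I. I f + I g - I (\<lambda>x. f x + g x) - e)"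
          by (intro continuous_map_diff continuous_map_add pr fg add) simp
        fix \<phi> assume \<phi>: "\<phi> \<in> test_functions" "\<And>x. x \<in> carrier G \<Longrightarrow> \<phi> x \<noteq> 0 \<Longrightarrow> x \<in> V"
        show "n \<phi> f + n \<phi> g - n \<phi> (\<lambda>x. f x + g x) - e \<le> 0"
        proof -
          have "(cov f \<phi> + cov g \<phi>) / cov f0 \<phi> \<le> (cov (\<lambda>x. f x + g x) \<phi> + e * cov f0 \<phi>) / cov f0 \<phi>"
            using V(3)[OF \<phi>] pos[OF \<phi>(1)] by (simp add: divide_right_mono)
          then show ?thesis using pos[OF \<phi>(1)] fg add by (simp add: n_def add_divide_distrib)
        qed
      qed
      then show ?thesis by simp
    qed
    then have "I f + I g \<le> I (\<lambda>x. f x + g x)" by (rule field_le_epsilon)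
    ultimately show "I (\<lambda>x. f x + g x) = I f + I g" by simp
  next
    fix f and c :: real assume f: "f \<in> Cc_nonneg T" and c: "0 \<le> c"
    have "\<bar>I (\<lambda>x. c * f x) - c * I f\<bar> \<le> 0"
      using f c Cc_nonneg_cmult[OF f c] cov_cmult[OF CC[OF f] _ c]
      by (intro key'[of "\<lambda>I. \<bar>I (\<lambda>x. c * f x) - c * I f\<bar>"] continuous_map_real_abs continuous_map_diff
          continuous_map_real_mult_left pr) (auto simp: n_def)
    then show "I (\<lambda>x. c * f x) = c * I f" by simp
  next
    fix f a assume f: "f \<in> Cc_nonneg T" and a: "a \<in> carrier G"
    have "\<bar>I (\<lambda>x. f (x \<otimes> a)) - I f\<bar> \<le> 0"
      using f Cc_nonneg_translate[OF f a] cov_translate[OF CC[OF f] _ a]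
      by (intro key'[of "\<lambda>I. \<bar>I (\<lambda>x. f (x \<otimes> a)) - I f\<bar>"] continuous_map_real_abs continuous_map_diff
          continuous_map_real_mult_left pr) (auto simp: n_def)
    then show "I (\<lambda>x. f (x \<otimes> a)) = I f" by simp
  next
    fix f assume "f \<in> Cc_nonneg T"
    then have "I f \<in> {0..cov f f0}" using IX by (auto simp: X_def PiE_iff)
    then show "0 \<le> I f" by simp
  next
    have "\<bar>I f0 - 1\<bar> \<le> 0"
      using f0C pos
      by (intro key'[of "\<lambda>I. \<bar>I f0 - 1\<bar>"] continuous_map_real_abs continuous_map_diff pr) (force simp: n_def)+
    then show "I f0 = 1" by simp
  qed
qed

text \<open>
  The functional on nonnegative functions extends to differences. It is strictly positive on test
  functions because it is not zero and finitely many translates of a test function dominate any other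
  function.
\<close>

theorem haar_functional_exists:
  obtains J where "positive_functional T J"
    "\<And>f a. \<lbrakk>f \<in> Cc T; a \<in> carrier G\<rbrakk> \<Longrightarrow> J (\<lambda>x. f (x \<otimes> a)) = J f"
    "\<And>f. f \<in> test_functions \<Longrightarrow> 0 < J f"
proof -
  have "\<one> \<in> topspace T" by (simp add: topspace_eq)
  then obtain f0 where f0: "f0 \<in> test_functions" using test_function_exists[OF openin_topspace] by blast
  obtain I where I:
    "\<And>f g. \<lbrakk>f \<in> Cc_nonneg T; g \<in> Cc_nonneg T; \<And>x. x \<in> carrier G \<Longrightarrow> f x \<le> g x\<rbrakk> \<Longrightarrow> I f \<le> I g"
    "\<And>f g. \<lbrakk>f \<in> Cc_nonneg T; g \<in> Cc_nonneg T\<rbrakk> \<Longrightarrow> I (\<lambda>x. f x + g x) = I f + I g"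
    "\<And>f c. \<lbrakk>f \<in> Cc_nonneg T; 0 \<le> c\<rbrakk> \<Longrightarrow> I (\<lambda>x. c * f x) = c * I f"
    "\<And>f a. \<lbrakk>f \<in> Cc_nonneg T; a \<in> carrier G\<rbrakk> \<Longrightarrow> I (\<lambda>x. f (x \<otimes> a)) = I f"
    "\<And>f. f \<in> Cc_nonneg T \<Longrightarrow> 0 \<le> I f" "I f0 = (1::real)"
    using haar_on_nonneg[OF f0] by blast
  define J where "J = (\<lambda>f. I (\<lambda>x. max (f x) 0) - I (\<lambda>x. max (- f x) 0))"
  have J_diff: "J (\<lambda>x. u x - v x) = I u - I v" if u: "u \<in> Cc_nonneg T" and v: "v \<in> Cc_nonneg T" for u v
  proof -
    have uv: "(\<lambda>x. u x - v x) \<in> Cc T" using u v by (intro Cc_diff) (auto simp: Cc_nonneg_def)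
    note p = Cc_pos_part[OF uv] and m = Cc_neg_part[OF uv]
    have "I (\<lambda>x. max (u x - v x) 0) + I v = I (\<lambda>x. max (u x - v x) 0 + v x)"
      using I(2)[OF p v] by simp
    also have "(\<lambda>x. max (u x - v x) 0 + v x) = (\<lambda>x. max (- (u x - v x)) 0 + u x)"
      by (auto simp: max_def)
    also have "I \<dots> = I (\<lambda>x. max (- (u x - v x)) 0) + I u" using I(2)[OF m u] .
    finally show ?thesis by (simp add: J_def)
  qed
  have J_eq: "J f = I f" if f: "f \<in> Cc_nonneg T" for f
  proof -
    have z: "(\<lambda>x. 0 * f x) \<in> Cc_nonneg T" by (rule Cc_nonneg_cmult[OF f]) simp
    then have "J (\<lambda>x. f x - 0 * f x) = I f - I (\<lambda>x. 0 * f x)" using J_diff f by blast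
    then show ?thesis using I(3)[OF f, of 0] by simp
  qed
  have dec: "\<exists>u v. u \<in> Cc_nonneg T \<and> v \<in> Cc_nonneg T \<and> f = (\<lambda>x. u x - v x)" if "f \<in> Cc T" for f
    by (intro exI[of _ "\<lambda>x. max (f x) 0"] exI[of _ "\<lambda>x. max (- f x) 0"])
       (use Cc_pos_part[OF that] Cc_neg_part[OF that] in \<open>auto simp: max_def\<close>)
  have "J (\<lambda>x. f x + g x) = J f + J g" if f: "f \<in> Cc T" and g: "g \<in> Cc T" for f g
  proof -
    obtain u v where uv: "u \<in> Cc_nonneg T" "v \<in> Cc_nonneg T" "f = (\<lambda>x. u x - v x)" using dec[OF f] by blast
    obtain s t where st: "s \<in> Cc_nonneg T" "t \<in> Cc_nonneg T" "g = (\<lambda>x. s x - t x)" using dec[OF g] by blast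
    have "(\<lambda>x. f x + g x) = (\<lambda>x. (u x + s x) - (v x + t x))" by (auto simp: uv st)
    then show ?thesis
      using J_diff[OF Cc_nonneg_add[OF uv(1) st(1)] Cc_nonneg_add[OF uv(2) st(2)]]
        J_diff[OF uv(1,2)] J_diff[OF st(1,2)] I(2) uv st by simp
  qed
  moreover have "J (\<lambda>x. c * f x) = c * J f" if f: "f \<in> Cc T" for f c
  proof -
    obtain u v where uv: "u \<in> Cc_nonneg T" "v \<in> Cc_nonneg T" "f = (\<lambda>x. u x - v x)" using dec[OF f] by blast
    show ?thesis
    proof (cases "0 \<le> c")
      case True
      have "(\<lambda>x. c * f x) = (\<lambda>x. c * u x - c * v x)" by (auto simp: uv algebra_simps)
      then show ?thesis
        using J_diff[OF Cc_nonneg_cmult[OF uv(1) True] Cc_nonneg_cmult[OF uv(2) True]]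
          J_diff[OF uv(1,2)] I(3)[OF uv(1) True] I(3)[OF uv(2) True] uv(3) by (simp add: right_diff_distrib)
    next
      case False
      then have c: "0 \<le> - c" by simp
      have "(\<lambda>x. c * f x) = (\<lambda>x. (- c) * v x - (- c) * u x)" by (auto simp: uv algebra_simps)
      then have "J (\<lambda>x. c * f x) = (- c) * I v - (- c) * I u"
        by (simp only: J_diff[OF Cc_nonneg_cmult[OF uv(2) c] Cc_nonneg_cmult[OF uv(1) c]]
            I(3)[OF uv(1) c] I(3)[OF uv(2) c])
      then show ?thesis using J_diff[OF uv(1,2), folded uv(3)] by algebra
    qed
  qed
  ultimately have "positive_functional T J"
    using I(5) J_eq by (auto simp: positive_functional_def)
  moreover have "J (\<lambda>x. f (x \<otimes> a)) = J f" if f: "f \<in> Cc T" and a: "a \<in> carrier G" for f a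
  proof -
    obtain u v where uv: "u \<in> Cc_nonneg T" "v \<in> Cc_nonneg T" "f = (\<lambda>x. u x - v x)" using dec[OF f] by blast
    show ?thesis
      using J_diff[OF Cc_nonneg_translate[OF uv(1) a] Cc_nonneg_translate[OF uv(2) a]]
        J_diff[OF uv(1,2)] I(4)[OF uv(1) a] I(4)[OF uv(2) a] uv by simp
  qed
  moreover have "0 < J f" if f: "f \<in> test_functions" for f
  proof -
    have f': "f \<in> Cc_nonneg T" using test_functionD[OF f] by blast
    \<comment> \<open>\<open>f0\<close> is dominated by finitely many translates of \<open>f\<close>, so \<open>J f = 0\<close> would force \<open>J f0 = 0\<close>.\<close>
    obtain cs where cs: "cs \<in> covers f0 f" using covers_nonempty[OF test_functionD(1)[OF f0] f] by blast
    have "translate_sum f cs \<in> Cc_nonneg T \<and> I (translate_sum f cs) = weight cs * I f"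
      if "\<forall>(c, y)\<in>set cs. 0 \<le> c \<and> y \<in> carrier G" for cs
      using that
    proof (induction cs)
      case Nil
      have "translate_sum f [] = (\<lambda>x. 0 * f x)" by auto
      then show ?case using I(3)[OF f', of 0] Cc_nonneg_cmult[OF f', of 0] by (simp del: mult_zero_left)
    next
      case (Cons p cs)
      obtain c y where p: "p = (c, y)" by fastforce
      with Cons.prems have cy: "0 \<le> c" "y \<in> carrier G" by auto
      have t: "translate_sum f (p # cs) = (\<lambda>x. c * f (x \<otimes> y) + translate_sum f cs x)" by (auto simp: p)
      note C = Cc_nonneg_cmult[OF Cc_nonneg_translate[OF f' cy(2)] cy(1)]
      have "I (\<lambda>x. c * f (x \<otimes> y)) = c * I f"
        using I(3)[OF Cc_nonneg_translate[OF f' cy(2)] cy(1)] I(4)[OF f' cy(2)] by simp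
      then show ?case unfolding t using Cons Cc_nonneg_add[OF C] I(2)[OF C]
        by (auto simp: p algebra_simps)
    qed
    then have "translate_sum f cs \<in> Cc_nonneg T" "I (translate_sum f cs) = weight cs * I f"
      using cs by (auto simp: covers_def)
    then have "1 \<le> weight cs * I f"
      using I(1)[of f0 "translate_sum f cs"] I(6) cs test_functionD(2)[OF f0] by (auto simp: covers_def)
    then have "I f \<noteq> 0" by auto
    then show ?thesis using I(5)[OF f'] J_eq[OF f'] by simp
  qed
  ultimately show thesis using that by blast
qed

end

section \<open>Differentiation under a positive functional\<close>

text \<open>
  Functions of \<open>(t, g)\<close> whose partial derivatives in \<open>t\<close> up to order \<open>k\<close> exist and are jointly
  continuous; nothing is differentiated in the direction of \<open>X\<close>.
\<close>

primrec par_Ck :: "'a topology \<Rightarrow> nat \<Rightarrow> nat \<Rightarrow> (nat \<Rightarrow> real) set \<Rightarrow> ((nat \<Rightarrow> real) \<Rightarrow> 'a \<Rightarrow> real) \<Rightarrow> bool" where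
  "par_Ck X n 0 U F \<longleftrightarrow>
     continuous_map (prod_topology (subtopology (Euclidean_space n) U) X) euclideanreal (\<lambda>(t, g). F t g)"
| "par_Ck X n (Suc k) U F \<longleftrightarrow>
     continuous_map (prod_topology (subtopology (Euclidean_space n) U) X) euclideanreal (\<lambda>(t, g). F t g) \<and>
     (\<forall>i<n. (\<forall>t\<in>U. \<forall>g\<in>topspace X. (\<lambda>s. F (t(i := s)) g) field_differentiable at (t i)) \<and>
            par_Ck X n k U (\<lambda>t g. partial_deriv i (\<lambda>t. F t g) t))"

lemma par_Ck_continuous:
  "par_Ck X n k U F \<Longrightarrow>
   continuous_map (prod_topology (subtopology (Euclidean_space n) U) X) euclideanreal (\<lambda>(t, g). F t g)"
  by (cases k) auto

lemma par_continuous_section: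
  assumes U: "openin (Euclidean_space n) U"
    and F: "continuous_map (prod_topology (subtopology (Euclidean_space n) U) X) euclideanreal (\<lambda>(t, g). F t g)"
    and t: "t \<in> U"
  shows "continuous_map X euclideanreal (F t)"
proof -
  have "t \<in> topspace (subtopology (Euclidean_space n) U)" using t openin_subset[OF U] by auto
  then have "continuous_map X (prod_topology (subtopology (Euclidean_space n) U) X) (\<lambda>g. (t, g))"
    by (simp add: continuous_map_pairedI)
  from continuous_map_compose[OF this F] show ?thesis by (simp add: o_def)
qed

text \<open>
  Off \<open>K\<close> both values vanish, and near \<open>{x} \<times> K\<close> the tube lemma applies.
\<close>

lemma par_uniformly_close:
  assumes U: "openin (Euclidean_space n) U" and K: "compactin X K"
    and F: "continuous_map (prod_topology (subtopology (Euclidean_space n) U) X) euclideanreal (\<lambda>(t, g). F t g)"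
    and supp: "\<forall>t\<in>U. \<forall>g\<in>topspace X. F t g \<noteq> 0 \<longrightarrow> g \<in> K"
    and x: "x \<in> U" and e: "0 < (e::real)"
  obtains N where "openin (Euclidean_space n) N" "x \<in> N" "N \<subseteq> U"
    "\<And>t g. t \<in> N \<Longrightarrow> g \<in> topspace X \<Longrightarrow> \<bar>F t g - F x g\<bar> < e"
proof -
  let ?E = "subtopology (Euclidean_space n) U"
  have E: "topspace ?E = U" using openin_subset[OF U] by auto
  define W where "W = {p \<in> topspace (prod_topology ?E X). (\<lambda>p. (\<lambda>(t, g). F t g) p - F x (snd p)) p \<in> {-e<..<e}}"
  have "continuous_map (prod_topology ?E X) euclideanreal (\<lambda>p. (\<lambda>(t, g). F t g) p - F x (snd p))"
    using continuous_map_compose[OF continuous_map_snd par_continuous_section[OF U F x], of ?E]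
    by (intro continuous_map_diff F) (simp add: o_def)
  then have W: "openin (prod_topology ?E X) W"
    unfolding W_def by (rule openin_continuous_map_preimage) simp
  have "{x} \<times> K \<subseteq> W" using e x compactin_subset_topspace[OF K] by (auto simp: W_def E simp del: topspace_subtopology)
  then obtain N V where NV: "openin ?E N" "x \<in> N" "K \<subseteq> V" "N \<times> V \<subseteq> W"
    using tube_lemma_right[OF W K, of x] x E by metis
  have N: "openin (Euclidean_space n) N" "N \<subseteq> U"
    using NV(1) U openin_trans_full openin_subset E by blast+
  show thesis
  proof (rule that[OF N(1) NV(2) N(2)])
    fix t g assume t: "t \<in> N" and g: "g \<in> topspace X"
    show "\<bar>F t g - F x g\<bar> < e"
    proof (cases "g \<in> K")
      case True
      then have "(t, g) \<in> W" using NV t by blast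
      then show ?thesis by (auto simp: W_def abs_less_iff)
    next
      case False
      then have "F t g = 0" "F x g = 0" using supp t g N x by blast+
      then show ?thesis using e by simp
    qed
  qed
qed

text \<open>
  By the mean value theorem the difference quotients of \<open>F\<close> in a direction of \<open>t\<close> are values of the
  partial derivative at nearby points, hence converge uniformly on \<open>X\<close> with supports in \<open>K\<close>. A
  positive functional respects this kind of convergence, so it commutes with the derivative.
\<close>

lemma Ck_positive_functional:
  assumes J: "positive_functional X J"
    and X: "locally_compact_space X" "Hausdorff_space X" and K: "compactin X K"
    and U: "openin (Euclidean_space n) U"
  shows "par_Ck X n k U F \<Longrightarrow> (\<forall>t\<in>U. \<forall>g\<in>topspace X. F t g \<noteq> 0 \<longrightarrow> g \<in> K) \<Longrightarrow>
     Ck_on n k U (\<lambda>t. J (F t))"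
proof -
  obtain B where B: "0 \<le> B"
    "\<And>f e. \<lbrakk>f \<in> Cc X; \<And>x. x \<in> topspace X \<Longrightarrow> f x \<noteq> 0 \<Longrightarrow> x \<in> K;
       \<And>x. x \<in> topspace X \<Longrightarrow> \<bar>f x\<bar> \<le> e; 0 \<le> e\<rbrakk> \<Longrightarrow> \<bar>J f\<bar> \<le> e * B"
    using positive_functional_bound[OF J X K] by blast
  have J_cmult: "J (\<lambda>x. c * f x) = c * J f" if "f \<in> Cc X" for c f
    using J that by (auto simp: positive_functional_def)
  have FCc: "F t \<in> Cc X"
    if "continuous_map (prod_topology (subtopology (Euclidean_space n) U) X) euclideanreal (\<lambda>(t, g). F t g)"
      "\<forall>t\<in>U. \<forall>g\<in>topspace X. F t g \<noteq> 0 \<longrightarrow> g \<in> K" "t \<in> U" for F t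
    using par_continuous_section[OF U that(1,3)] that(2,3) K by (auto simp: Cc_def)
  have cont: "continuous_on U (\<lambda>t. J (F t))"
    if F: "continuous_map (prod_topology (subtopology (Euclidean_space n) U) X) euclideanreal (\<lambda>(t, g). F t g)"
      and supp: "\<forall>t\<in>U. \<forall>g\<in>topspace X. F t g \<noteq> 0 \<longrightarrow> g \<in> K" for F
    unfolding continuous_on_def
  proof (intro ballI tendstoI)
    fix x and e :: real assume x: "x \<in> U" and e: "0 < e"
    have e': "0 < e / (B + 1)" using e B by simp
    obtain N where N: "openin (Euclidean_space n) N" "x \<in> N" "N \<subseteq> U"
      "\<And>t g. t \<in> N \<Longrightarrow> g \<in> topspace X \<Longrightarrow> \<bar>F t g - F x g\<bar> < e / (B + 1)"
      using par_uniformly_close[OF U K F supp x e'] by blast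
    have near: "dist (J (F t)) (J (F x)) < e" if t: "t \<in> N" for t
    proof -
      have tU: "t \<in> U" using t N by blast
      note C = FCc[OF F supp tU] FCc[OF F supp x]
      have "\<bar>J (\<lambda>g. F t g - F x g)\<bar> \<le> e / (B + 1) * B"
      proof (rule B(2)[OF Cc_diff[OF C]])
        show "g \<in> K" if "g \<in> topspace X" "F t g - F x g \<noteq> 0" for g
          using supp tU x that by (metis diff_self)
        show "\<bar>F t g - F x g\<bar> \<le> e / (B + 1)" if "g \<in> topspace X" for g
          using N(4)[OF t that] by simp
      qed (use e' in simp)
      also have "\<dots> < e" using e B by (simp add: field_simps)
      finally show ?thesis using positive_functional_diff[OF J C] by (simp add: dist_real_def)
    qed
    obtain S where S: "open S" "N = Rn n \<inter> S"
      using N(1) Euclidean_space_euclidean openin_open by metis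
    have "\<forall>\<^sub>F t in at x within U. t \<in> S \<inter> U"
      using S N(2) by (auto simp: eventually_at_topological)
    then show "\<forall>\<^sub>F t in at x within U. dist (J (F t)) (J (F x)) < e"
      by (rule eventually_mono) (use near S openin_subset[OF U] in blast)
  qed
  show "par_Ck X n k U F \<Longrightarrow> (\<forall>t\<in>U. \<forall>g\<in>topspace X. F t g \<noteq> 0 \<longrightarrow> g \<in> K) \<Longrightarrow>
     Ck_on n k U (\<lambda>t. J (F t))"
  proof (induction k arbitrary: F)
    case 0
    then show ?case using cont[of F] by (simp add: sub_Euclidean[OF U])
  next
    case (Suc k)
    note F = par_Ck_continuous[OF Suc.prems(1)] and supp = Suc.prems(2)
    define P where "P = (\<lambda>i t g. partial_deriv i (\<lambda>t. F t g) t)"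
    have FD: "((\<lambda>s. F (t(i := s)) g) has_field_derivative P i t g) (at (t i))"
      if "i < n" "t \<in> U" "g \<in> topspace X" for i t g
      using Suc.prems(1) that unfolding P_def partial_deriv_def by (simp add: field_differentiable_derivI)
    \<comment> \<open>A function that vanishes for all parameters near \<open>t\<close> has a vanishing derivative, so supports stay in \<open>K\<close>.\<close>
    have Psupp': "g \<in> K" if "i < n" "t \<in> U" "g \<in> topspace X" "P i t g \<noteq> 0" for i t g
    proof (rule ccontr)
      assume g: "g \<notin> K"
      have "\<forall>\<^sub>F s in nhds (t i). F (t(i := s)) g = 0"
        using eventually_upd[OF U that(2,1)] by (rule eventually_mono) (use g supp that(3) in blast)
      then have "((\<lambda>s. F (t(i := s)) g) has_field_derivative 0) (at (t i))"
        by (subst DERIV_cong_ev) auto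
      then show False using FD[OF that(1-3)] that(4) DERIV_unique by blast
    qed
    have Psupp: "\<forall>t\<in>U. \<forall>g\<in>topspace X. P i t g \<noteq> 0 \<longrightarrow> g \<in> K" if "i < n" for i
      using Psupp'[OF that] by blast
    have Pk: "par_Ck X n k U (P i)" if "i < n" for i
      using Suc.prems(1) that by (simp add: P_def)
    note P = par_Ck_continuous[OF Pk]
    show ?case
    proof (rule Ck_SucI[OF U cont[OF F supp], where f' = "\<lambda>i t. J (P i t)"])
      show "Ck_on n k U (\<lambda>t. J (P i t))" if "i < n" for i
        by (rule Suc.IH[OF Pk[OF that] Psupp[OF that]])
      fix i x assume i: "i < n" and x: "x \<in> U"
      show "((\<lambda>s. J (F (x(i := s)))) has_field_derivative J (P i x)) (at (x i))"
        unfolding has_field_derivative_iff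
      proof (rule tendstoI)
        fix e :: real assume e: "0 < e"
        have e': "0 < e / (B + 1)" using e B by simp
        obtain N where N: "openin (Euclidean_space n) N" "x \<in> N" "N \<subseteq> U"
          "\<And>t g. t \<in> N \<Longrightarrow> g \<in> topspace X \<Longrightarrow> \<bar>P i t g - P i x g\<bar> < e / (B + 1)"
          using par_uniformly_close[OF U K P[OF i] Psupp[OF i] x e'] by blast
        obtain d where d: "0 < d" "\<And>s. \<bar>s - x i\<bar> < d \<Longrightarrow> x(i := s) \<in> N"
          using eventually_upd[OF N(1,2) i] unfolding eventually_nhds_metric by (auto simp: dist_real_def)
        have est: "dist ((J (F (x(i := s))) - J (F (x(i := x i)))) / (s - x i)) (J (P i x)) < e"
          if s: "s \<noteq> x i" "\<bar>s - x i\<bar> < d" for s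
        proof -
          define c where "c = 1 / (s - x i)"
          have sU: "x(i := s) \<in> U" using d(2)[OF s(2)] N(3) by blast
          note C = FCc[OF F supp sU] FCc[OF F supp x]
          note CP = FCc[OF P[OF i] Psupp[OF i] x]
          note CQ = Cc_cmult[OF Cc_diff[OF C], of c]
          have mvt: "\<exists>t\<in>N. c * (F (x(i := s)) g - F x g) = P i t g" if g: "g \<in> topspace X" for g
          proof -
            let ?u = "\<lambda>s. F (x(i := s)) g"
            have D: "DERIV ?u r :> P i (x(i := r)) g" if "\<bar>r - x i\<bar> < d" for r
              using FD[OF i _ g, of "x(i := r)"] d(2)[OF that] N(3) by auto
            have "\<exists>r. \<bar>r - x i\<bar> < d \<and> ?u s - ?u (x i) = (s - x i) * P i (x(i := r)) g"
            proof (cases "x i < s")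
              case True
              then obtain r where "x i < r" "r < s" "?u s - ?u (x i) = (s - x i) * P i (x(i := r)) g"
                using MVT2[of "x i" s ?u "\<lambda>r. P i (x(i := r)) g"] D s by fastforce
              then show ?thesis using s by (intro exI[of _ r]) auto
            next
              case False
              then have "s < x i" using s by simp
              then obtain r where "s < r" "r < x i" "?u (x i) - ?u s = (x i - s) * P i (x(i := r)) g"
                using MVT2[of s "x i" ?u "\<lambda>r. P i (x(i := r)) g"] D s by fastforce
              then show ?thesis using s by (intro exI[of _ r]) (auto simp: algebra_simps)
            qed
            then obtain r where "\<bar>r - x i\<bar> < d" "F (x(i := s)) g - F x g = (s - x i) * P i (x(i := r)) g"
              by auto
            then show ?thesis using d(2) s(1) by (intro bexI[of _ "x(i := r)"]) (auto simp: c_def)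
          qed
          have "\<bar>J (\<lambda>g. c * (F (x(i := s)) g - F x g) - P i x g)\<bar> \<le> e / (B + 1) * B"
          proof (rule B(2)[OF Cc_diff[OF CQ CP]])
            show "g \<in> K" if "g \<in> topspace X" "c * (F (x(i := s)) g - F x g) - P i x g \<noteq> 0" for g
            proof (rule ccontr)
              assume "g \<notin> K"
              then have "F (x(i := s)) g = 0" "F x g = 0" "P i x g = 0"
                using supp sU x Psupp[OF i] that(1) by blast+
              then show False using that(2) by simp
            qed
            show "\<bar>c * (F (x(i := s)) g - F x g) - P i x g\<bar> \<le> e / (B + 1)" if g: "g \<in> topspace X" for g
              using mvt[OF g] N(4)[OF _ g] by fastforce
          qed (use e' in simp)
          also have "\<dots> < e" using e B by (simp add: field_simps)
          finally have "\<bar>J (\<lambda>g. c * (F (x(i := s)) g - F x g) - P i x g)\<bar> < e" .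
          moreover have "J (\<lambda>g. c * (F (x(i := s)) g - F x g) - P i x g)
              = c * (J (F (x(i := s))) - J (F x)) - J (P i x)"
            by (simp only: positive_functional_diff[OF J CQ CP] J_cmult[OF Cc_diff[OF C]]
                positive_functional_diff[OF J C])
          ultimately show ?thesis
            unfolding dist_real_def fun_upd_triv by (simp only: c_def times_divide_eq_left mult_1)
        qed
        show "\<forall>\<^sub>F s in at (x i). dist ((J (F (x(i := s))) - J (F (x(i := x i)))) / (s - x i)) (J (P i x)) < e"
          unfolding eventually_at using d(1) est by (auto simp: dist_real_def intro!: exI[of _ d])
      qed
    qed
  qed
qed

section \<open>Charts\<close>

text \<open>
  The topological part of being a chart, stated for one chart, so that it applies to the group and
  to the manifold alike.
\<close>

definition chart_on :: "'a topology \<Rightarrow> nat \<Rightarrow> 'a set \<Rightarrow> ('a \<Rightarrow> nat \<Rightarrow> real) \<Rightarrow> bool" where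
  "chart_on X n A \<phi> \<longleftrightarrow> openin X A \<and> openin (Euclidean_space n) (\<phi> ` A) \<and>
     homeomorphic_map (subtopology X A) (subtopology (Euclidean_space n) (\<phi> ` A)) \<phi>"

lemma chart_onD:
  assumes "chart_on X n A \<phi>"
  shows "openin X A" "A \<subseteq> topspace X" "openin (Euclidean_space n) (\<phi> ` A)" "\<phi> ` A \<subseteq> Rn n" "inj_on \<phi> A"
    and "continuous_map (subtopology X A) (Euclidean_space n) \<phi>"
    and "continuous_map (subtopology (Euclidean_space n) (\<phi> ` A)) X (inv_into A \<phi>)"
proof -
  have o: "openin X A" "openin (Euclidean_space n) (\<phi> ` A)"
    and h: "homeomorphic_map (subtopology X A) (subtopology (Euclidean_space n) (\<phi> ` A)) \<phi>"
    using assms by (auto simp: chart_on_def)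
  show "openin X A" "openin (Euclidean_space n) (\<phi> ` A)" by fact+
  show AX: "A \<subseteq> topspace X" and "\<phi> ` A \<subseteq> Rn n" using o openin_subset by blast+
  show inj: "inj_on \<phi> A"
    using homeomorphic_imp_injective_map[OF h] AX by (simp add: Int_absorb1)
  show "continuous_map (subtopology X A) (Euclidean_space n) \<phi>"
    using homeomorphic_imp_continuous_map[OF h] by (simp add: continuous_map_in_subtopology)
  obtain g where g: "homeomorphic_maps (subtopology X A) (subtopology (Euclidean_space n) (\<phi> ` A)) \<phi> g"
    using h homeomorphic_map_maps by blast
  have eq: "g y = inv_into A \<phi> y" if "y \<in> \<phi> ` A" for y
    using g that AX inj by (auto simp: homeomorphic_maps_def inv_into_f_f)
  have "continuous_map (subtopology (Euclidean_space n) (\<phi> ` A)) X g"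
    using g by (simp add: homeomorphic_maps_def continuous_map_in_subtopology)
  then show "continuous_map (subtopology (Euclidean_space n) (\<phi> ` A)) X (inv_into A \<phi>)"
    by (rule continuous_map_eq) (simp add: eq)
qed

lemma chart_on_compact_nbhd:
  assumes A: "chart_on X n A \<phi>" and p: "p \<in> \<phi> ` A"
  obtains N where "openin (Euclidean_space n) N" "p \<in> N" "N \<subseteq> \<phi> ` A"
    "\<exists>C. compactin X C \<and> inv_into A \<phi> ` N \<subseteq> C \<and> C \<subseteq> A"
proof -
  note D = chart_onD[OF A]
  obtain r where r: "r > 0" "cbox_Rn n p r \<subseteq> \<phi> ` A" using cbox_Rn_inside[OF D(3) p] .
  have "compactin (subtopology (Euclidean_space n) (\<phi> ` A)) (cbox_Rn n p r)"
    using compactin_cbox_Rn r(2) by (simp add: compactin_subtopology)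
  then have C: "compactin X (inv_into A \<phi> ` cbox_Rn n p r)" by (rule image_compactin[OF _ D(7)])
  have sub: "box_Rn n p r \<subseteq> cbox_Rn n p r" by (auto simp: box_Rn_def cbox_Rn_def less_imp_le)
  show thesis
  proof (rule that[of "box_Rn n p r"])
    show "p \<in> box_Rn n p r" using r p D(4) by (auto simp: box_Rn_def)
    show "\<exists>C. compactin X C \<and> inv_into A \<phi> ` box_Rn n p r \<subseteq> C \<and> C \<subseteq> A"
      using C sub r(2) by (intro exI[of _ "inv_into A \<phi> ` cbox_Rn n p r"]) (auto intro: inv_into_into)
  qed (use openin_box_Rn sub r(2) in auto)
qed

lemma locally_compact_space_if_charts:
  assumes cov: "\<And>x. x \<in> topspace X \<Longrightarrow> \<exists>A \<phi>. chart_on X n A \<phi> \<and> x \<in> A"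
  shows "locally_compact_space X"
  unfolding locally_compact_space_def
proof
  fix x assume "x \<in> topspace X"
  then obtain A \<phi> where A: "chart_on X n A \<phi>" and x: "x \<in> A" using cov by blast
  note D = chart_onD[OF A]
  obtain N C where N: "openin (Euclidean_space n) N" "\<phi> x \<in> N" "N \<subseteq> \<phi> ` A"
    and C: "compactin X C" "inv_into A \<phi> ` N \<subseteq> C"
    using chart_on_compact_nbhd[OF A imageI[OF x]] by metis
  have "openin (subtopology X A) {y \<in> topspace (subtopology X A). \<phi> y \<in> N}"
    by (rule openin_continuous_map_preimage[OF D(6) N(1)])
  then have "openin X {y \<in> topspace (subtopology X A). \<phi> y \<in> N}"
    using D(1) openin_trans_full by blast
  moreover have "{y \<in> topspace (subtopology X A). \<phi> y \<in> N} \<subseteq> C"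
    using C(2) D(5) by (force simp: inv_into_f_f)
  ultimately show "\<exists>U K. openin X U \<and> compactin X K \<and> x \<in> U \<and> U \<subseteq> K"
    using C(1) x N(2) D(2) by (intro exI[of _ "{y \<in> topspace (subtopology X A). \<phi> y \<in> N}"] exI[of _ C]) auto
qed

section \<open>Joint smoothness in product charts\<close>

lemma continuous_map_locally:
  assumes "\<And>x. x \<in> topspace X \<Longrightarrow> \<exists>W. openin X W \<and> x \<in> W \<and> continuous_map (subtopology X W) Y f"
  shows "continuous_map X Y f"
proof -
  let ?I = "{W. openin X W \<and> continuous_map (subtopology X W) Y f}"
  show ?thesis
    by (rule pasting_lemma[of ?I X id Y "\<lambda>_. f"]) (use assms in auto)
qed

definition fst_coords :: "nat \<Rightarrow> (nat \<Rightarrow> real) \<Rightarrow> nat \<Rightarrow> real" where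
  "fst_coords l z = (\<lambda>i. if i < l then z i else 0)"

definition snd_coords :: "nat \<Rightarrow> (nat \<Rightarrow> real) \<Rightarrow> nat \<Rightarrow> real" where
  "snd_coords l z = (\<lambda>i. z (l + i))"

text \<open>
  Concatenation of coordinates is the identification by which charts of a product are formed;
  \<open>fst_coords\<close> and \<open>snd_coords\<close> are its two projections.
\<close>

definition join_coords :: "nat \<Rightarrow> (nat \<Rightarrow> real) \<Rightarrow> (nat \<Rightarrow> real) \<Rightarrow> nat \<Rightarrow> real" where
  "join_coords l s t = (\<lambda>i. if i < l then s i else t (i - l))"

lemma fst_join: "s \<in> Rn l \<Longrightarrow> fst_coords l (join_coords l s t) = s"
  by (auto simp: fst_coords_def join_coords_def mem_Rn fun_eq_iff)

lemma snd_join: "snd_coords l (join_coords l s t) = t"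
  by (auto simp: snd_coords_def join_coords_def)

lemma join_fst_snd: "join_coords l (fst_coords l z) (snd_coords l z) = z"
  by (auto simp: fst_coords_def snd_coords_def join_coords_def)

lemma join_in_Rn: "t \<in> Rn n \<Longrightarrow> join_coords l s t \<in> Rn (l + n)"
  by (auto simp: join_coords_def mem_Rn)

lemma continuous_map_coord: "continuous_map (Euclidean_space n) euclideanreal (\<lambda>x. x i)"
  unfolding Euclidean_space_def
  by (intro continuous_map_from_subtopology continuous_map_product_coordinates) simp

lemma continuous_map_into_Rn:
  assumes "\<And>i. i < n \<Longrightarrow> continuous_map X euclideanreal (\<lambda>x. f x i)"
    and "\<And>x. x \<in> topspace X \<Longrightarrow> f x \<in> Rn n"
  shows "continuous_map X (Euclidean_space n) f"
proof -
  have "continuous_map X (Euclidean_space n) (\<lambda>x i. if i < n then f x i else 0)"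
    using assms(1) by (simp add: continuous_map_componentwise_Euclidean_space)
  then show ?thesis
    by (rule continuous_map_eq) (use assms(2) in \<open>auto simp: mem_Rn fun_eq_iff\<close>)
qed

lemma continuous_map_fst_coords: "continuous_map (Euclidean_space (l + n)) (Euclidean_space l) (fst_coords l)"
  by (rule continuous_map_into_Rn) (auto simp: fst_coords_def mem_Rn intro!: continuous_map_coord)

lemma continuous_map_snd_coords: "continuous_map (Euclidean_space (l + n)) (Euclidean_space n) (snd_coords l)"
  by (rule continuous_map_into_Rn) (auto simp: snd_coords_def mem_Rn intro!: continuous_map_coord)

definition prod_set :: "nat \<Rightarrow> nat \<Rightarrow> (nat \<Rightarrow> real) set \<Rightarrow> (nat \<Rightarrow> real) set \<Rightarrow> (nat \<Rightarrow> real) set" where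
  "prod_set l n S U = {z \<in> Rn (l + n). fst_coords l z \<in> S \<and> snd_coords l z \<in> U}"

lemma openin_prod_set:
  assumes "openin (Euclidean_space l) S" "openin (Euclidean_space n) U"
  shows "openin (Euclidean_space (l + n)) (prod_set l n S U)"
proof -
  have "openin (Euclidean_space (l + n)) ({z \<in> Rn (l + n). fst_coords l z \<in> S} \<inter> {z \<in> Rn (l + n). snd_coords l z \<in> U})"
    by (intro openin_Int openin_continuous_map_preimage[OF continuous_map_fst_coords]
        openin_continuous_map_preimage[OF continuous_map_snd_coords] assms)
  moreover have "prod_set l n S U = {z \<in> Rn (l + n). fst_coords l z \<in> S} \<inter> {z \<in> Rn (l + n). snd_coords l z \<in> U}"
    by (auto simp only: prod_set_def)
  ultimately show ?thesis by simp
qed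

lemma par_Ck_subset:
  assumes "V \<subseteq> U"
  shows "par_Ck X n k U F \<Longrightarrow> par_Ck X n k V F"
proof (induction k arbitrary: F)
  have *: "continuous_map (prod_topology (subtopology (Euclidean_space n) V) X) euclideanreal F"
    if F: "continuous_map (prod_topology (subtopology (Euclidean_space n) U) X) euclideanreal F" for F
  proof -
    have V: "subtopology (subtopology (Euclidean_space n) U) V = subtopology (Euclidean_space n) V"
      using assms by (simp add: subtopology_subtopology Int_absorb1)
    show ?thesis
      using continuous_map_from_subtopology[OF F, of "V \<times> topspace X"]
      by (simp only: V subtopology_topspace subtopology_Times)
  qed
  { case 0 then show ?case using * by simp }
  { case (Suc k) then show ?case using * assms by auto }
qed

text \<open>
  If \<open>F\<close> is smooth in \<open>t\<close> and in coordinates of \<open>X\<close> together, then its partial derivatives in \<open>t\<close> are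
  partial derivatives in the second block of coordinates and hence jointly continuous.
\<close>

lemma par_CkI_charts:
  assumes U: "openin (Euclidean_space n) U"
  shows "(\<And>g. g \<in> topspace X \<Longrightarrow> \<exists>A \<theta>. chart_on X l A \<theta> \<and> g \<in> A \<and>
      Ck_on (l + n) k (prod_set l n (\<theta> ` A) U) (\<lambda>z. F (snd_coords l z) (inv_into A \<theta> (fst_coords l z))))
    \<Longrightarrow> par_Ck X n k U F"
proof -
  let ?E = "subtopology (Euclidean_space n) U"
  have Us: "U \<subseteq> Rn n" using U openin_subset by blast
  have E: "topspace ?E = U" using Us by auto
  have cont: "continuous_map (prod_topology ?E X) euclideanreal (\<lambda>(t, g). F t g)"
    if charts: "\<And>g. g \<in> topspace X \<Longrightarrow> \<exists>A \<theta>. chart_on X l A \<theta> \<and> g \<in> A \<and>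
      Ck_on (l + n) k (prod_set l n (\<theta> ` A) U) (\<lambda>z. F (snd_coords l z) (inv_into A \<theta> (fst_coords l z)))" for k F
  proof (rule continuous_map_locally)
    fix p assume p: "p \<in> topspace (prod_topology ?E X)"
    then obtain A \<theta> where A: "chart_on X l A \<theta>" "snd p \<in> A"
      and C: "Ck_on (l + n) k (prod_set l n (\<theta> ` A) U) (\<lambda>z. F (snd_coords l z) (inv_into A \<theta> (fst_coords l z)))"
      using charts[of "snd p"] by auto
    note D = chart_onD[OF A(1)]
    let ?P = "prod_topology ?E (subtopology X A)"
    have P: "subtopology (prod_topology ?E X) (U \<times> A) = ?P"
      using E by (metis subtopology_Times subtopology_topspace)
    have tP: "topspace ?P = U \<times> A" using E D(2) by (auto simp del: topspace_subtopology simp: topspace_subtopology_subset)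
    have j: "continuous_map ?P (Euclidean_space (l + n)) (\<lambda>(t, g). join_coords l (\<theta> g) t)"
    proof (rule continuous_map_into_Rn)
      fix i
      have 1: "continuous_map ?P euclideanreal (\<lambda>p. \<theta> (snd p) i)"
        using continuous_map_compose[OF continuous_map_snd continuous_map_compose[OF D(6) continuous_map_coord[of l i]], of ?E]
        by (simp add: o_def)
      have 2: "continuous_map ?P euclideanreal (\<lambda>p. fst p (i - l))"
        using continuous_map_compose[OF continuous_map_fst continuous_map_from_subtopology[OF continuous_map_coord[of n "i - l"]],
            of U "subtopology X A"]
        by (simp add: o_def)
      show "continuous_map ?P euclideanreal (\<lambda>p. (case p of (t, g) \<Rightarrow> join_coords l (\<theta> g) t) i)"
        using 1 2 by (cases "i < l") (simp_all add: join_coords_def case_prod_unfold)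
    next
      fix p assume "p \<in> topspace ?P"
      then have "p \<in> U \<times> A" using tP by blast
      then show "(case p of (t, g) \<Rightarrow> join_coords l (\<theta> g) t) \<in> Rn (l + n)"
        using Us by (auto intro: join_in_Rn)
    qed
    have "join_coords l (\<theta> g) t \<in> prod_set l n (\<theta> ` A) U" if "t \<in> U" "g \<in> A" for t g
      using that Us D(4) fst_join[of "\<theta> g" l t] snd_join[of l "\<theta> g" t] join_in_Rn[of t n l "\<theta> g"]
      by (auto simp: prod_set_def)
    then have "continuous_map ?P (subtopology (Euclidean_space (l + n)) (prod_set l n (\<theta> ` A) U)) (\<lambda>(t, g). join_coords l (\<theta> g) t)"
      using j tP by (auto simp: continuous_map_in_subtopology simp del: topspace_prod_topology)
    from continuous_map_compose[OF this Ck_continuous[OF C]]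
    have "continuous_map ?P euclideanreal (\<lambda>(t, g). F t g)"
    proof (rule continuous_map_eq)
      fix p assume "p \<in> topspace ?P"
      then have "p \<in> U \<times> A" using tP by blast
      then show "((\<lambda>z. F (snd_coords l z) (inv_into A \<theta> (fst_coords l z))) \<circ> (\<lambda>(t, g). join_coords l (\<theta> g) t)) p
         = (case p of (t, g) \<Rightarrow> F t g)"
        using D(4,5) by (auto simp: snd_join fst_join image_subset_iff)
    qed
    moreover have "openin (prod_topology ?E X) (U \<times> A)"
      using D(1) E openin_topspace[of ?E] by (auto simp: openin_prod_Times_iff)
    ultimately show "\<exists>W. openin (prod_topology ?E X) W \<and> p \<in> W \<and>
        continuous_map (subtopology (prod_topology ?E X) W) euclideanreal (\<lambda>(t, g). F t g)"
      using p A(2) E by (intro exI[of _ "U \<times> A"]) (auto simp: P)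
  qed
  show "(\<And>g. g \<in> topspace X \<Longrightarrow> \<exists>A \<theta>. chart_on X l A \<theta> \<and> g \<in> A \<and>
      Ck_on (l + n) k (prod_set l n (\<theta> ` A) U) (\<lambda>z. F (snd_coords l z) (inv_into A \<theta> (fst_coords l z))))
    \<Longrightarrow> par_Ck X n k U F"
  proof (induction k arbitrary: F)
    case 0
    then show ?case using cont[of 0 F] by simp
  next
    case (Suc k)
    have upd: "fst_coords l (z(l + i := s)) = fst_coords l z"
      "snd_coords l (z(l + i := s)) = (snd_coords l z)(i := s)" for z i s
      by (auto simp: fst_coords_def snd_coords_def)
    have pd: "partial_deriv (l + i) (\<lambda>z. F (snd_coords l z) (inv_into A \<theta> (fst_coords l z)))
       = (\<lambda>z. partial_deriv i (\<lambda>t. F t (inv_into A \<theta> (fst_coords l z))) (snd_coords l z))" for i A \<theta>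
      unfolding partial_deriv_def upd by (simp add: snd_coords_def)
    have "(\<lambda>s. F (t(i := s)) g) field_differentiable at (t i)"
      if h: "i < n" "t \<in> U" "g \<in> topspace X" for i t g
    proof -
      obtain A \<theta> where A: "chart_on X l A \<theta>" "g \<in> A"
        and C: "Ck_on (l + n) (Suc k) (prod_set l n (\<theta> ` A) U) (\<lambda>z. F (snd_coords l z) (inv_into A \<theta> (fst_coords l z)))"
        using Suc.prems[OF h(3)] by blast
      note D = chart_onD[OF A(1)]
      define z where "z = join_coords l (\<theta> g) t"
      have "\<theta> g \<in> Rn l" using D(4) A(2) by blast
      then have fz: "fst_coords l z = \<theta> g" "snd_coords l z = t" "z (l + i) = t i"
        unfolding z_def by (simp add: fst_join, simp add: snd_join, simp add: join_coords_def)
      have "z \<in> prod_set l n (\<theta> ` A) U"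
        using fz that A(2) Us join_in_Rn[of t n l "\<theta> g"] by (auto simp: prod_set_def z_def)
      then have "(\<lambda>s. F (snd_coords l (z(l + i := s))) (inv_into A \<theta> (fst_coords l (z(l + i := s)))))
          field_differentiable at (z (l + i))"
        using C that(1) by simp
      then show ?thesis using A(2) D(5) unfolding upd fz by simp
    qed
    moreover have "par_Ck X n k U (\<lambda>t g. partial_deriv i (\<lambda>t. F t g) t)" if i: "i < n" for i
    proof (rule Suc.IH)
      fix g assume "g \<in> topspace X"
      then obtain A \<theta> where A: "chart_on X l A \<theta>" "g \<in> A"
        and C: "Ck_on (l + n) (Suc k) (prod_set l n (\<theta> ` A) U) (\<lambda>z. F (snd_coords l z) (inv_into A \<theta> (fst_coords l z)))"
        using Suc.prems by blast
      have "Ck_on (l + n) k (prod_set l n (\<theta> ` A) U)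
         (\<lambda>z. partial_deriv i (\<lambda>t. F t (inv_into A \<theta> (fst_coords l z))) (snd_coords l z))"
        using C i unfolding pd[symmetric] by simp
      then show "\<exists>A \<theta>. chart_on X l A \<theta> \<and> g \<in> A \<and> Ck_on (l + n) k (prod_set l n (\<theta> ` A) U)
         (\<lambda>z. partial_deriv i (\<lambda>t. F t (inv_into A \<theta> (fst_coords l z))) (snd_coords l z))"
        using A by blast
    qed
    ultimately show ?case using cont[OF Suc.prems] by simp
  qed
qed

section \<open>Averaging over a proper action\<close>

lemma smooth_manifold_chart:
  assumes "smooth_manifold M" "(U, \<phi>) \<in> atlas M"
  shows "chart_on (mtop M) (mdim M) U \<phi>"
  using assms by (auto simp: smooth_manifold_def chart_on_def)

lemma smooth_manifold_chart_at:
  assumes "smooth_manifold M" "x \<in> points M"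
  obtains U \<phi> where "(U, \<phi>) \<in> atlas M" "x \<in> U"
proof -
  have "x \<in> (\<Union>(U, \<phi>)\<in>atlas M. U)" using assms by (simp add: smooth_manifold_def)
  then show thesis using that by auto
qed

lemma smooth_manifold_locally_compact:
  assumes "smooth_manifold M"
  shows "locally_compact_space (mtop M)"
proof (rule locally_compact_space_if_charts)
  fix x assume "x \<in> points M"
  then obtain U \<phi> where "(U, \<phi>) \<in> atlas M" "x \<in> U" using smooth_manifold_chart_at[OF assms] by blast
  then show "\<exists>A \<phi>. chart_on (mtop M) (mdim M) A \<phi> \<and> x \<in> A" using smooth_manifold_chart[OF assms] by blast
qed

lemma lie_group_locally_compact_group:
  assumes "lie_group G L"
  shows "locally_compact_group G (mtop L)"
proof -
  interpret lie_group G L by fact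
  show ?thesis
  proof
    show "topspace (mtop L) = carrier G" by (rule carrier_eq)
    show "continuous_map (prod_topology (mtop L) (mtop L)) (mtop L) (\<lambda>(g, h). g \<otimes>\<^bsub>G\<^esub> h)"
      using smooth_mult by (simp add: smooth_map_def prod_manifold_def)
    show "continuous_map (mtop L) (mtop L) (\<lambda>g. inv\<^bsub>G\<^esub> g)"
      using smooth_inv by (simp add: smooth_map_def)
    show "Hausdorff_space (mtop L)" using manifold by (simp add: smooth_manifold_def)
    show "locally_compact_space (mtop L)" by (rule smooth_manifold_locally_compact[OF manifold])
  qed
qed

locale proper_lie_action =
  fixes G :: "('g, 'z) monoid_scheme" and L :: "'g manifold"
    and M :: "'m manifold" and \<alpha> :: "'g \<Rightarrow> 'm \<Rightarrow> 'm"
  assumes lie: "lie_group G L" and manifold_M: "smooth_manifold M" and proper: "proper_action G L M \<alpha>"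
begin

lemma manifold_L: "smooth_manifold L" and points_L: "points L = carrier G"
  using lie by (auto simp: lie_group_def lie_group_axioms_def)

lemma action: "group_action G (points M) \<alpha>"
  using proper by (simp add: proper_action_def smooth_action_def)

lemma smooth_act: "smooth_map (prod_manifold L M) M (\<lambda>(g, x). \<alpha> g x)"
  using proper by (simp add: proper_action_def smooth_action_def)

lemma continuous_act: "continuous_map (prod_topology (mtop L) (mtop M)) (mtop M) (\<lambda>(g, x). \<alpha> g x)"
  using smooth_act by (simp add: smooth_map_def prod_manifold_def)

lemma act_closed: "g \<in> carrier G \<Longrightarrow> x \<in> points M \<Longrightarrow> \<alpha> g x \<in> points M"
  using group_action.element_image[OF action] by blast

lemma act_mult:
  "x \<in> points M \<Longrightarrow> g \<in> carrier G \<Longrightarrow> h \<in> carrier G \<Longrightarrow> \<alpha> (g \<otimes>\<^bsub>G\<^esub> h) x = \<alpha> g (\<alpha> h x)"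
  using group_action.composition_rule[OF action] by blast

lemma act_one: "x \<in> points M \<Longrightarrow> \<alpha> \<one>\<^bsub>G\<^esub> x = x"
  using group_action.id_eq_one[OF action] by (metis restrict_apply')

text \<open>
  This is where properness enters: the set is a projection of the preimage of \<open>K \<times> C\<close>.
\<close>

lemma compactin_transporter:
  assumes K: "compactin (mtop M) K" and C: "compactin (mtop M) C"
  shows "compactin (mtop L) {g \<in> carrier G. \<exists>y\<in>C. \<alpha> g y \<in> K}"
proof -
  let ?P = "prod_topology (mtop L) (mtop M)"
  have "proper_map ?P (prod_topology (mtop M) (mtop M)) (\<lambda>(g, x). (\<alpha> g x, x))"
    using proper by (simp add: proper_action_def)
  moreover have "compactin (prod_topology (mtop M) (mtop M)) (K \<times> C)"
    using K C by (simp add: compactin_Times)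
  ultimately have "compactin ?P {p \<in> topspace ?P. (\<lambda>(g, x). (\<alpha> g x, x)) p \<in> K \<times> C}"
    by (rule compactin_proper_map_preimage)
  from image_compactin[OF this continuous_map_fst]
  have "compactin (mtop L) (fst ` {p \<in> topspace ?P. (\<lambda>(g, x). (\<alpha> g x, x)) p \<in> K \<times> C})" .
  moreover have "fst ` {p \<in> topspace ?P. (\<lambda>(g, x). (\<alpha> g x, x)) p \<in> K \<times> C} = {g \<in> carrier G. \<exists>y\<in>C. \<alpha> g y \<in> K}"
    using compactin_subset_topspace[OF C] points_L by (force simp: image_iff)
  ultimately show ?thesis by simp
qed

text \<open>
  The orbit of \<open>x\<close> is the slice at \<open>x\<close> of the image of \<open>G \<times> {x}\<close> under a proper, hence closed, map.
\<close>

lemma closedin_orbit: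
  assumes x: "x \<in> points M"
  shows "closedin (mtop M) (orbit G \<alpha> x)"
proof -
  let ?P = "prod_topology (mtop L) (mtop M)"
  have "closed_map ?P (prod_topology (mtop M) (mtop M)) (\<lambda>(g, x). (\<alpha> g x, x))"
    using proper by (simp add: proper_action_def proper_imp_closed_map)
  moreover have "closedin ?P (points L \<times> {x})"
    using manifold_M x by (simp add: closedin_prod_Times_iff smooth_manifold_def closedin_Hausdorff_singleton)
  ultimately have "closedin (prod_topology (mtop M) (mtop M)) ((\<lambda>(g, x). (\<alpha> g x, x)) ` (points L \<times> {x}))"
    by (simp add: closed_map_def)
  moreover have "continuous_map (mtop M) (prod_topology (mtop M) (mtop M)) (\<lambda>y. (y, x))"
    using x by (simp add: continuous_map_pairedI)
  ultimately have "closedin (mtop M) {y \<in> points M. (y, x) \<in> (\<lambda>(g, x). (\<alpha> g x, x)) ` (points L \<times> {x})}"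
    by (rule closedin_continuous_map_preimage[rotated])
  moreover have "{y \<in> points M. (y, x) \<in> (\<lambda>(g, x). (\<alpha> g x, x)) ` (points L \<times> {x})} = orbit G \<alpha> x"
    using act_closed x points_L by (auto simp: orbit_def)
  ultimately show ?thesis by simp
qed

text \<open>
  Where \<open>g \<cdot> y\<close> lies in the chart domain \<open>U\<close>, the function is a smooth function on all of \<open>\<real>\<^sup>m\<close> applied
  to the coordinates of \<open>g \<cdot> y\<close>; where \<open>g \<cdot> y\<close> lies outside \<open>K\<close>, it is zero. These two open sets cover.
\<close>

lemma par_Ck_translated_bump:
  assumes U: "(U, \<phi>) \<in> atlas M" and V: "(V, \<psi>) \<in> atlas M"
    and b: "smooth_on (mdim M) (Rn (mdim M)) b"
    and K: "compactin (mtop M) K" "K \<subseteq> U" and supp: "\<And>y. y \<in> U \<Longrightarrow> b (\<phi> y) \<noteq> 0 \<Longrightarrow> y \<in> K"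
  defines "\<rho> \<equiv> (\<lambda>y. if y \<in> U then b (\<phi> y) else 0)"
  shows "par_Ck (mtop L) (mdim M) k (\<psi> ` V) (\<lambda>t g. \<rho> (\<alpha> g (inv_into V \<psi> t)))"
proof (rule par_CkI_charts)
  let ?l = "mdim L" and ?m = "mdim M"
  note DU = chart_onD[OF smooth_manifold_chart[OF manifold_M U]]
  note DV = chart_onD[OF smooth_manifold_chart[OF manifold_M V]]
  show "openin (Euclidean_space ?m) (\<psi> ` V)" by (rule DV(3))
  fix g0 assume "g0 \<in> topspace (mtop L)"
  then obtain A \<theta> where A: "(A, \<theta>) \<in> atlas L" "g0 \<in> A"
    using smooth_manifold_chart_at[OF manifold_L] by blast
  note DA = chart_onD[OF smooth_manifold_chart[OF manifold_L A(1)]]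
  let ?Z = "prod_set ?l ?m (\<theta> ` A) (\<psi> ` V)"
  let ?J = "\<lambda>z. (inv_into A \<theta> (fst_coords ?l z), inv_into V \<psi> (snd_coords ?l z))"
  let ?act = "\<lambda>z. \<alpha> (inv_into A \<theta> (fst_coords ?l z)) (inv_into V \<psi> (snd_coords ?l z))"
  let ?c = "\<lambda>(x, y). join_coords ?l (\<theta> x) (\<psi> y)"
  have Z: "openin (Euclidean_space (?l + ?m)) ?Z" by (rule openin_prod_set[OF DA(3) DV(3)])
  have act: "continuous_map (subtopology (Euclidean_space (?l + ?m)) ?Z) (mtop M) ?act"
  proof -
    let ?S = "subtopology (Euclidean_space (?l + ?m)) ?Z"
    have 1: "continuous_map ?S (subtopology (Euclidean_space ?l) (\<theta> ` A)) (fst_coords ?l)"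
      using continuous_map_fst_coords by (auto simp: continuous_map_in_subtopology prod_set_def intro: continuous_map_from_subtopology)
    have 2: "continuous_map ?S (subtopology (Euclidean_space ?m) (\<psi> ` V)) (snd_coords ?l)"
      using continuous_map_snd_coords by (auto simp: continuous_map_in_subtopology prod_set_def intro: continuous_map_from_subtopology)
    have "continuous_map ?S (prod_topology (mtop L) (mtop M)) ?J"
      using continuous_map_compose[OF 1 DA(7)] continuous_map_compose[OF 2 DV(7)]
      by (intro continuous_map_pairedI) (simp_all only: o_def)
    from continuous_map_compose[OF this continuous_act] show ?thesis by (simp add: o_def)
  qed
  have pre: "openin (Euclidean_space (?l + ?m)) {z \<in> ?Z. ?act z \<in> W}" if "openin (mtop M) W" for W
  proof -
    have t: "topspace (subtopology (Euclidean_space (?l + ?m)) ?Z) = ?Z"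
      using openin_subset[OF Z] by auto
    show ?thesis
      using openin_trans_full[OF openin_continuous_map_preimage[OF act that, unfolded t] Z] .
  qed
  have inj: "inj_on ?c (A \<times> V)"
  proof (rule inj_onI, clarify)
    fix x y x' y' assume h: "x \<in> A" "y \<in> V" "x' \<in> A" "y' \<in> V"
      and eq: "join_coords ?l (\<theta> x) (\<psi> y) = join_coords ?l (\<theta> x') (\<psi> y')"
    have "\<theta> x = \<theta> x'" "\<psi> y = \<psi> y'"
      using h DA(4) eq fst_join[of "\<theta> x" ?l "\<psi> y"] fst_join[of "\<theta> x'" ?l "\<psi> y'"]
        snd_join[of ?l "\<theta> x" "\<psi> y"] snd_join[of ?l "\<theta> x'" "\<psi> y'"] by (auto simp: image_subset_iff)
    then show "x = x' \<and> y = y'" using h DA(5) DV(5) by (auto dest: inj_onD)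
  qed
  have cJ: "?J z \<in> A \<times> V" "?c (?J z) = z" if "z \<in> ?Z" for z
    using that by (auto simp: prod_set_def inv_into_into f_inv_into_f join_fst_snd)
  have cZ: "?c p \<in> ?Z" "?J (?c p) = p" if p: "p \<in> A \<times> V" for p
  proof -
    obtain x y where xy: "p = (x, y)" "x \<in> A" "y \<in> V" using p by auto
    have r: "\<theta> x \<in> Rn ?l" "\<psi> y \<in> Rn ?m" using xy DA(4) DV(4) by auto
    show "?c p \<in> ?Z" "?J (?c p) = p"
      using xy r DA(5) DV(5) by (auto simp: prod_set_def fst_join snd_join join_in_Rn)
  qed
  have Jinv: "inv_into (A \<times> V) ?c z = ?J z" if "z \<in> ?Z" for z
    by (rule inv_into_f_eq[OF inj cJ[OF that]])
  let ?\<Phi> = "\<lambda>z. \<rho> (\<alpha> (inv_into A \<theta> (fst_coords ?l z)) (inv_into V \<psi> (snd_coords ?l z)))"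
  have "Ck_on (?l + ?m) k ?Z ?\<Phi>"
  proof (rule Ck_local[OF Z])
    fix z assume z: "z \<in> ?Z"
    show "\<exists>W. openin (Euclidean_space (?l + ?m)) W \<and> z \<in> W \<and> Ck_on (?l + ?m) k W ?\<Phi>"
    proof (cases "?act z \<in> U")
      case True
      let ?W = "{z \<in> ?Z. ?act z \<in> U}"
      have W: "openin (Euclidean_space (?l + ?m)) ?W" by (rule pre[OF DU(1)])
      have img: "?c ` {x \<in> A \<times> V. (case x of (g, x) \<Rightarrow> \<alpha> g x) \<in> U} = ?W"
      proof (intro subset_antisym subsetI)
        fix w assume "w \<in> ?c ` {x \<in> A \<times> V. (case x of (g, x) \<Rightarrow> \<alpha> g x) \<in> U}"
        then obtain p where p: "w = ?c p" "p \<in> A \<times> V" "(case p of (g, x) \<Rightarrow> \<alpha> g x) \<in> U" by blast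
        then show "w \<in> ?W" using cZ[OF p(2)] by (auto simp: prod_eq_iff)
      next
        fix w assume w: "w \<in> ?W"
        then have w': "w \<in> ?Z" "?act w \<in> U" by auto
        have "?c (?J w) \<in> ?c ` {x \<in> A \<times> V. (case x of (g, x) \<Rightarrow> \<alpha> g x) \<in> U}"
          by (rule imageI) (use cJ(1)[OF w'(1)] w'(2) in auto)
        then show "w \<in> ?c ` {x \<in> A \<times> V. (case x of (g, x) \<Rightarrow> \<alpha> g x) \<in> U}"
          by (simp only: cJ(2)[OF w'(1)])
      qed
      have comp: "Ck_on (?l + ?m) k ?W (\<lambda>z. \<phi> (?act z) j)" if j: "j < ?m" for j
      proof -
        have "(A \<times> V, ?c) \<in> atlas (prod_manifold L M)"
          using A(1) V by (auto simp: prod_manifold_def join_coords_def)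
        then have "smooth_on (?l + ?m) (?c ` {x \<in> A \<times> V. (case x of (g, x) \<Rightarrow> \<alpha> g x) \<in> U})
            (\<lambda>y. \<phi> (case inv_into (A \<times> V) ?c y of (g, x) \<Rightarrow> \<alpha> g x) j)"
          using smooth_act U j unfolding smooth_map_def by (fastforce simp: prod_manifold_def)
        then have "Ck_on (?l + ?m) k ?W (\<lambda>y. \<phi> (case inv_into (A \<times> V) ?c y of (g, x) \<Rightarrow> \<alpha> g x) j)"
          unfolding img smooth_on_def by blast
        then show ?thesis by (rule Ck_cong[OF W, rotated]) (use Jinv in auto)
      qed
      have bk: "Ck_on ?m k (Rn ?m) b" using b by (simp add: smooth_on_def)
      have "Ck_on (?l + ?m) k ?W (\<lambda>z. b (\<lambda>j. if j < ?m then \<phi> (?act z) j else 0))"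
        by (rule Ck_compose[OF W bk comp])
      then have "Ck_on (?l + ?m) k ?W ?\<Phi>"
      proof (rule Ck_cong[OF W, rotated])
        fix w assume "w \<in> ?W"
        then have w: "?act w \<in> U" by blast
        then have "\<phi> (?act w) \<in> Rn ?m" using DU(4) by blast
        then have "(\<lambda>j. if j < ?m then \<phi> (?act w) j else 0) = \<phi> (?act w)"
          by (auto simp: mem_Rn fun_eq_iff)
        then show "b (\<lambda>j. if j < ?m then \<phi> (?act w) j else 0) = ?\<Phi> w" using w by (simp add: \<rho>_def)
      qed
      then show ?thesis using W z True by (intro exI[of _ ?W]) blast
    next
      case False
      let ?W = "{z \<in> ?Z. ?act z \<in> points M - K}"
      have "closedin (mtop M) K"
        using compactin_imp_closedin K(1) manifold_M by (auto simp: smooth_manifold_def)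
      then have W: "openin (Euclidean_space (?l + ?m)) ?W" by (intro pre) blast
      have "Ck_on (?l + ?m) k ?W ?\<Phi>"
        by (rule Ck_cong[OF W _ Ck_const[OF W, of k 0]]) (use supp in \<open>auto simp: \<rho>_def\<close>)
      moreover have "z \<in> ?W"
      proof -
        have "inv_into A \<theta> (fst_coords ?l z) \<in> carrier G" "inv_into V \<psi> (snd_coords ?l z) \<in> points M"
          using cJ(1)[OF z] DA(2) DV(2) points_L by auto
        then show ?thesis using z False K(2) act_closed by auto
      qed
      ultimately show ?thesis using W by (intro exI[of _ ?W]) blast
    qed
  qed
  then show "\<exists>A \<theta>. chart_on (mtop L) ?l A \<theta> \<and> g0 \<in> A \<and> Ck_on (?l + ?m) k (prod_set ?l ?m (\<theta> ` A) (\<psi> ` V))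
      (\<lambda>z. \<rho> (\<alpha> (inv_into A \<theta> (fst_coords ?l z)) (inv_into V \<psi> (snd_coords ?l z))))"
    using A smooth_manifold_chart[OF manifold_L A(1)] by blast
qed

abbreviation invariant_functions :: "('m \<Rightarrow> real) set" where
  "invariant_functions \<equiv> ccarrier (invariant_cinf_ring G M \<alpha>)"

lemma mem_invariants:
  "f \<in> invariant_functions \<longleftrightarrow> f \<in> Cinf M \<and> (\<forall>g\<in>carrier G. \<forall>x\<in>points M. f (\<alpha> g x) = f x)"
  by (simp add: invariant_cinf_ring_def)

text \<open>
  Average over \<open>G\<close> a bump \<open>\<rho>\<close> with support in a compact subset \<open>K\<close> of \<open>W\<close>. Invariance of the average
  is right invariance of the Haar functional. The average is positive at \<open>x\<close> because \<open>\<rho> (\<one> \<cdot> x) > 0\<close>,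
  and at \<open>y\<close> it can be nonzero only if some \<open>g \<cdot> y\<close> meets the support of \<open>\<rho>\<close>.
\<close>

theorem invariant_bump:
  assumes W: "openin (mtop M) W" and x: "x \<in> W"
  obtains f K where "f \<in> invariant_functions" "\<And>y. y \<in> points M \<Longrightarrow> 0 \<le> f y" "0 < f x"
    "compactin (mtop M) K" "K \<subseteq> W" "\<And>y. y \<in> points M \<Longrightarrow> f y \<noteq> 0 \<Longrightarrow> \<exists>g\<in>carrier G. \<alpha> g y \<in> K"
proof -
  interpret locally_compact_group G "mtop L" by (rule lie_group_locally_compact_group[OF lie])
  have xM: "x \<in> points M" using W x openin_subset by blast
  obtain U \<phi> where U: "(U, \<phi>) \<in> atlas M" "x \<in> U" using smooth_manifold_chart_at[OF manifold_M xM] by blast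
  note chU = smooth_manifold_chart[OF manifold_M U(1)]
  note DU = chart_onD[OF chU]
  have "openin (subtopology (mtop M) U) (U \<inter> W)" using W by (simp add: openin_subtopology_Int2)
  then have "openin (subtopology (Euclidean_space (mdim M)) (\<phi> ` U)) (\<phi> ` (U \<inter> W))"
    using chU homeomorphic_imp_open_map unfolding chart_on_def open_map_def by blast
  then have oUW: "openin (Euclidean_space (mdim M)) (\<phi> ` (U \<inter> W))" using DU(3) openin_trans_full by blast
  moreover have "\<phi> x \<in> \<phi> ` (U \<inter> W)" using U x by blast
  ultimately obtain b C where b: "smooth_on (mdim M) (Rn (mdim M)) b" "\<And>t. b t \<ge> 0" "b (\<phi> x) > 0"
    and C: "compactin (Euclidean_space (mdim M)) C" "C \<subseteq> \<phi> ` (U \<inter> W)" "\<And>t. t \<in> Rn (mdim M) \<Longrightarrow> b t \<noteq> 0 \<Longrightarrow> t \<in> C"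
    by (rule bump_Rn) blast
  define K where "K = inv_into U \<phi> ` C"
  have CU: "C \<subseteq> \<phi> ` U" using C(2) by blast
  have "compactin (subtopology (Euclidean_space (mdim M)) (\<phi> ` U)) C" using C(1) CU by (simp add: compactin_subtopology)
  then have K: "compactin (mtop M) K" unfolding K_def by (rule image_compactin[OF _ DU(7)])
  have KUW: "K \<subseteq> U \<inter> W" using C(2) DU(5) by (auto simp: K_def inv_into_f_f subset_iff image_iff)
  have bK: "y \<in> K" if "y \<in> U" "b (\<phi> y) \<noteq> 0" for y
  proof -
    have "\<phi> y \<in> C" using C(3) DU(4) that by blast
    then show ?thesis using DU(5) that(1) unfolding K_def by (metis imageI inv_into_f_f)
  qed
  define \<rho> where "\<rho> = (\<lambda>y. if y \<in> U then b (\<phi> y) else 0)"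
  have \<rho>K: "y \<in> K" if "\<rho> y \<noteq> 0" for y using that bK by (auto simp: \<rho>_def split: if_splits)
  have \<rho>0: "0 \<le> \<rho> y" for y using b(2) by (simp add: \<rho>_def)
  have par: "par_Ck (mtop L) (mdim M) k (\<psi> ` V) (\<lambda>t g. \<rho> (\<alpha> g (inv_into V \<psi> t)))" if "(V, \<psi>) \<in> atlas M" for V \<psi> k
    using par_Ck_translated_bump[OF U(1) that b(1) K _ bK] KUW unfolding \<rho>_def by blast
  have Cc: "(\<lambda>g. \<rho> (\<alpha> g y)) \<in> Cc (mtop L)" if y: "y \<in> points M" for y
  proof -
    obtain V \<psi> where V: "(V, \<psi>) \<in> atlas M" "y \<in> V" using smooth_manifold_chart_at[OF manifold_M y] by blast
    note DV = chart_onD[OF smooth_manifold_chart[OF manifold_M V(1)]]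
    have "continuous_map (mtop L) euclideanreal (\<lambda>g. \<rho> (\<alpha> g (inv_into V \<psi> (\<psi> y))))"
      using par_continuous_section[OF DV(3) par_Ck_continuous[OF par[OF V(1)]]] V(2) by blast
    moreover have "compactin (mtop L) {g \<in> carrier G. \<exists>z\<in>{y}. \<alpha> g z \<in> K}"
      using y by (intro compactin_transporter K) simp
    ultimately show ?thesis using V(2) DV(5) \<rho>K points_L by (fastforce simp: Cc_def inv_into_f_f)
  qed
  obtain J where J: "positive_functional (mtop L) J"
    "\<And>f a. \<lbrakk>f \<in> Cc (mtop L); a \<in> carrier G\<rbrakk> \<Longrightarrow> J (\<lambda>x. f (x \<otimes>\<^bsub>G\<^esub> a)) = J f"
    "\<And>f. f \<in> test_functions \<Longrightarrow> 0 < J f"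
    using haar_functional_exists by blast
  define f where "f = (\<lambda>y\<in>points M. J (\<lambda>g. \<rho> (\<alpha> g y)))"
  have inv: "f (\<alpha> h y) = f y" if h: "h \<in> carrier G" and y: "y \<in> points M" for h y
  proof -
    have hy: "\<alpha> h y \<in> points M" using act_closed h y .
    have "J (\<lambda>g. \<rho> (\<alpha> g (\<alpha> h y))) = J (\<lambda>g. \<rho> (\<alpha> (g \<otimes>\<^bsub>G\<^esub> h) y))"
      using act_mult y h points_L
      by (intro positive_functional_cong[OF J(1) Cc[OF hy] Cc_translate[OF Cc[OF y] h]]) simp
    also have "\<dots> = J (\<lambda>g. \<rho> (\<alpha> g y))" using J(2)[OF Cc[OF y] h] .
    finally show ?thesis using y hy by (simp add: f_def)
  qed
  have "Ck_on (mdim M) k (\<psi> ` V) (\<lambda>t. f (inv_into V \<psi> t))" if V: "(V, \<psi>) \<in> atlas M" for V \<psi> k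
  proof (rule Ck_local)
    note ch = smooth_manifold_chart[OF manifold_M V]
    note DV = chart_onD[OF ch]
    show "openin (Euclidean_space (mdim M)) (\<psi> ` V)" by (rule DV(3))
    fix t0 assume "t0 \<in> \<psi> ` V"
    then obtain N C' where N: "openin (Euclidean_space (mdim M)) N" "t0 \<in> N" "N \<subseteq> \<psi> ` V"
      and C': "compactin (mtop M) C'" "inv_into V \<psi> ` N \<subseteq> C'"
      using chart_on_compact_nbhd[OF ch] by metis
    let ?F = "\<lambda>t g. \<rho> (\<alpha> g (inv_into V \<psi> t))"
    have "Ck_on (mdim M) k N (\<lambda>t. J (?F t))"
    proof (rule Ck_positive_functional[OF J(1) locally_compact Hausdorff compactin_transporter[OF K C'(1)] N(1)])
      show "par_Ck (mtop L) (mdim M) k N ?F" by (rule par_Ck_subset[OF N(3) par[OF V]])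
      show "\<forall>t\<in>N. \<forall>g\<in>points L. ?F t g \<noteq> 0 \<longrightarrow> g \<in> {g \<in> carrier G. \<exists>y\<in>C'. \<alpha> g y \<in> K}"
        using \<rho>K C'(2) points_L by blast
    qed
    then have "Ck_on (mdim M) k N (\<lambda>t. f (inv_into V \<psi> t))"
    proof (rule Ck_cong[OF N(1), rotated])
      fix t assume "t \<in> N"
      then have "inv_into V \<psi> t \<in> points M" using N(3) DV(2) inv_into_into by (metis subsetD)
      then show "J (?F t) = f (inv_into V \<psi> t)" by (simp add: f_def)
    qed
    then show "\<exists>W. openin (Euclidean_space (mdim M)) W \<and> t0 \<in> W \<and> Ck_on (mdim M) k W (\<lambda>t. f (inv_into V \<psi> t))"
      using N by blast
  qed
  then have "f \<in> invariant_functions" using inv by (auto simp: mem_invariants Cinf_def smooth_on_def f_def)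
  moreover have "0 \<le> f y" if y: "y \<in> points M" for y
    using J(1) Cc[OF y] \<rho>0 y by (simp add: f_def positive_functional_def Cc_nonneg_def)
  moreover have "0 < f x"
  proof -
    have "(\<lambda>g. \<rho> (\<alpha> g x)) \<in> test_functions"
      using Cc[OF xM] \<rho>0 act_one[OF xM] U(2) b(3) by (simp add: test_functions_def Cc_nonneg_def \<rho>_def)
    then show ?thesis using J(3) xM by (simp add: f_def)
  qed
  moreover have "\<exists>g\<in>carrier G. \<alpha> g y \<in> K" if y: "y \<in> points M" and f: "f y \<noteq> 0" for y
  proof (rule ccontr)
    assume "\<not> ?thesis"
    then have "\<rho> (\<alpha> g y) = 0" if "g \<in> points L" for g using that \<rho>K points_L by blast
    then have "J (\<lambda>g. \<rho> (\<alpha> g y)) = J (\<lambda>g. 0 * \<rho> (\<alpha> g y))"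
      by (intro positive_functional_cong[OF J(1) Cc[OF y] Cc_cmult[OF Cc[OF y]]]) simp
    also have "\<dots> = 0 * J (\<lambda>g. \<rho> (\<alpha> g y))" by (rule positive_functional_cmult[OF J(1) Cc[OF y]])
    finally show False using f y by (simp add: f_def)
  qed
  ultimately show thesis using that K KUW by blast
qed

end

section \<open>Points of the ring of invariant functions\<close>

lemma quotient_maps_same_fibres_homeomorphic:
  assumes f: "quotient_map X Y f" and h: "quotient_map X Z h"
    and eq: "\<And>x y. \<lbrakk>x \<in> topspace X; y \<in> topspace X\<rbrakk> \<Longrightarrow> f x = f y \<longleftrightarrow> h x = h y"
  shows "Y homeomorphic_space Z"
proof -
  obtain u where u: "continuous_map Y Z u" "\<And>x. x \<in> topspace X \<Longrightarrow> u (f x) = h x"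
    using quotient_map_lift_exists[OF f quotient_imp_continuous_map[OF h]] eq by metis
  obtain v where v: "continuous_map Z Y v" "\<And>x. x \<in> topspace X \<Longrightarrow> v (h x) = f x"
    using quotient_map_lift_exists[OF h quotient_imp_continuous_map[OF f]] eq by metis
  have "homeomorphic_maps Y Z u v"
    unfolding homeomorphic_maps_def
    using u v quotient_imp_surjective_map[OF f] quotient_imp_surjective_map[OF h] by force
  then show ?thesis unfolding homeomorphic_space_def by blast
qed

context proper_lie_action
begin

abbreviation \<A> where "\<A> \<equiv> invariant_cinf_ring G M \<alpha>"

lemma cop_invariants:
  "cop \<A> f as = (\<lambda>x\<in>points M. f (vec_of_list (map (\<lambda>a. a x) as)))"
  by (simp add: invariant_cinf_ring_def Cinf_ring_def)

lemma cop_invariants_closed: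
  "as \<in> lists invariant_functions \<Longrightarrow> f \<in> Cinf_Rn (length as) \<Longrightarrow> cop \<A> f as \<in> invariant_functions"
  by (rule invariant_op[OF manifold_M action])

lemma cinf_ring_A: "is_cinf_ring \<A>"
  by (rule is_cinf_ring_invariant[OF manifold_M action])

lemma invariantsD:
  assumes "f \<in> invariant_functions"
  shows "f \<in> extensional (points M)" "\<And>g x. g \<in> carrier G \<Longrightarrow> x \<in> points M \<Longrightarrow> f (\<alpha> g x) = f x"
    "\<And>U \<phi> k. (U, \<phi>) \<in> atlas M \<Longrightarrow> Ck_on (mdim M) k (\<phi> ` U) (\<lambda>y. f (inv_into U \<phi> y))"
  using assms unfolding mem_invariants Cinf_def smooth_on_def by auto

lemma invariantsI:
  assumes "f \<in> extensional (points M)" "\<And>g x. g \<in> carrier G \<Longrightarrow> x \<in> points M \<Longrightarrow> f (\<alpha> g x) = f x"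
    "\<And>U \<phi> k. (U, \<phi>) \<in> atlas M \<Longrightarrow> Ck_on (mdim M) k (\<phi> ` U) (\<lambda>y. f (inv_into U \<phi> y))"
  shows "f \<in> invariant_functions"
  using assms unfolding mem_invariants Cinf_def smooth_on_def by auto

lemma invariants_continuous:
  assumes f: "f \<in> invariant_functions"
  shows "continuous_map (mtop M) euclideanreal f"
proof (rule continuous_map_locally)
  fix x assume "x \<in> points M"
  then obtain U \<phi> where U: "(U, \<phi>) \<in> atlas M" "x \<in> U" using smooth_manifold_chart_at[OF manifold_M] by blast
  note D = chart_onD[OF smooth_manifold_chart[OF manifold_M U(1)]]
  have "continuous_map (subtopology (Euclidean_space (mdim M)) (\<phi> ` U)) euclideanreal (\<lambda>y. f (inv_into U \<phi> y))"
    using Ck_continuous[OF invariantsD(3)[OF f U(1), of 0]] .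
  moreover have "continuous_map (subtopology (mtop M) U) (subtopology (Euclidean_space (mdim M)) (\<phi> ` U)) \<phi>"
    using D(6) by (auto simp: continuous_map_in_subtopology)
  ultimately have "continuous_map (subtopology (mtop M) U) euclideanreal ((\<lambda>y. f (inv_into U \<phi> y)) \<circ> \<phi>)"
    by (rule continuous_map_compose[rotated])
  then have "continuous_map (subtopology (mtop M) U) euclideanreal f"
    by (rule continuous_map_eq) (use D(5) in auto)
  then show "\<exists>W. openin (mtop M) W \<and> x \<in> W \<and> continuous_map (subtopology (mtop M) W) euclideanreal f"
    using D(1) U(2) by blast
qed

lemma hom_smooth_operation:
  assumes h: "h \<in> cinf_hom \<A> real_cinf_ring" and as: "as \<in> lists invariant_functions"
    and F: "\<And>k. Ck_on (length as) k (Rn (length as)) F"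
  defines "b \<equiv> (\<lambda>x\<in>points M. F (vec_of_list (map (\<lambda>a. a x) as)))"
  shows "b \<in> invariant_functions" "h b = F (vec_of_list (map h as))"
proof -
  let ?f = "restrict F (Rn (length as))"
  have f: "?f \<in> Cinf_Rn (length as)" by (rule Cinf_RnI[OF F])
  have b: "cop \<A> ?f as = b"
    using vec_Rn[of "map (\<lambda>a. a x) as" for x] by (auto simp: cop_invariants b_def fun_eq_iff)
  show "b \<in> invariant_functions" using cop_invariants_closed[OF as f] by (simp add: b)
  have "h (cop \<A> ?f as) = cop real_cinf_ring ?f (map h as)"
    using h as f unfolding cinf_hom_def by blast
  then show "h b = F (vec_of_list (map h as))"
    using vec_Rn[of "map h as"] by (simp add: b real_cinf_ring_def)
qed

lemma evaluation_hom:
  assumes x: "x \<in> points M"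
  shows "(\<lambda>a\<in>invariant_functions. a x) \<in> cinf_hom \<A> real_cinf_ring"
proof -
  have "(\<lambda>a\<in>invariant_functions. a x) (cop \<A> f as) = cop real_cinf_ring f (map (\<lambda>a\<in>invariant_functions. a x) as)"
    if as: "as \<in> lists invariant_functions" and f: "f \<in> Cinf_Rn (length as)" for as f
  proof -
    have "map (\<lambda>a\<in>invariant_functions. a x) as = map (\<lambda>a. a x) as" using as by (intro map_cong) auto
    then show ?thesis using cop_invariants_closed[OF as f] x by (simp add: cop_invariants real_cinf_ring_def del: map_eq_conv)
  qed
  then show ?thesis unfolding cinf_hom_def by (auto simp: real_cinf_ring_def)
qed

text \<open>
  For different orbits, take an invariant bump at \<open>x\<close> inside the complement of the closed orbit of \<open>y\<close>.
\<close>

lemma same_orbit_iff: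
  assumes "x \<in> points M" "y \<in> points M"
  shows "orbit G \<alpha> x = orbit G \<alpha> y \<longleftrightarrow> (\<lambda>a\<in>invariant_functions. a x) = (\<lambda>a\<in>invariant_functions. a y)"
proof
  have self: "x \<in> orbit G \<alpha> x" using group_action.orbit_refl[OF action] assms by blast
  { assume "orbit G \<alpha> x = orbit G \<alpha> y"
    then obtain g where "g \<in> carrier G" "x = \<alpha> g y" using self by (auto simp: orbit_def)
    then have "a x = a y" if "a \<in> invariant_functions" for a using invariantsD(2)[OF that] assms by simp
    then show "(\<lambda>a\<in>invariant_functions. a x) = (\<lambda>a\<in>invariant_functions. a y)" by (rule restrict_ext) }
  { assume eq: "(\<lambda>a\<in>invariant_functions. a x) = (\<lambda>a\<in>invariant_functions. a y)"
    show "orbit G \<alpha> x = orbit G \<alpha> y"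
    proof (rule ccontr)
      assume ne: "orbit G \<alpha> x \<noteq> orbit G \<alpha> y"
      have "x \<notin> orbit G \<alpha> y"
      proof
        assume "x \<in> orbit G \<alpha> y"
        moreover have "orbit G \<alpha> x \<in> orbits G (points M) \<alpha>" "orbit G \<alpha> y \<in> orbits G (points M) \<alpha>"
          using assms by (auto simp: orbits_def)
        ultimately show False
          using self ne group_action.disjoint_union[OF action] by blast
      qed
      then have "x \<in> points M - orbit G \<alpha> y" using assms by blast
      moreover have "openin (mtop M) (points M - orbit G \<alpha> y)"
        using closedin_orbit[OF assms(2)] by blast
      ultimately obtain f K where f: "f \<in> invariant_functions" "0 < f x"
        and K: "K \<subseteq> points M - orbit G \<alpha> y" "\<And>z. z \<in> points M \<Longrightarrow> f z \<noteq> 0 \<Longrightarrow> \<exists>g\<in>carrier G. \<alpha> g z \<in> K"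
        using invariant_bump by metis
      have "f y = f x" using fun_cong[OF eq, of f] f(1) by simp
      then obtain g where "g \<in> carrier G" "\<alpha> g y \<in> K" using K(2)[OF assms(2)] f(2) by auto
      then show False using K(1) by (auto simp: orbit_def)
    qed }
qed

text \<open>
  Countably many invariant bumps \<open>f\<^sub>i\<close> with compact sets \<open>C\<^sub>i\<close> suffice for \<open>M\<close> to be covered by the sets
  \<open>{f\<^sub>i > 0}\<close>. Let \<open>s\<^sub>n = f\<^sub>0 + \<dots> + f\<^sub>n\<close> and let \<open>\<theta>\<^sub>n\<close> be a smooth function of \<open>n s\<^sub>n\<close> that is \<open>0\<close> once
  \<open>n s\<^sub>n \<ge> 1\<close> and equals \<open>exp (-1)\<close> where \<open>s\<^sub>n = 0\<close>. Near each point \<open>s\<^sub>n\<close> is eventually bounded below, so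
  the sum \<open>p\<close> of the \<open>\<theta>\<^sub>n\<close> is locally finite; and on orbits that miss \<open>C\<^sub>0, \<dots>, C\<^sub>N\<^sub>-\<^sub>1\<close> the first \<open>N\<close> terms
  all equal \<open>exp (-1)\<close>, so \<open>p\<close> is large there.
\<close>

lemma exhaustion_function:
  obtains p where "p \<in> invariant_functions"
    "\<And>c. \<exists>C. compactin (mtop M) C \<and> (\<forall>y\<in>points M. p y \<le> c \<longrightarrow> (\<exists>g\<in>carrier G. \<alpha> g y \<in> C))"
proof (cases "points M = {}")
  case True
  have "restrict (\<lambda>_. 0) (Rn 0) \<in> Cinf_Rn (length [])"
    using Cinf_RnI[of 0 "\<lambda>_. 0"] by (simp add: Ck_const)
  then have "cop \<A> (restrict (\<lambda>_. 0) (Rn 0)) [] \<in> invariant_functions" by (intro cop_invariants_closed) auto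
  then show thesis using that True by (metis compactin_empty empty_iff)
next
  case False
  have "\<forall>x\<in>points M. \<exists>f K. f \<in> invariant_functions \<and> (\<forall>y\<in>points M. 0 \<le> f y) \<and> 0 < f x \<and> compactin (mtop M) K \<and>
      (\<forall>y\<in>points M. f y \<noteq> 0 \<longrightarrow> (\<exists>g\<in>carrier G. \<alpha> g y \<in> K))"
    using invariant_bump[OF openin_topspace] by metis
  then obtain F K where FK: "\<And>x. x \<in> points M \<Longrightarrow> F x \<in> invariant_functions \<and> (\<forall>y\<in>points M. 0 \<le> F x y) \<and> 0 < F x x \<and>
      compactin (mtop M) (K x) \<and> (\<forall>y\<in>points M. F x y \<noteq> 0 \<longrightarrow> (\<exists>g\<in>carrier G. \<alpha> g y \<in> K x))"
    by metis
  let ?S = "\<lambda>x. {y \<in> points M. F x y \<in> {0<..}}"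
  have oS: "openin (mtop M) (?S x)" if "x \<in> points M" for x
    by (rule openin_continuous_map_preimage[OF invariants_continuous]) (use FK[OF that] in auto)
  have "\<Union>(?S ` points M) = points M" using FK by auto
  moreover have "Lindelof_space (mtop M)"
    using manifold_M by (intro second_countable_imp_Lindelof_space) (simp add: smooth_manifold_def)
  ultimately have "\<exists>\<V>. countable \<V> \<and> \<V> \<subseteq> ?S ` points M \<and> \<Union>\<V> = points M"
    using oS by (intro Lindelof_spaceD) blast+
  then obtain \<V> where \<V>: "countable \<V>" "\<V> \<subseteq> ?S ` points M" "\<Union>\<V> = points M"
    by (elim exE conjE)
  then obtain D where D: "countable D" "D \<subseteq> points M" "\<V> = ?S ` D"
    using iffD1[OF countable_subset_image conjI[OF \<V>(1,2)]] by (elim exE conjE)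
  have Dne: "D \<noteq> {}" using \<V>(3) False unfolding D(3) by blast
  define f where "f = (\<lambda>n. F (from_nat_into D n))"
  define C where "C = (\<lambda>n. K (from_nat_into D n))"
  have nD: "from_nat_into D n \<in> points M" for n using from_nat_into[OF Dne] D(2) by blast
  have f: "f n \<in> invariant_functions" "y \<in> points M \<Longrightarrow> 0 \<le> f n y" "compactin (mtop M) (C n)"
    "y \<in> points M \<Longrightarrow> f n y \<noteq> 0 \<Longrightarrow> \<exists>g\<in>carrier G. \<alpha> g y \<in> C n" for n y
    using FK[OF nD[of n]] by (auto simp: f_def C_def)
  have cover: "\<exists>n. 0 < f n y" if "y \<in> points M" for y
  proof -
    have "y \<in> \<Union>(?S ` D)" using that \<V>(3) unfolding D(3) by simp
    then obtain d where "d \<in> D" "0 < F d y" by auto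
    then show ?thesis using from_nat_into_surj[OF D(1)] unfolding f_def by metis
  qed
  define s where "s = (\<lambda>n y. \<Sum>i\<le>n. f i y)"
  define \<theta> where "\<theta> = (\<lambda>n y. flat 1 (1 - real n * s n y))"
  define p where "p = (\<lambda>y\<in>points M. \<Sum>n. \<theta> n y)"
  have s_ge: "f i y \<le> s n y" if "y \<in> points M" "i \<le> n" for i n y
    unfolding s_def using f(2)[OF that(1)] that(2) by (intro member_le_sum) auto
  have \<theta>0: "\<theta> n y = 0" if y: "y \<in> points M" and d: "0 < d" "d < f i y" and n: "max i (nat \<lceil>1 / d\<rceil>) \<le> n" for n y i d
  proof -
    have "1 / d \<le> real n" using n by linarith
    then have "1 \<le> real n * d" using d by (simp add: field_simps)
    also have "\<dots> \<le> real n * s n y" using s_ge[OF y, of i n] n d by (intro mult_left_mono) auto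
    finally show ?thesis by (simp add: \<theta>_def flat_def)
  qed
  have \<theta>_tail: "\<theta> n y = 0"
    if h: "y \<in> points M" "0 < d" "d < f i y" and n: "n \<notin> {..<max i (nat \<lceil>1 / d\<rceil>)}" for n y i d
    by (rule \<theta>0[OF h]) (use n in \<open>simp only: lessThan_iff not_less\<close>)
  have p_sum: "p y = (\<Sum>n<max i (nat \<lceil>1 / d\<rceil>). \<theta> n y)" if h: "y \<in> points M" "0 < d" "d < f i y" for y i d
  proof -
    have "(\<Sum>n. \<theta> n y) = (\<Sum>n<max i (nat \<lceil>1 / d\<rceil>). \<theta> n y)"
      by (rule suminf_finite[OF finite_lessThan \<theta>_tail[OF h]])
    then show ?thesis using h(1) by (simp only: p_def restrict_apply' if_True)
  qed
  have "p \<in> invariant_functions"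
  proof (rule invariantsI)
    show "p \<in> extensional (points M)" by (simp add: p_def)
    show "p (\<alpha> g x) = p x" if "g \<in> carrier G" "x \<in> points M" for g x
      using that act_closed invariantsD(2)[OF f(1)] by (simp add: p_def \<theta>_def s_def)
    fix U \<phi> k assume U: "(U, \<phi>) \<in> atlas M"
    note DU = chart_onD[OF smooth_manifold_chart[OF manifold_M U]]
    show "Ck_on (mdim M) k (\<phi> ` U) (\<lambda>t. p (inv_into U \<phi> t))"
    proof (rule Ck_local[OF DU(3)])
      fix t0 assume t0: "t0 \<in> \<phi> ` U"
      have inU: "inv_into U \<phi> t \<in> points M" if "t \<in> \<phi> ` U" for t using that DU(2) inv_into_into by (metis subsetD)
      obtain i where i: "0 < f i (inv_into U \<phi> t0)" using cover inU t0 by blast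
      define d where "d = f i (inv_into U \<phi> t0) / 2"
      have d: "0 < d" "d < f i (inv_into U \<phi> t0)" using i by (auto simp: d_def)
      let ?E = "subtopology (Euclidean_space (mdim M)) (\<phi> ` U)"
      have tE: "topspace ?E = \<phi> ` U" using DU(4) by auto
      define W where "W = {t \<in> \<phi> ` U. f i (inv_into U \<phi> t) \<in> {d<..}}"
      have "openin ?E {t \<in> topspace ?E. f i (inv_into U \<phi> t) \<in> {d<..}}"
        by (rule openin_continuous_map_preimage[OF Ck_continuous[OF invariantsD(3)[OF f(1) U, of 0]]]) simp
      then have W: "openin (Euclidean_space (mdim M)) W"
        unfolding W_def tE using DU(3) openin_trans_full by blast
      have WU: "W \<subseteq> \<phi> ` U" by (auto simp: W_def)
      have "Ck_on (mdim M) k W (\<lambda>t. \<Sum>n<max i (nat \<lceil>1 / d\<rceil>). \<theta> n (inv_into U \<phi> t))"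
        unfolding \<theta>_def s_def
        by (intro Ck_sum[OF W] Ck_flat[OF W] Ck_diff[OF W] Ck_mult[OF W] Ck_const[OF W] finite_lessThan finite_atMost
            Ck_subset[OF invariantsD(3)[OF f(1) U] WU])
      then have "Ck_on (mdim M) k W (\<lambda>t. p (inv_into U \<phi> t))"
        by (rule Ck_cong[OF W, rotated]) (use p_sum[OF _ d(1)] inU in \<open>auto simp: W_def\<close>)
      moreover have "t0 \<in> W" using t0 d by (simp add: W_def)
      ultimately show "\<exists>V. openin (Euclidean_space (mdim M)) V \<and> t0 \<in> V \<and> Ck_on (mdim M) k V (\<lambda>t. p (inv_into U \<phi> t))"
        using W by blast
    qed
  qed
  moreover have "\<exists>C. compactin (mtop M) C \<and> (\<forall>y\<in>points M. p y \<le> c \<longrightarrow> (\<exists>g\<in>carrier G. \<alpha> g y \<in> C))" for c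
  proof -
    obtain N :: nat where N: "c < real N * exp (- 1)" using ex_less_of_nat_mult[of "exp (- 1) :: real" c] by auto
    show ?thesis
    proof (intro exI[of _ "\<Union>(C ` {..<N})"] conjI ballI impI)
      show "compactin (mtop M) (\<Union>(C ` {..<N}))" using f(3) by (intro compactin_Union) auto
      fix y assume y: "y \<in> points M" and c: "p y \<le> c"
      show "\<exists>g\<in>carrier G. \<alpha> g y \<in> \<Union>(C ` {..<N})"
      proof (rule ccontr)
        assume no: "\<not> ?thesis"
        have "f i y = 0" if "i < N" for i using f(4)[OF y, of i] no that by blast
        then have "\<theta> n y = exp (- 1)" if "n < N" for n using that by (simp add: \<theta>_def s_def flat_def)
        then have "real N * exp (- 1) = (\<Sum>n<N. \<theta> n y)" by simp
        also have "\<dots> \<le> p y"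
        proof -
          obtain i where i: "0 < f i y" using cover[OF y] by blast
          have "summable (\<lambda>n. \<theta> n y)"
            by (rule summable_finite[OF finite_lessThan \<theta>_tail[OF y, of "f i y / 2" i]]) (use i in simp_all)
          then have "(\<Sum>n<N. \<theta> n y) \<le> (\<Sum>n. \<theta> n y)" by (rule sum_le_suminf) (auto simp: \<theta>_def flat_def)
          then show ?thesis using y by (simp add: p_def)
        qed
        finally show False using c N by simp
      qed
    qed
  qed
  ultimately show thesis using that by blast
qed

text \<open>
  Otherwise each point \<open>x\<close> has an invariant function with \<open>a x \<noteq> h a\<close>. On the set where \<open>p \<le> h p\<close>, for an
  exhaustion function \<open>p\<close>, finitely many of them suffice by compactness modulo \<open>G\<close>. The function \<open>b\<close>,
  the sum of the squares of \<open>p - h p\<close> and of these \<open>a - h a\<close>, has no zero, so it is invertible in the ring,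
  but \<open>h b = 0\<close>, as \<open>h\<close> commutes with the smooth operation \<open>Q\<close> that defines \<open>b\<close>.
\<close>

lemma hom_is_evaluation:
  assumes h: "h \<in> cinf_hom \<A> real_cinf_ring"
  obtains x where "x \<in> points M" "h = (\<lambda>a\<in>invariant_functions. a x)"
proof -
  have "\<exists>x\<in>points M. \<forall>a\<in>invariant_functions. h a = a x"
  proof (rule ccontr)
    assume "\<not> ?thesis"
    then obtain a where a: "\<And>x. x \<in> points M \<Longrightarrow> a x \<in> invariant_functions" "\<And>x. x \<in> points M \<Longrightarrow> h (a x) \<noteq> a x x"
      by metis
    obtain p where p: "p \<in> invariant_functions"
      "\<And>c. \<exists>C. compactin (mtop M) C \<and> (\<forall>y\<in>points M. p y \<le> c \<longrightarrow> (\<exists>g\<in>carrier G. \<alpha> g y \<in> C))"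
      using exhaustion_function by blast
    obtain C where C: "compactin (mtop M) C" "\<forall>y\<in>points M. p y \<le> h p \<longrightarrow> (\<exists>g\<in>carrier G. \<alpha> g y \<in> C)"
      using p(2) by blast
    have CM: "C \<subseteq> points M" by (rule compactin_subset_topspace[OF C(1)])
    have "\<exists>F. finite F \<and> F \<subseteq> C \<and> C \<subseteq> (\<Union>x\<in>F. {y \<in> points M. a x y \<in> - {h (a x)}})"
    proof (rule compactin_finite_subcover[OF C(1)])
      show "openin (mtop M) {y \<in> points M. a x y \<in> - {h (a x)}}" if "x \<in> C" for x
        by (rule openin_continuous_map_preimage[OF invariants_continuous]) (use that CM a(1) in auto)
      show "C \<subseteq> (\<Union>x\<in>C. {y \<in> points M. a x y \<in> - {h (a x)}})"
      proof
        fix x assume "x \<in> C"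
        then have "x \<in> {y \<in> points M. a x y \<in> - {h (a x)}}" using CM a(2)[of x] by auto
        then show "x \<in> (\<Union>x\<in>C. {y \<in> points M. a x y \<in> - {h (a x)}})" using \<open>x \<in> C\<close> by (rule UN_I[rotated])
      qed
    qed
    then obtain F where F: "finite F" "F \<subseteq> C" "C \<subseteq> (\<Union>x\<in>F. {y \<in> points M. a x y \<in> - {h (a x)}})"
      by (elim exE conjE)
    obtain xs where xs: "set xs = F" using finite_list[OF F(1)] by blast
    define as where "as = p # map a xs"
    have aF: "a x \<in> invariant_functions" if "x \<in> F" for x using a(1) F(2) CM that by blast
    have as: "as \<in> lists invariant_functions" using p(1) aF xs by (auto simp: as_def)
    define Q where "Q = (\<lambda>v. \<Sum>j<length as. (v j - h (as ! j))\<^sup>2)"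
    have Q: "Ck_on (length as) k (Rn (length as)) Q" for k
      unfolding Q_def by (intro Ck_sum Ck_power Ck_diff Ck_coord Ck_const) auto
    define b where "b = (\<lambda>x\<in>points M. Q (vec_of_list (map (\<lambda>a. a x) as)))"
    have b: "b \<in> invariant_functions" "h b = Q (vec_of_list (map h as))"
      unfolding b_def by (rule hom_smooth_operation[OF h as Q])+
    have hb: "h b = 0" unfolding b(2) Q_def vec_of_list_def by simp
    have b_eq: "b y = (\<Sum>j<length as. ((as ! j) y - h (as ! j))\<^sup>2)" if "y \<in> points M" for y
      using that by (simp add: b_def Q_def vec_of_list_def)
    have b_ne: "b y \<noteq> 0" if y: "y \<in> points M" for y
    proof
      assume "b y = 0"
      then have z: "\<forall>j<length as. (as ! j) y = h (as ! j)"
        unfolding b_eq[OF y] by (subst (asm) sum_nonneg_eq_0_iff) auto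
      then have eq: "c y = h c" if "c \<in> set as" for c using that by (metis in_set_conv_nth)
      then have "p y \<le> h p" by (simp add: as_def)
      then obtain g where g: "g \<in> carrier G" "\<alpha> g y \<in> C" using C(2) y by blast
      then obtain x where x: "x \<in> F" "a x (\<alpha> g y) \<noteq> h (a x)" using F(3) by auto
      have "a x (\<alpha> g y) = a x y" using invariantsD(2)[OF aF[OF x(1)] g(1) y] .
      moreover have "a x y = h (a x)" using eq x(1) xs by (simp add: as_def)
      ultimately show False using x(2) by simp
    qed
    define ib where "ib = (\<lambda>x\<in>points M. inverse (b x))"
    have ib: "ib \<in> invariant_functions"
    proof (rule invariantsI)
      show "ib (\<alpha> g x) = ib x" if "g \<in> carrier G" "x \<in> points M" for g x
        using that act_closed invariantsD(2)[OF b(1)] by (simp add: ib_def)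
      fix U \<phi> k assume U: "(U, \<phi>) \<in> atlas M"
      note DU = chart_onD[OF smooth_manifold_chart[OF manifold_M U]]
      have inU: "inv_into U \<phi> t \<in> points M" if "t \<in> \<phi> ` U" for t using that DU(2) inv_into_into by (metis subsetD)
      have "Ck_on (mdim M) k (\<phi> ` U) (\<lambda>t. inverse (b (inv_into U \<phi> t)))"
        by (rule Ck_inverse[OF DU(3) invariantsD(3)[OF b(1) U]]) (use b_ne inU in blast)
      then show "Ck_on (mdim M) k (\<phi> ` U) (\<lambda>t. ib (inv_into U \<phi> t))"
        by (rule Ck_cong[OF DU(3), rotated]) (simp add: ib_def inU)
    qed (simp add: ib_def)
    have L: "[b, ib] \<in> lists invariant_functions" "[] \<in> lists invariant_functions" using b ib by auto
    have mult: "h (\<lambda>x\<in>points M. vec_of_list (map (\<lambda>a. a x) [b, ib]) 0 * vec_of_list (map (\<lambda>a. a x) [b, ib]) 1)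
        = vec_of_list (map h [b, ib]) 0 * vec_of_list (map h [b, ib]) 1"
      by (rule hom_smooth_operation(2)[OF h L(1), where F = "\<lambda>v. v 0 * v 1"])
         (intro Ck_mult Ck_coord; simp)
    have one: "h (\<lambda>x\<in>points M. 1) = 1"
      by (rule hom_smooth_operation(2)[OF h L(2), where F = "\<lambda>v. 1"]) (intro Ck_const; simp)
    have "(\<lambda>x\<in>points M. vec_of_list (map (\<lambda>a. a x) [b, ib]) 0 * vec_of_list (map (\<lambda>a. a x) [b, ib]) 1) = (\<lambda>x\<in>points M. 1)"
      using b_ne by (auto simp: vec_of_list_def ib_def intro!: restrict_ext)
    then have "1 = vec_of_list (map h [b, ib]) 0 * vec_of_list (map h [b, ib]) 1" using mult one by simp
    then show False using hb by (simp add: vec_of_list_def)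
  qed
  then obtain x where x: "x \<in> points M" "\<forall>a\<in>invariant_functions. h a = a x" by blast
  have "h \<in> extensional invariant_functions"  using h by (auto simp: cinf_hom_def PiE_def)
  then have "h = (\<lambda>a\<in>invariant_functions. a x)"
    by (rule extensionalityI[OF _ restrict_extensional]) (simp add: x(2))
  then show thesis using that x(1) by blast
qed

lemma openin_space_of_points:
  "openin (space_of_points \<A>) = arbitrary union_of
       (\<lambda>U. \<exists>a\<in>invariant_functions. U = {x \<in> cinf_hom \<A> real_cinf_ring. x a \<noteq> 0})"
  unfolding space_of_points_def by (rule topology_inverse'[OF space_of_points_basis(1)[OF cinf_ring_A]])

text \<open>
  Evaluation is open: if \<open>f\<close> is an invariant bump at \<open>x \<in> W\<close> inside \<open>W\<close>, then every point at which \<open>f\<close>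
  does not vanish has a translate in \<open>W\<close>, so the basic open set of \<open>f\<close> lies in the image of \<open>W\<close>.
\<close>

theorem evaluation_quotient_map:
  "quotient_map (mtop M) (space_of_points \<A>) (\<lambda>x. \<lambda>a\<in>invariant_functions. a x)"
proof (rule continuous_open_imp_quotient_map)
  let ?e = "\<lambda>x. \<lambda>a\<in>invariant_functions. a x"
  let ?X = "cinf_hom \<A> real_cinf_ring"
  have tX: "topspace (space_of_points \<A>) = ?X" by (rule space_of_points_basis(2)[OF cinf_ring_A])
  show "?e ` points M = topspace (space_of_points \<A>)"
    unfolding tX
  proof (intro subset_antisym image_subsetI subsetI)
    show "?e x \<in> ?X" if "x \<in> points M" for x by (rule evaluation_hom[OF that])
    show "h \<in> ?e ` points M" if "h \<in> ?X" for h using hom_is_evaluation[OF that] by blast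
  qed
  show "continuous_map (mtop M) (space_of_points \<A>) ?e"
    unfolding continuous_map_def tX
  proof (intro conjI allI impI)
    show "?e \<in> points M \<rightarrow> ?X" using evaluation_hom by blast
    fix U assume "openin (space_of_points \<A>) U"
    then obtain \<U> where \<U>: "\<And>V. V \<in> \<U> \<Longrightarrow> \<exists>a\<in>invariant_functions. V = {x \<in> ?X. x a \<noteq> 0}" "\<Union>\<U> = U"
      unfolding openin_space_of_points union_of_def by auto
    have "openin (mtop M) {x \<in> points M. ?e x \<in> V}" if V: "V \<in> \<U>" for V
    proof -
      obtain a where a: "a \<in> invariant_functions" "V = {x \<in> ?X. x a \<noteq> 0}" using \<U>(1)[OF V] by blast
      have "{x \<in> points M. ?e x \<in> V} = {x \<in> points M. a x \<in> - {0}}"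
        using evaluation_hom a by auto
      moreover have "openin (mtop M) {x \<in> points M. a x \<in> - {0}}"
        by (rule openin_continuous_map_preimage[OF invariants_continuous[OF a(1)]]) auto
      ultimately show ?thesis by simp
    qed
    then have "openin (mtop M) (\<Union>V\<in>\<U>. {x \<in> points M. ?e x \<in> V})" by blast
    moreover have "(\<Union>V\<in>\<U>. {x \<in> points M. ?e x \<in> V}) = {x \<in> points M. ?e x \<in> U}" using \<U>(2) by blast
    ultimately show "openin (mtop M) {x \<in> points M. ?e x \<in> U}" by simp
  qed
  show "open_map (mtop M) (space_of_points \<A>) ?e"
    unfolding open_map_def
  proof (intro allI impI)
    fix W assume W: "openin (mtop M) W"
    have WM: "W \<subseteq> points M" by (rule openin_subset[OF W])
    have "\<exists>T. openin (space_of_points \<A>) T \<and> ?e x \<in> T \<and> T \<subseteq> ?e ` W" if x: "x \<in> W" for x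
    proof -
      obtain f K where f: "f \<in> invariant_functions" "0 < f x"
        and K: "K \<subseteq> W" "\<And>y. y \<in> points M \<Longrightarrow> f y \<noteq> 0 \<Longrightarrow> \<exists>g\<in>carrier G. \<alpha> g y \<in> K"
        using invariant_bump[OF W x] by metis
      let ?T = "{z \<in> ?X. z f \<noteq> 0}"
      have "openin (space_of_points \<A>) ?T"
        unfolding openin_space_of_points by (rule arbitrary_union_of_inc) (use f(1) in blast)
      moreover have "?e x \<in> ?T" using f evaluation_hom x WM by auto
      moreover have "?T \<subseteq> ?e ` W"
      proof
        fix z assume z: "z \<in> ?T"
        then obtain y where y: "y \<in> points M" "z = ?e y" using hom_is_evaluation by blast
        then have "f y \<noteq> 0" using z f(1) by simp
        then obtain g where g: "g \<in> carrier G" "\<alpha> g y \<in> K" using K(2) y(1) by blast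
        then have "?e y = ?e (\<alpha> g y)" by (intro restrict_ext) (simp add: invariantsD(2) g(1) y(1))
        then show "z \<in> ?e ` W" using y(2) g(2) K(1) by blast
      qed
      ultimately show ?thesis by blast
    qed
    then show "openin (space_of_points \<A>) (?e ` W)"
      by (subst openin_subopen) blast
  qed
qed

theorem space_of_points_homeomorphic_orbit_space:
  "space_of_points \<A> homeomorphic_space orbit_space G M \<alpha>"
  unfolding orbit_space_def
  using quotient_maps_same_fibres_homeomorphic[OF evaluation_quotient_map quotient_map_quotient_topology] same_orbit_iff
  by blast

end

theorem lemma5p10:
  fixes G :: "('g, 'z) monoid_scheme" and L :: "'g manifold"
    and M :: "'m manifold" and \<alpha> :: "'g \<Rightarrow> 'm \<Rightarrow> 'm"
  assumes "lie_group G L"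
    and "smooth_manifold M"
    and "proper_action G L M \<alpha>"
  shows "space_of_points (invariant_cinf_ring G M \<alpha>) homeomorphic_space orbit_space G M \<alpha>"
  using proper_lie_action.space_of_points_homeomorphic_orbit_space[OF proper_lie_action.intro[OF assms]] .

end
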